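(* Let $\mathcal A$ be a unital $C^*$-algebra, $L$ a partially-defined $L$-seminorm on $\mathcal A$, and $p\in[1,\infty)$. Consider the diagrams $\{(S(\mathcal A_\alpha),d_{L,\alpha})\}_\alpha$ and $\{(S(\mathcal A_\alpha),W_{p,\alpha})\}_\alpha$ in the category $\mathbf{CCHpd_{con}}$, indexed by all unital commutative $C^*$-subalgebras $\mathcal A_\alpha$ of $\mathcal A$, with morphisms the restriction maps $S(\mathcal A_\beta)\to S(\mathcal A_\alpha)$, $\mu_\beta\mapsto\mu_\beta|_{\mathcal A_\alpha}$, for $\mathcal A_\alpha\subseteq\mathcal A_\beta$. Then the projective limits of these diagrams in $\mathbf{CCHpd_{con}}$ are, respectively, $(QS(\mathcal A),d_L)$ and $(QS(\mathcal A),\underleftarrow{W}_p)$, with the restriction maps $\mu\mapsto\mu|_{\mathcal A_\alpha}$ as projections.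
   Context: The category $\mathbf{CCHpd_{con}}$: objects are pairs $(K,d)$ with $K$ a convex set carrying a compact Hausdorff topology for which $(a,b)\mapsto ta+(1-t)b$ is continuous on $K\times K$ for each $t\in[0,1]$, and $d$ a $[0,\infty]$-valued pseudo-distance on $K$ (symmetric, zero on the diagonal, triangle inequality; may vanish on distinct points). Morphisms $(K_1,d_1)\to(K_2,d_2)$ are continuous affine maps $f$ with $d_2(f(x),f(y))\le d_1(x,y)$ for all $x,y$. $\mathcal A^{sa}$ is the set of self-adjoint elements. Unital commutative $C^*$-subalgebras $\mathcal A_\alpha\subseteq\mathcal A$ contain the unit of $\mathcal A$; $S(\mathcal A_\alpha)$ is the state space with the weak$^*$-topology; $X_\alpha$ is the Gelfand spectrum of $\mathcal A_\alpha$ (identified with the pure states), and states of $\mathcal A_\alpha$ are identified with Radon probability measures on $X_\alpha$. A quasi-state on $\mathcal A$ is a map $\mu:\mathcal A\to\mathbb C$ that is linear on every unital commutative $C^*$-subalgebra, satisfies $\mu(a+ib)=\mu(a)+i\mu(b)$ for $a,b\in\mathcal A^{sa}$, $\mu(a^*a)\ge0$ for all $a$, and $\mu(1)=1$; $QS(\mathcal A)$ is the set of quasi-states with pointwise convex structure and the coarsest topology making all restriction maps $QS(\mathcal A)\to S(\mathcal A_\alpha)$ continuous. A partially-defined $L$-seminorm on $\mathcal A$ is a map $L:\mathcal A^{sa}\to[0,+\infty]$ with $L(af)=|a|L(f)$ for $a\in\mathbb R$ (with $0\cdot\infty=0$), $L(f+g)\le L(f)+L(g)$, $L(1)=0$.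 Define $d_L(\mu,\nu):=\sup\{|\mu(f)-\nu(f)|:f\in\mathcal A^{sa},L(f)\le1\}$ on $QS(\mathcal A)$; $d_{L,\alpha}(\mu_\alpha,\nu_\alpha):=\sup\{|\mu_\alpha(f)-\nu_\alpha(f)|:f\in\mathcal A_\alpha^{sa},L(f)\le1\}$ on $S(\mathcal A_\alpha)$; $W_{p,\alpha}(\mu_\alpha,\nu_\alpha):=\inf_\pi\big(\int_{X_\alpha\times X_\alpha} d_{L,\alpha}^p(x,y)\,d\pi\big)^{1/p}$, the infimum over Radon probability measures $\pi$ on $X_\alpha\times X_\alpha$ with marginals $\mu_\alpha,\nu_\alpha$; and $\underleftarrow{W}_p(\mu,\nu):=\sup_\alpha W_{p,\alpha}(\mu|_{\mathcal A_\alpha},\nu|_{\mathcal A_\alpha})$ on $QS(\mathcal A)$, the supremum over all unital commutative $C^*$-subalgebras. *)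

theory Defs
  imports "HOL-Analysis.Analysis" "HOL-Library.Function_Algebras"
begin

section \<open>Unital C*-algebras\<close>

text \<open>Only \<open>monoid_mult\<close> is required, not \<open>ring_1\<close>: the zero algebra is not excluded.
  In every other case \<open>norm 1 = 1\<close> follows from the C*-identity.\<close>

class cstar_algebra = real_normed_algebra + banach + monoid_mult +
  fixes scaleC :: "complex \<Rightarrow> 'a \<Rightarrow> 'a" (infixr \<open>*\<^sub>C\<close> 75)
    and star :: "'a \<Rightarrow> 'a"
  assumes scaleC_add_right: "c *\<^sub>C (x + y) = c *\<^sub>C x + c *\<^sub>C y"
    and scaleC_add_left: "(c + d) *\<^sub>C x = c *\<^sub>C x + d *\<^sub>C x"
    and scaleC_scaleC: "c *\<^sub>C d *\<^sub>C x = (c * d) *\<^sub>C x"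
    and scaleR_scaleC: "r *\<^sub>R x = complex_of_real r *\<^sub>C x"
    and mult_scaleC_left: "(c *\<^sub>C x) * y = c *\<^sub>C (x * y)"
    and mult_scaleC_right: "x * (c *\<^sub>C y) = c *\<^sub>C (x * y)"
    and norm_scaleC: "norm (c *\<^sub>C x) = cmod c * norm x"
    and star_star: "star (star x) = x"
    and star_add: "star (x + y) = star x + star y"
    and star_scaleC: "star (c *\<^sub>C x) = cnj c *\<^sub>C star x"
    and star_mult: "star (x * y) = star y * star x"
    and cstar_identity: "norm (star x * x) = (norm x)\<^sup>2"

definition self_adjoint :: "'a::cstar_algebra set" where
  "self_adjoint = {f. star f = f}"

definition comm_subalgs :: "'a::cstar_algebra set set" where
  "comm_subalgs = {B. closed B \<and> 1 \<in> B \<and>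
     (\<forall>a\<in>B. \<forall>b\<in>B. a + b \<in> B \<and> a * b \<in> B \<and> a * b = b * a) \<and>
     (\<forall>a\<in>B. star a \<in> B \<and> (\<forall>c. c *\<^sub>C a \<in> B))}"

definition clinear_on :: "'a::cstar_algebra set \<Rightarrow> ('a \<Rightarrow> complex) \<Rightarrow> bool" where
  "clinear_on B \<mu> \<longleftrightarrow>
     (\<forall>a\<in>B. \<forall>b\<in>B. \<mu> (a + b) = \<mu> a + \<mu> b) \<and> (\<forall>c. \<forall>a\<in>B. \<mu> (c *\<^sub>C a) = c * \<mu> a)"


section \<open>States, quasi-states and the Gelfand spectrum\<close>

text \<open>Scalar-valued functions form a real vector space under the pointwise operations.
  Addition is that of \<^theory>\<open>HOL-Library.Function_Algebras\<close>.\<close>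

instantiation "fun" :: (type, real_vector) real_vector
begin

definition scaleR_fun :: "real \<Rightarrow> ('a \<Rightarrow> 'b) \<Rightarrow> 'a \<Rightarrow> 'b" where
  "scaleR_fun r f = (\<lambda>x. r *\<^sub>R f x)"

instance
  by standard (simp_all add: scaleR_fun_def plus_fun_def fun_eq_iff scaleR_add_left scaleR_add_right)

end

definition initial_topology ::
    "'k set \<Rightarrow> 'i set \<Rightarrow> ('i \<Rightarrow> 'k \<Rightarrow> 'b) \<Rightarrow> ('i \<Rightarrow> 'b topology) \<Rightarrow> 'k topology" where
  "initial_topology S I f T =
     topology_generated_by (insert S {{x \<in> S. f i x \<in> U} | i U. i \<in> I \<and> openin (T i) U})"

text \<open>A functional on a subalgebra \<open>B\<close> is encoded as a function on the whole algebra that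
  vanishes outside \<open>B\<close>. Such functions are a linear subspace of the function space,
  so convex combinations are the pointwise ones.\<close>

definition restrict_to :: "'a set \<Rightarrow> ('a \<Rightarrow> complex) \<Rightarrow> 'a \<Rightarrow> complex" where
  "restrict_to B \<mu> = (\<lambda>a. if a \<in> B then \<mu> a else 0)"

definition states :: "'a::cstar_algebra set \<Rightarrow> ('a \<Rightarrow> complex) set" where
  "states B = {\<mu>. (\<forall>a. a \<notin> B \<longrightarrow> \<mu> a = 0) \<and> clinear_on B \<mu> \<and>
     (\<forall>a\<in>B. \<mu> (star a * a) \<in> \<real>\<^sub>\<ge>\<^sub>0) \<and> \<mu> 1 = 1}"

definition state_space :: "'a::cstar_algebra set \<Rightarrow> ('a \<Rightarrow> complex) topology" where
  "state_space B = initial_topology (states B) B (\<lambda>a \<mu>. \<mu> a) (\<lambda>_. euclidean)"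

definition characters :: "'a::cstar_algebra set \<Rightarrow> ('a \<Rightarrow> complex) set" where
  "characters B = {\<omega>. (\<forall>a. a \<notin> B \<longrightarrow> \<omega> a = 0) \<and> clinear_on B \<omega> \<and>
     (\<forall>a\<in>B. \<forall>b\<in>B. \<omega> (a * b) = \<omega> a * \<omega> b) \<and> \<omega> 1 = 1}"

definition spectrum :: "'a::cstar_algebra set \<Rightarrow> ('a \<Rightarrow> complex) topology" where
  "spectrum B = initial_topology (characters B) B (\<lambda>a \<omega>. \<omega> a) (\<lambda>_. euclidean)"

definition quasi_states :: "('a::cstar_algebra \<Rightarrow> complex) set" where
  "quasi_states = {\<mu>. (\<forall>B\<in>comm_subalgs. clinear_on B \<mu>) \<and>
     (\<forall>a\<in>self_adjoint. \<forall>b\<in>self_adjoint. \<mu> (a + \<i> *\<^sub>C b) = \<mu> a + \<i> * \<mu> b) \<and>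
     (\<forall>a. \<mu> (star a * a) \<in> \<real>\<^sub>\<ge>\<^sub>0) \<and> \<mu> 1 = 1}"

definition quasi_state_space :: "('a::cstar_algebra \<Rightarrow> complex) topology" where
  "quasi_state_space = initial_topology quasi_states comm_subalgs restrict_to state_space"


section \<open>Radon probability measures\<close>

definition borel_on :: "'b topology \<Rightarrow> 'b measure" where
  "borel_on X = sigma (topspace X) {U. openin X U}"

definition radon_prob :: "'b topology \<Rightarrow> 'b measure \<Rightarrow> bool" where
  "radon_prob X m \<longleftrightarrow> sets m = sets (borel_on X) \<and> emeasure m (space m) = 1 \<and>
     (\<forall>E\<in>sets m. emeasure m E = (SUP K\<in>{K \<in> sets m. K \<subseteq> E \<and> compactin X K}. emeasure m K))"

text \<open>The identification of states of \<open>B\<close> with Radon probability measures on its spectrum.\<close>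

definition represents ::
    "'a::cstar_algebra set \<Rightarrow> ('a \<Rightarrow> complex) measure \<Rightarrow> ('a \<Rightarrow> complex) \<Rightarrow> bool" where
  "represents B m \<mu> \<longleftrightarrow> radon_prob (spectrum B) m \<and> (\<forall>a\<in>B. \<mu> a = (\<integral>\<omega>. \<omega> a \<partial>m))"

definition couplings :: "'a::cstar_algebra set \<Rightarrow> ('a \<Rightarrow> complex) \<Rightarrow> ('a \<Rightarrow> complex) \<Rightarrow>
    (('a \<Rightarrow> complex) \<times> ('a \<Rightarrow> complex)) measure set" where
  "couplings B \<mu> \<nu> = {\<pi>. radon_prob (prod_topology (spectrum B) (spectrum B)) \<pi> \<and>
     represents B (distr \<pi> (borel_on (spectrum B)) fst) \<mu> \<and>
     represents B (distr \<pi> (borel_on (spectrum B)) snd) \<nu>}"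


section \<open>L-seminorms and the associated pseudo-distances\<close>

text \<open>Only the values of \<open>L\<close> on self-adjoint elements matter.
  In \<^typ>\<open>ennreal\<close>, \<open>0 * \<infinity> = 0\<close>.\<close>

definition L_seminorm :: "('a::cstar_algebra \<Rightarrow> ennreal) \<Rightarrow> bool" where
  "L_seminorm L \<longleftrightarrow>
     (\<forall>t::real. \<forall>f\<in>self_adjoint. L (t *\<^sub>R f) = ennreal \<bar>t\<bar> * L f) \<and>
     (\<forall>f\<in>self_adjoint. \<forall>g\<in>self_adjoint. L (f + g) \<le> L f + L g) \<and> L 1 = 0"

text \<open>For a subalgebra \<open>B\<close> this is the pseudo-distance on states of \<open>B\<close>; for \<open>B = UNIV\<close> it is the one on quasi-states.\<close>

definition dist_L :: "('a::cstar_algebra \<Rightarrow> ennreal) \<Rightarrow> 'a set \<Rightarrow>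
    ('a \<Rightarrow> complex) \<Rightarrow> ('a \<Rightarrow> complex) \<Rightarrow> ennreal" where
  "dist_L L B \<mu> \<nu> = (SUP f\<in>{f \<in> B \<inter> self_adjoint. L f \<le> 1}. ennreal (cmod (\<mu> f - \<nu> f)))"

text \<open>Powers with a positive real exponent.\<close>

definition ennreal_powr :: "ennreal \<Rightarrow> real \<Rightarrow> ennreal" where
  "ennreal_powr x p = (if x = \<infinity> then \<infinity> else ennreal (enn2real x powr p))"

definition wasserstein :: "real \<Rightarrow> ('a::cstar_algebra \<Rightarrow> ennreal) \<Rightarrow> 'a set \<Rightarrow>
    ('a \<Rightarrow> complex) \<Rightarrow> ('a \<Rightarrow> complex) \<Rightarrow> ennreal" where
  "wasserstein p L B \<mu> \<nu> =
     (INF \<pi>\<in>couplings B \<mu> \<nu>.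
        ennreal_powr (\<integral>\<^sup>+(x, y). ennreal_powr (dist_L L B x y) p \<partial>\<pi>) (1 / p))"

definition wasserstein_QS :: "real \<Rightarrow> ('a::cstar_algebra \<Rightarrow> ennreal) \<Rightarrow>
    ('a \<Rightarrow> complex) \<Rightarrow> ('a \<Rightarrow> complex) \<Rightarrow> ennreal" where
  "wasserstein_QS p L \<mu> \<nu> =
     (SUP B\<in>comm_subalgs. wasserstein p L B (restrict_to B \<mu>) (restrict_to B \<nu>))"


section \<open>Compact convex Hausdorff spaces with a pseudo-distance, and contractions\<close>

text \<open>The underlying set of an object is the \<^const>\<open>topspace\<close> of its topology, a convex subset of
  an arbitrary real vector space. The topology need not come from the ambient space.\<close>

type_synonym 'k cchpd = "'k topology \<times> ('k \<Rightarrow> 'k \<Rightarrow> ennreal)"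

definition pseudo_dist_on :: "'k set \<Rightarrow> ('k \<Rightarrow> 'k \<Rightarrow> ennreal) \<Rightarrow> bool" where
  "pseudo_dist_on K d \<longleftrightarrow> (\<forall>x\<in>K. d x x = 0) \<and> (\<forall>x\<in>K. \<forall>y\<in>K. d x y = d y x) \<and>
     (\<forall>x\<in>K. \<forall>y\<in>K. \<forall>z\<in>K. d x z \<le> d x y + d y z)"

fun cchpd_obj :: "'k::real_vector cchpd \<Rightarrow> bool" where
  "cchpd_obj (T, d) \<longleftrightarrow> convex (topspace T) \<and> compact_space T \<and> Hausdorff_space T \<and>
     (\<forall>t\<in>{0..1}. continuous_map (prod_topology T T) T (\<lambda>(x, y). t *\<^sub>R x + (1 - t) *\<^sub>R y)) \<and>
     pseudo_dist_on (topspace T) d"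

fun cchpd_hom :: "'k::real_vector cchpd \<Rightarrow> 'l::real_vector cchpd \<Rightarrow> ('k \<Rightarrow> 'l) \<Rightarrow> bool" where
  "cchpd_hom (S, d) (T, e) f \<longleftrightarrow> continuous_map S T f \<and>
     (\<forall>x\<in>topspace S. \<forall>y\<in>topspace S. \<forall>t\<in>{0..1}.
        f (t *\<^sub>R x + (1 - t) *\<^sub>R y) = t *\<^sub>R f x + (1 - t) *\<^sub>R f y) \<and>
     (\<forall>x\<in>topspace S. \<forall>y\<in>topspace S. e (f x) (f y) \<le> d x y)"

abbreviation carr :: "'k cchpd \<Rightarrow> 'k set" where
  "carr X \<equiv> topspace (fst X)"

text \<open>Diagrams over a preordered index set, contravariant: \<open>\<phi> j i : D j \<rightarrow> D i\<close> for \<open>le i j\<close>.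
  Morphisms are functions considered on the underlying set of their domain only.\<close>

definition cchpd_diagram :: "'i set \<Rightarrow> ('i \<Rightarrow> 'i \<Rightarrow> bool) \<Rightarrow> ('i \<Rightarrow> 'k::real_vector cchpd) \<Rightarrow>
    ('i \<Rightarrow> 'i \<Rightarrow> 'k \<Rightarrow> 'k) \<Rightarrow> bool" where
  "cchpd_diagram I le D \<phi> \<longleftrightarrow>
     (\<forall>i\<in>I. cchpd_obj (D i)) \<and>
     (\<forall>i\<in>I. \<forall>j\<in>I. le i j \<longrightarrow> cchpd_hom (D j) (D i) (\<phi> j i)) \<and>
     (\<forall>i\<in>I. \<forall>x\<in>carr (D i). \<phi> i i x = x) \<and>
     (\<forall>i\<in>I. \<forall>j\<in>I. \<forall>k\<in>I. le i j \<longrightarrow> le j k \<longrightarrow>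
        (\<forall>x\<in>carr (D k). \<phi> j i (\<phi> k j x) = \<phi> k i x))"

definition cchpd_cone :: "'i set \<Rightarrow> ('i \<Rightarrow> 'i \<Rightarrow> bool) \<Rightarrow> ('i \<Rightarrow> 'k::real_vector cchpd) \<Rightarrow>
    ('i \<Rightarrow> 'i \<Rightarrow> 'k \<Rightarrow> 'k) \<Rightarrow> 'c::real_vector cchpd \<Rightarrow> ('i \<Rightarrow> 'c \<Rightarrow> 'k) \<Rightarrow> bool" where
  "cchpd_cone I le D \<phi> X q \<longleftrightarrow>
     cchpd_obj X \<and> (\<forall>i\<in>I. cchpd_hom X (D i) (q i)) \<and>
     (\<forall>i\<in>I. \<forall>j\<in>I. le i j \<longrightarrow> (\<forall>x\<in>carr X. \<phi> j i (q j x) = q i x))"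

text \<open>The universal property is tested against cones whose apex lies in the real vector space
  \<open>'c\<close>. A theorem stated with \<open>'c\<close> as a type variable ranges over all such apices.\<close>

definition cchpd_limit :: "'c::real_vector itself \<Rightarrow> 'i set \<Rightarrow> ('i \<Rightarrow> 'i \<Rightarrow> bool) \<Rightarrow>
    ('i \<Rightarrow> 'k::real_vector cchpd) \<Rightarrow> ('i \<Rightarrow> 'i \<Rightarrow> 'k \<Rightarrow> 'k) \<Rightarrow>
    'l::real_vector cchpd \<Rightarrow> ('i \<Rightarrow> 'l \<Rightarrow> 'k) \<Rightarrow> bool" where
  "cchpd_limit (_ :: 'c itself) I le D \<phi> X q \<longleftrightarrow>
     cchpd_cone I le D \<phi> X q \<and>
     (\<forall>(Y :: 'c cchpd) r. cchpd_cone I le D \<phi> Y r \<longrightarrow>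
        (\<exists>h. cchpd_hom Y X h \<and> (\<forall>i\<in>I. \<forall>y\<in>carr Y. q i (h y) = r i y) \<and>
          (\<forall>h'. cchpd_hom Y X h' \<and> (\<forall>i\<in>I. \<forall>y\<in>carr Y. q i (h' y) = r i y) \<longrightarrow>
            (\<forall>y\<in>carr Y. h' y = h y))))"

end

theory Submission
  imports Defs "HOL-Probability.Probability_Measure"
begin

text \<open>A quasi-state is the same as a compatible family of states on the unital commutative
  subalgebras: every self-adjoint element lies in such a subalgebra, and the value at \<open>x + i y\<close>
  is determined by those at \<open>x\<close> and \<open>y\<close>. Positivity of the glued functional needs \<open>a\<^sup>* a = b\<^sup>2\<close> with
  \<open>b\<close> self-adjoint and commuting with \<open>a\<^sup>* a\<close>; this is obtained from norm estimates alone, the positive cone of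
  a commutative subalgebra being \<open>{x. \<parallel>t - x\<parallel> \<le> t for some t}\<close>. Both pseudo-distances on
  quasi-states are the suprema of those on the subalgebras, so the limit property is formal
  once the \<open>W\<^sub>p\<close> are known to be pseudo-distances contracted by restriction.

  The triangle inequality for \<open>W\<^sub>p\<close> requires gluing couplings on a compact space which need not be
  metrizable. The couplings define a positive functional on the functions \<open>f(x,y) + g(y,z)\<close>, which
  extends to all continuous functions by Hahn-Banach and is represented by a Radon measure.
  The same extension argument turns a state into a Radon measure on the
  spectrum, given that an element which is nonnegative at all characters is positive. The latter
  is Krivine's argument: a maximal proper preordering of the self-adjoint part is the
  nonnegativity set of a character.\<close>

section \<open>Positivity in C*-algebras\<close>

text \<open>The obstacle for quasi-states is that positivity is demanded at
  \<open>star a * a\<close> for every \<open>a\<close>, while a non-normal \<open>a\<close> lies in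
  no commutative subalgebra. The glued functional sees \<open>star a * a\<close> only through
  subalgebras containing that product, where it must be recognised as a square. The bridge is a norm
  bound that mentions no subalgebra: such bounds add up by the triangle inequality even for squares
  that do not commute. For the Wasserstein part the obstacle is measurability. Over a non-metrizable
  spectrum a disintegration need not be available, the Borel sets of a product may exceed the
  product sigma-algebra, and \<open>dist_L\<close> is a supremum over a possibly uncountable family.
  Hence couplings are Borel measures for the product topology, the cost is measurable by lower
  semicontinuity, and positivity of the functional to be extended reduces to one separating Borel
  function of the middle coordinate. Since functionals on a subalgebra vanish outside it, states,
  characters and quasi-states lie in one function space; their topologies are that of pointwise
  convergence, and compactness is Tychonoff's theorem.\<close>

lemma star_zero [simp]: "star (0::'a::cstar_algebra) = 0"
  using star_add[of "0::'a" 0] by simp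

lemma star_minus [simp]: "star (- x) = - star (x::'a::cstar_algebra)"
  using star_add[of x "- x"] by (simp add: eq_neg_iff_add_eq_0 add.commute)

lemma star_diff: "star (x - y) = star x - star (y::'a::cstar_algebra)"
  using star_add[of x "- y"] by simp

lemma star_one [simp]: "star (1::'a::cstar_algebra) = 1"
  by (metis mult_1_right star_mult star_star)

lemma star_scaleR: "star (r *\<^sub>R x) = r *\<^sub>R star (x::'a::cstar_algebra)"
  by (simp add: scaleR_scaleC star_scaleC)

lemma norm_star [simp]: "norm (star x) = norm (x::'a::cstar_algebra)"
proof -
  have le: "norm y \<le> norm (star y)" for y :: 'a
  proof (cases "norm y = 0")
    case False
    have "norm y * norm y \<le> norm (star y) * norm y"
      using cstar_identity[of y] norm_mult_ineq[of "star y" y] by (simp add: power2_eq_square)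
    then show ?thesis using False by (simp add: mult_le_cancel_right)
  qed simp
  show ?thesis using le[of x] le[of "star x"] by (simp add: star_star)
qed

lemma norm_self_adjoint_square: "star x = x \<Longrightarrow> norm (x * x) = (norm (x::'a::cstar_algebra))\<^sup>2"
  using cstar_identity[of x] by simp

text \<open>Only an inequality: the zero algebra is allowed, and there the unit has norm 0.\<close>

lemma norm_one_le: "norm (1::'a::cstar_algebra) \<le> 1"
proof -
  have "norm (1::'a) = (norm (1::'a))\<^sup>2"
    using cstar_identity[of "1::'a"] by simp
  then show ?thesis by (metis norm_ge_zero power2_eq_square mult_cancel_left1 order.refl zero_le_one)
qed

lemma bounded_linear_star: "bounded_linear (star :: 'a::cstar_algebra \<Rightarrow> 'a)"
  by (rule bounded_linear_intro[where K=1]) (simp_all add: star_add star_scaleR)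

lemma scaleC_one [simp]: "1 *\<^sub>C x = (x::'a::cstar_algebra)"
  using scaleR_scaleC[of 1 x] by simp

lemma scaleC_zero_right [simp]: "c *\<^sub>C (0::'a::cstar_algebra) = 0"
  using scaleC_add_right[of c "0::'a" 0] by simp

lemma scaleC_zero_left [simp]: "0 *\<^sub>C (x::'a::cstar_algebra) = 0"
  using scaleC_add_left[of 0 0 x] by simp

lemma scaleC_minus_left: "(- c) *\<^sub>C x = - (c *\<^sub>C (x::'a::cstar_algebra))"
  using scaleC_add_left[of c "- c" x] by (simp add: eq_neg_iff_add_eq_0 add.commute)

lemma scaleC_minus_right: "c *\<^sub>C (- x) = - (c *\<^sub>C (x::'a::cstar_algebra))"
  using scaleC_add_right[of c x "- x"] by (simp add: eq_neg_iff_add_eq_0 add.commute)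

lemma scaleC_diff_right: "c *\<^sub>C (x - y) = c *\<^sub>C x - c *\<^sub>C (y::'a::cstar_algebra)"
  using scaleC_add_right[of c x "- y"] by (simp add: scaleC_minus_right)

definition re_part :: "'a::cstar_algebra \<Rightarrow> 'a" where
  "re_part a = (1/2) *\<^sub>R (a + star a)"

definition im_part :: "'a::cstar_algebra \<Rightarrow> 'a" where
  "im_part a = (- \<i> / 2) *\<^sub>C (a - star a)"

lemma re_part_self_adjoint [simp]: "re_part a \<in> self_adjoint"
  by (simp add: re_part_def self_adjoint_def star_scaleR star_add star_star add.commute)

lemma im_part_self_adjoint [simp]: "im_part a \<in> self_adjoint"
proof -
  have "star (im_part a) = (\<i> / 2) *\<^sub>C (star a - a)"
    by (simp add: im_part_def star_scaleC star_diff star_star)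
  also have "\<dots> = im_part a"
    unfolding im_part_def by (simp add: scaleC_minus_left scaleC_diff_right)
  finally show ?thesis by (simp add: self_adjoint_def)
qed

lemma re_im_parts: "a = re_part a + \<i> *\<^sub>C im_part a"
proof -
  have "\<i> *\<^sub>C im_part a = (1/2) *\<^sub>C (a - star a)"
    unfolding im_part_def by (simp add: scaleC_scaleC)
  moreover have "re_part a = (1/2) *\<^sub>C (a + star a)"
    by (simp add: re_part_def scaleR_scaleC)
  moreover have "(1/2) *\<^sub>C a + (1/2) *\<^sub>C a = a"
    using scaleC_add_left[of "1/2" "1/2" a] by simp
  ultimately show ?thesis
    by (simp add: scaleC_diff_right scaleC_add_right)
qed

lemma re_im_parts_unique:
  assumes "x \<in> self_adjoint" "y \<in> self_adjoint"
  shows "re_part (x + \<i> *\<^sub>C y) = x" "im_part (x + \<i> *\<^sub>C y) = y"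
proof -
  have "star (x + \<i> *\<^sub>C y) = x - \<i> *\<^sub>C y"
    using assms by (simp add: self_adjoint_def star_add star_scaleC scaleC_minus_left)
  then show "re_part (x + \<i> *\<^sub>C y) = x" "im_part (x + \<i> *\<^sub>C y) = y"
    using scaleR_half_double[of x] scaleR_half_double[of y]
    by (simp_all add: re_part_def im_part_def scaleC_add_right scaleC_scaleC
        scaleC_add_left[symmetric] scaleR_2)
qed

lemma norm_re_part_le: "norm (re_part a) \<le> norm (a::'a::cstar_algebra)"
  using norm_triangle_ineq[of a "star a"] by (simp add: re_part_def)

lemma norm_im_part_le: "norm (im_part a) \<le> norm (a::'a::cstar_algebra)"
  using norm_triangle_ineq4[of a "star a"] by (simp add: im_part_def norm_scaleC norm_divide)

text \<open>The sequence \<open>z\<^sub>0 = 0\<close>, \<open>z\<^sub>n\<^sub>+\<^sub>1 = (y + z\<^sub>n\<^sup>2) / 2\<close> is dominated, together with its increments,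
  by the scalar sequence for \<open>y = 1\<close>. Its limit \<open>z\<close> satisfies \<open>(1 - z)\<^sup>2 = 1 - y\<close>.\<close>

primrec sqrt_iter :: "'a::real_normed_algebra \<Rightarrow> nat \<Rightarrow> 'a" where
  "sqrt_iter y 0 = 0"
| "sqrt_iter y (Suc n) = (1/2) *\<^sub>R (y + sqrt_iter y n * sqrt_iter y n)"

lemma sqrt_iter_one_bounds:
  "0 \<le> sqrt_iter (1::real) n \<and> sqrt_iter (1::real) n \<le> 1 \<and>
   sqrt_iter (1::real) n \<le> sqrt_iter 1 (Suc n)"
proof (induction n)
  case (Suc n)
  define u v where "u = sqrt_iter (1::real) n" and "v = sqrt_iter (1::real) (Suc n)"
  have u: "0 \<le> u" "u \<le> v" and v: "v = (1 + u * u) / 2" "v \<le> 1"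
    using Suc by (simp_all add: u_def v_def mult_le_one)
  have "sqrt_iter 1 (Suc (Suc n)) = (1 + v * v) / 2" by (simp add: v_def)
  moreover have "u * u \<le> v * v" using u by (simp add: mult_mono)
  ultimately show ?case using u v unfolding v_def[symmetric] by simp
qed simp

section \<open>Commutative subalgebras: square roots and the positive cone\<close>

locale comm_subalg =
  fixes B :: "'a::cstar_algebra set"
  assumes mem: "B \<in> comm_subalgs"
begin

lemma add_mem: "a \<in> B \<Longrightarrow> b \<in> B \<Longrightarrow> a + b \<in> B"
  and mult_mem: "a \<in> B \<Longrightarrow> b \<in> B \<Longrightarrow> a * b \<in> B"
  and commute: "a \<in> B \<Longrightarrow> b \<in> B \<Longrightarrow> a * b = b * a"
  and star_mem: "a \<in> B \<Longrightarrow> star a \<in> B"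
  and scaleC_mem: "a \<in> B \<Longrightarrow> c *\<^sub>C a \<in> B"
  and one_mem: "1 \<in> B"
  and closed: "closed B"
  using mem by (auto simp: comm_subalgs_def)

lemma scaleR_mem: "a \<in> B \<Longrightarrow> r *\<^sub>R a \<in> B"
  by (simp add: scaleR_scaleC scaleC_mem)

lemma minus_mem: "a \<in> B \<Longrightarrow> - a \<in> B"
  using scaleR_mem[of a "-1"] by simp

lemma diff_mem: "a \<in> B \<Longrightarrow> b \<in> B \<Longrightarrow> a - b \<in> B"
  using add_mem[of a "- b"] minus_mem by simp

lemma zero_mem: "0 \<in> B"
  using scaleR_mem[OF one_mem, of 0] by simp

definition sa :: "'a set" where "sa = B \<inter> self_adjoint"

lemma sa_mem: "a \<in> sa \<Longrightarrow> a \<in> B"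
  and sa_star: "a \<in> sa \<Longrightarrow> star a = a"
  and saI: "a \<in> B \<Longrightarrow> star a = a \<Longrightarrow> a \<in> sa"
  by (auto simp: sa_def self_adjoint_def)

lemma sa_add: "a \<in> sa \<Longrightarrow> b \<in> sa \<Longrightarrow> a + b \<in> sa"
  and sa_diff: "a \<in> sa \<Longrightarrow> b \<in> sa \<Longrightarrow> a - b \<in> sa"
  and sa_minus: "a \<in> sa \<Longrightarrow> - a \<in> sa"
  and sa_scaleR: "a \<in> sa \<Longrightarrow> r *\<^sub>R a \<in> sa"
  and sa_one: "1 \<in> sa"
  and sa_zero: "0 \<in> sa"
  by (auto simp: sa_def self_adjoint_def add_mem diff_mem minus_mem scaleR_mem one_mem zero_mem
      star_add star_diff star_scaleR)

lemma sa_commute: "a \<in> sa \<Longrightarrow> b \<in> sa \<Longrightarrow> a * b = b * a"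
  by (simp add: commute sa_mem)

lemma sa_mult: "a \<in> sa \<Longrightarrow> b \<in> sa \<Longrightarrow> a * b \<in> sa"
  by (auto intro!: saI simp: mult_mem sa_mem star_mult sa_star sa_commute)

lemmas sa_intros = sa_add sa_diff sa_minus sa_scaleR sa_one sa_zero sa_mult

lemma re_part_sa: "a \<in> B \<Longrightarrow> re_part a \<in> sa"
  unfolding sa_def using re_part_self_adjoint[of a] by (simp add: re_part_def scaleR_mem add_mem star_mem)

lemma im_part_sa: "a \<in> B \<Longrightarrow> im_part a \<in> sa"
  unfolding sa_def using im_part_self_adjoint[of a] by (simp add: im_part_def scaleC_mem diff_mem star_mem)

lemma closed_sa: "closed sa"
proof -
  have "closed {a::'a. star a = a}"
    by (intro closed_Collect_eq continuous_intros linear_continuous_on bounded_linear_star)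
  then show ?thesis
    by (simp add: sa_def self_adjoint_def closed closed_Int)
qed

lemma sqrt_iter_sa: "y \<in> sa \<Longrightarrow> sqrt_iter y n \<in> sa"
  by (induction n) (auto intro!: sa_intros)

text \<open>Domination needs only that the scalar sequence is bounded, so the boundary case
  \<open>norm y = 1\<close> is covered. The bound on \<open>1 - s\<close> makes the root itself
  positive by the norm criterion below, which \<open>abs_exists\<close> relies on.\<close>

lemma sqrt_exists:
  assumes y: "y \<in> sa" "norm y \<le> 1"
  obtains s where "s \<in> sa" "s * s = 1 - y" "norm (1 - s) \<le> 1"
proof -
  define z where "z = sqrt_iter y"
  define u where "u = sqrt_iter (1::real)"
  have zs: "z n \<in> sa" for n using y(1) by (simp add: z_def sqrt_iter_sa)
  have u: "0 \<le> u n" "u n \<le> 1" "u n \<le> u (Suc n)" for n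
    using sqrt_iter_one_bounds[of n] by (simp_all add: u_def)
  have nz: "norm (z n) \<le> u n" for n
  proof (induction n)
    case (Suc n)
    have "norm (z n * z n) \<le> u n * u n"
      by (meson Suc mult_mono norm_ge_zero norm_mult_ineq order_trans u(1))
    then have "norm (y + z n * z n) \<le> 1 + u n * u n"
      using y(2) norm_triangle_ineq[of y "z n * z n"] by linarith
    then show ?case by (simp add: z_def u_def)
  qed (simp add: z_def u_def)
  have dz: "norm (z (Suc n) - z n) \<le> u (Suc n) - u n" for n
  proof (induction n)
    case 0
    then show ?case using y(2) by (simp add: z_def u_def)
  next
    case (Suc n)
    \<comment> \<open>Commutation makes the difference of squares factor. The scalar increments
      satisfy the same identity, so the estimate propagates.\<close>
    have c: "z n * z (Suc n) = z (Suc n) * z n" using zs sa_commute by blast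
    have "z (Suc (Suc n)) - z (Suc n) = (1/2) *\<^sub>R (z (Suc n) * z (Suc n) - z n * z n)"
      unfolding z_def sqrt_iter.simps(2)[of y "Suc n"]
      unfolding z_def[symmetric]
      by (simp add: z_def scaleR_diff_right scaleR_add_right)
    also have "z (Suc n) * z (Suc n) - z n * z n = (z (Suc n) - z n) * (z (Suc n) + z n)"
      using c by (simp add: algebra_simps)
    finally have "norm (z (Suc (Suc n)) - z (Suc n)) \<le> (1/2) * (norm (z (Suc n) - z n) * norm (z (Suc n) + z n))"
      using norm_mult_ineq[of "z (Suc n) - z n" "z (Suc n) + z n"] by simp
    also have "\<dots> \<le> (1/2) * ((u (Suc n) - u n) * (u (Suc n) + u n))"
      using norm_triangle_le[OF add_mono[OF nz[of "Suc n"] nz[of n]]] Suc u(3)[of n]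
      by (intro mult_left_mono mult_mono) auto
    also have "\<dots> = u (Suc (Suc n)) - u (Suc n)"
      unfolding u_def sqrt_iter.simps(2)[of 1 "Suc n"]
      unfolding u_def[symmetric]
      by (simp add: u_def algebra_simps)
    finally show ?case .
  qed
  have ddz: "norm (z (m + k) - z m) \<le> u (m + k) - u m" for m k
  proof (induction k)
    case (Suc k)
    then show ?case using dz[of "m+k"] norm_triangle_ineq[of "z (Suc (m+k)) - z (m+k)" "z (m+k) - z m"]
      by simp
  qed simp
  have "incseq u" using u(3) by (rule incseq_SucI)
  then have "convergent u"
    using u by (intro Bseq_mono_convergent BseqI'[where K=1]) (auto simp: incseq_def)
  then have Cu: "Cauchy u" by (rule convergent_Cauchy)
  have "Cauchy z"
  proof (rule CauchyI)
    fix e :: real assume "e > 0"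
    then obtain M where M: "\<forall>m\<ge>M. \<forall>n\<ge>M. norm (u m - u n) < e"
      using CauchyD[OF Cu] by blast
    have "norm (z m - z n) < e" if "M \<le> n" "n \<le> m" for m n
      using ddz[of n "m - n"] M[rule_format, of m n] that by simp
    then have "\<forall>m\<ge>M. \<forall>n\<ge>M. norm (z m - z n) < e"
      by (metis linorder_le_cases norm_minus_commute)
    then show "\<exists>M. \<forall>m\<ge>M. \<forall>n\<ge>M. norm (z m - z n) < e" by blast
  qed
  then obtain w where w: "z \<longlonglongrightarrow> w" using Cauchy_convergent convergent_def by blast
  have ws: "w \<in> sa" using closed_sa zs w closed_sequentially by metis
  have "(\<lambda>n. (1/2) *\<^sub>R (y + z n * z n)) \<longlonglongrightarrow> (1/2) *\<^sub>R (y + w * w)"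
    by (intro tendsto_intros w)
  moreover have "(\<lambda>n. (1/2) *\<^sub>R (y + z n * z n)) \<longlonglongrightarrow> w"
    using LIMSEQ_Suc[OF w] by (simp add: z_def)
  ultimately have fix_w: "w = (1/2) *\<^sub>R (y + w * w)" using LIMSEQ_unique by blast
  then have "w + w = y + w * w"
    by (metis scaleR_half_double scaleR_add_right)
  then have "(1 - w) * (1 - w) = 1 - y" by (simp add: algebra_simps)
  moreover have "norm w \<le> 1"
    using nz u(2) by (intro LIMSEQ_le_const2[OF tendsto_norm[OF w]]) (meson order_trans)
  ultimately show ?thesis using that[of "1 - w"] ws by (simp add: sa_intros)
qed

text \<open>For w = q + i r commutativity gives \<open>star w * w\<close> = q^2 + r^2, and passing
  to the real part q does not increase the norm. This is monotonicity of the norm on sums of two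
  squares, obtained before any order is at hand.\<close>

lemma norm_square_le_sum_squares:
  assumes "q \<in> sa" "r \<in> sa"
  shows "(norm q)\<^sup>2 \<le> norm (q * q + r * r)"
proof -
  define w where "w = q + \<i> *\<^sub>C r"
  have sw: "star w = q - \<i> *\<^sub>C r"
    using assms by (simp add: w_def star_add star_scaleC sa_star scaleC_minus_left)
  have "star w * w = q * q + r * r"
    unfolding sw unfolding w_def using sa_commute[OF assms]
    by (simp add: algebra_simps mult_scaleC_left mult_scaleC_right scaleC_scaleC scaleC_diff_right scaleC_minus_left)
  then have "(norm w)\<^sup>2 = norm (q * q + r * r)" using cstar_identity[of w] by simp
  moreover have "re_part w = q"
    using assms by (simp add: w_def sa_def re_im_parts_unique)
  then have "norm q \<le> norm w" using norm_re_part_le[of w] by simp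
  ultimately show ?thesis by (metis norm_ge_zero power_mono)
qed

text \<open>Positivity by squares makes products immediate. Sums are the hard case and come from the
  two norm criteria below.\<close>

definition pos :: "'a set" where "pos = {b * b | b. b \<in> sa}"

lemma pos_sa: "x \<in> pos \<Longrightarrow> x \<in> sa"
  by (auto simp: pos_def sa_mult)

lemma pos_square: "b \<in> sa \<Longrightarrow> b * b \<in> pos"
  by (auto simp: pos_def)

lemma pos_scaleR: "x \<in> pos \<Longrightarrow> 0 \<le> r \<Longrightarrow> r *\<^sub>R x \<in> pos"
proof -
  assume "x \<in> pos" "0 \<le> r"
  then obtain b where "b \<in> sa" "x = b * b" by (auto simp: pos_def)
  then show ?thesis using pos_square[of "sqrt r *\<^sub>R b"] \<open>0 \<le> r\<close> by (simp add: sa_scaleR)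
qed

lemma pos_mult: "x \<in> pos \<Longrightarrow> y \<in> pos \<Longrightarrow> x * y \<in> pos"
proof -
  assume "x \<in> pos" "y \<in> pos"
  then obtain a b where ab: "a \<in> sa" "x = a * a" "b \<in> sa" "y = b * b" by (auto simp: pos_def)
  then have "x * y = (a * b) * (a * b)" using sa_commute[of a b] by (metis mult.assoc)
  then show ?thesis using ab by (simp add: pos_square sa_mult)
qed

lemma pos_one: "1 \<in> pos" and pos_zero: "0 \<in> pos"
  using pos_square[OF sa_one] pos_square[OF sa_zero] by simp_all

text \<open>Dividing by t turns the bound into \<open>norm y \<le> 1\<close> for y = 1 - x / t; a
  square root of 1 - y, rescaled, is a root of x.\<close>

lemma pos_of_norm_le:
  assumes x: "x \<in> sa" and t: "norm (t *\<^sub>R 1 - x) \<le> t"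
  shows "x \<in> pos"
proof (cases "t = 0")
  case True
  then show ?thesis using t pos_zero by simp
next
  case False
  then have t0: "t > 0" using t norm_ge_zero[of "t *\<^sub>R 1 - x"] by linarith
  define y where "y = 1 - (1/t) *\<^sub>R x"
  have "y = (1/t) *\<^sub>R (t *\<^sub>R 1 - x)" using t0 by (simp add: y_def scaleR_diff_right)
  then have "norm y \<le> 1" using t t0 by (simp add: divide_simps)
  moreover have "y \<in> sa" using x by (simp add: y_def sa_intros)
  ultimately obtain s where s: "s \<in> sa" "s * s = 1 - y" using sqrt_exists by blast
  have "t *\<^sub>R (s * s) = x" using s(2) t0 by (simp add: y_def)
  then show ?thesis using pos_scaleR[OF pos_square[OF s(1)], of t] t0 by simp
qed

text \<open>Normalise x to c^2 with \<open>norm (c * c) \<le> 1\<close> and take s^2 = 1 - c^2. As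
  s^2 + c^2 = 1, the norm of s is at most 1, and hence that of s^2 = 1 - x / t.\<close>

lemma norm_le_of_pos:
  assumes x: "x \<in> pos" and t: "norm x \<le> t"
  shows "norm (t *\<^sub>R 1 - x) \<le> t"
proof (cases "t = 0")
  case True
  then show ?thesis using t by simp
next
  case False
  then have t0: "t > 0" using t norm_ge_zero[of x] by linarith
  obtain b where b: "b \<in> sa" "x = b * b" using x by (auto simp: pos_def)
  define c where "c = (1 / sqrt t) *\<^sub>R b"
  have c: "c \<in> sa" using b by (simp add: c_def sa_scaleR)
  have cc: "c * c = (1/t) *\<^sub>R x" using t0 b by (simp add: c_def)
  then have "norm (c * c) \<le> 1" using t t0 by (simp add: divide_simps)
  then obtain s where s: "s \<in> sa" "s * s = 1 - c * c" using sqrt_exists[OF sa_mult[OF c c]] by blast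
  then have "(norm s)\<^sup>2 \<le> 1" using norm_square_le_sum_squares[OF s(1) c] norm_one_le[where 'a='a] by simp
  then have "norm (s * s) \<le> 1" using norm_self_adjoint_square sa_star[OF s(1)] by metis
  then have "norm (t *\<^sub>R (s * s)) \<le> t" using t0 by simp
  then show ?thesis using s(2) cc t0 by (simp add: scaleR_diff_right)
qed

text \<open>The norm criterion is additive in the pair (t, x), by the triangle inequality.\<close>

lemma pos_add:
  assumes "x \<in> pos" "y \<in> pos"
  shows "x + y \<in> pos"
proof (rule pos_of_norm_le[where t="norm x + norm y"])
  show "x + y \<in> sa" using assms pos_sa sa_add by blast
  have "(norm x + norm y) *\<^sub>R 1 - (x + y) = (norm x *\<^sub>R 1 - x) + (norm y *\<^sub>R 1 - y)"
    by (simp add: scaleR_add_left)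
  then show "norm ((norm x + norm y) *\<^sub>R 1 - (x + y)) \<le> norm x + norm y"
    by (metis norm_triangle_le add_mono norm_le_of_pos assms order_refl)
qed

lemma norm_minus_pos:
  assumes "x \<in> sa" "norm x \<le> t"
  shows "t *\<^sub>R 1 - x \<in> pos"
  using assms by (intro pos_of_norm_le[where t=t]) (simp_all add: sa_intros)

lemma norm_plus_pos:
  assumes "x \<in> sa" "norm x \<le> t"
  shows "t *\<^sub>R 1 + x \<in> pos"
  using norm_minus_pos[of "- x" t] assms by (simp add: sa_minus)

text \<open>The element m is the absolute value of h, a rescaled square root of h^2 / t with t the
  norm of h^2. Positivity of that root is where the bound on \<open>1 - s\<close> enters.\<close>

lemma abs_exists:
  assumes h: "h \<in> sa"
  obtains m where "m \<in> pos" "m * m = h * h"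
proof (cases "h = 0")
  case True
  then show ?thesis using that[of 0] pos_zero by simp
next
  case False
  define t where "t = norm (h * h)"
  have t0: "t > 0" using False norm_self_adjoint_square[OF sa_star[OF h]] by (simp add: t_def)
  define y where "y = (1/t) *\<^sub>R (t *\<^sub>R 1 - h * h)"
  have ysa: "y \<in> sa" using h by (auto simp: y_def intro!: sa_intros)
  have "norm (t *\<^sub>R 1 - h * h) \<le> t"
    using norm_le_of_pos[OF pos_square[OF h]] by (simp add: t_def)
  then have "norm y \<le> 1" using t0 by (simp add: y_def divide_simps)
  then obtain s where s: "s \<in> sa" "s * s = 1 - y" "norm (1 - s) \<le> 1"
    using sqrt_exists[OF ysa] by blast
  have "s \<in> pos" using pos_of_norm_le[OF s(1), of 1] s(3) by simp
  then have "sqrt t *\<^sub>R s \<in> pos" using t0 by (simp add: pos_scaleR)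
  moreover have "(sqrt t *\<^sub>R s) * (sqrt t *\<^sub>R s) = h * h"
    using s(2) t0 by (simp add: y_def scaleR_diff_right)
  ultimately show ?thesis by (rule that)
qed

end

text \<open>The subalgebra is the bicommutant of \<open>h\<close>, which is commutative because \<open>h\<close> lies in its own
  commutant.\<close>

lemma self_adjoint_in_comm_subalg:
  assumes "h \<in> self_adjoint"
  obtains B where "comm_subalg B" "h \<in> B"
proof -
  define C where "C = {y. h * y = y * (h::'a)}"
  define B where "B = {x. \<forall>y\<in>C. x * y = y * x}"
  have hs: "star h = h" using assms by (simp add: self_adjoint_def)
  \<comment> \<open>The commutant of a self-adjoint element is closed under \<open>star\<close>, and
    therefore so is the bicommutant.\<close>
  have Cs: "star y \<in> C" if "y \<in> C" for y
  proof -
    have "h * y = y * h" using that by (simp add: C_def)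
    then have "star (h * y) = star (y * h)" by simp
    then show ?thesis by (simp add: C_def star_mult hs)
  qed
  have hC: "h \<in> C" by (simp add: C_def)
  have BC: "B \<subseteq> C" using hC by (auto simp: B_def C_def)
  have "closed {x. x * y = y * x}" for y :: 'a
    by (intro closed_Collect_eq continuous_intros)
  moreover have "B = (\<Inter>y\<in>C. {x. x * y = y * x})" by (auto simp: B_def)
  ultimately have clB: "closed B" by (simp add: closed_INT)
  have starB: "star a \<in> B" if "a \<in> B" for a
  proof -
    have "star a * y = y * star a" if "y \<in> C" for y
    proof -
      have "a * star y = star y * a" using \<open>a \<in> B\<close> Cs[OF that] by (simp add: B_def)
      then have "star (a * star y) = star (star y * a)" by simp
      then show ?thesis by (simp add: star_mult star_star)
    qed
    then show ?thesis by (simp add: B_def)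
  qed
  have commB: "a * b = b * a" if "a \<in> B" "b \<in> B" for a b
    using that BC by (auto simp: B_def)
  have addB: "a + b \<in> B" and multB: "a * b \<in> B" if "a \<in> B" "b \<in> B" for a b
  proof -
    have "(a + b) * y = y * (a + b) \<and> (a * b) * y = y * (a * b)" if "y \<in> C" for y
    proof -
      have ay: "a * y = y * a" and byc: "b * y = y * b"
        using \<open>a \<in> B\<close> \<open>b \<in> B\<close> that by (simp_all add: B_def)
      have "a * (b * y) = (a * y) * b" unfolding byc by (simp only: mult.assoc)
      then show ?thesis by (simp only: distrib_left distrib_right ay byc mult.assoc)
    qed
    then show "a + b \<in> B" "a * b \<in> B" by (simp_all add: B_def)
  qed
  have oneB: "1 \<in> B" by (simp add: B_def)
  have scB: "c *\<^sub>C a \<in> B" if "a \<in> B" for a c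
  proof -
    have "(c *\<^sub>C a) * y = y * (c *\<^sub>C a)" if "y \<in> C" for y
    proof -
      have "a * y = y * a" using \<open>a \<in> B\<close> that by (simp add: B_def)
      then show ?thesis by (simp only: mult_scaleC_left mult_scaleC_right)
    qed
    then show ?thesis by (simp add: B_def)
  qed
  have "B \<in> comm_subalgs" unfolding comm_subalgs_def mem_Collect_eq
    by (intro conjI ballI allI) (rule clB oneB addB multB starB scB commB; assumption)+
  then have "comm_subalg B" by (rule comm_subalg.intro)
  moreover have "h \<in> B" by (simp add: B_def C_def)
  ultimately show ?thesis by (rule that)
qed

text \<open>Each square is treated in a subalgebra of its own, but the resulting bound refers to
  none of them. Bounds for non-commuting squares can therefore be added, which places the sum in the
  positive cone of any commutative subalgebra that contains it.\<close>

lemma norm_minus_square_le: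
  assumes "star b = (b::'a::cstar_algebra)"
  shows "norm (norm (b * b) *\<^sub>R 1 - b * b) \<le> norm (b * b)"
proof -
  obtain B where "comm_subalg B" "b \<in> B"
    using self_adjoint_in_comm_subalg[of b] assms by (auto simp: self_adjoint_def)
  then interpret comm_subalg B by simp
  show ?thesis using norm_le_of_pos[OF pos_square[OF saI]] \<open>b \<in> B\<close> assms by simp
qed


text \<open>Since \<open>u c = c v\<close> for \<open>u = 1 - c c\<^sup>* / 2N\<close> and \<open>v = 1 + q\<^sup>2 / 2N\<close>, where \<open>N = \<parallel>c\<parallel>\<^sup>2\<close>, and \<open>\<parallel>u\<parallel> \<le> 1\<close>,
  the norm of \<open>c v\<^sup>2\<close> is at most that of \<open>c\<close>. But \<open>\<parallel>c v\<^sup>2\<parallel>\<^sup>2 = \<parallel>q\<^sup>2 v\<^sup>4\<parallel> \<ge> 2N\<close>.\<close>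

lemma star_mult_self_eq_minus_square:
  assumes B: "comm_subalg B" and q: "q \<in> comm_subalg.sa B"
    and c: "star c * c = - (q * (q::'a::cstar_algebra))"
  shows "q = 0"
proof (rule ccontr)
  assume "q \<noteq> 0"
  interpret comm_subalg B by fact
  define N where "N = norm (q * q)"
  have N0: "N > 0" using \<open>q \<noteq> 0\<close> norm_self_adjoint_square[OF sa_star[OF q]] by (simp add: N_def)
  have nc: "(norm c)\<^sup>2 = N" using cstar_identity[of c] c by (simp add: N_def)
  define P where "P = c * star c"
  have starP: "star P = P" by (simp add: P_def star_mult star_star)
  have nP: "norm P = N" using cstar_identity[of "star c"] nc by (simp add: P_def star_star)
  define x y where "x = re_part c" and "y = im_part c"
  have xs: "star x = x" and ys: "star y = y"
    using re_part_self_adjoint[of c] im_part_self_adjoint[of c] by (simp_all add: x_def y_def self_adjoint_def)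
  have cxy: "c = x + \<i> *\<^sub>C y" unfolding x_def y_def by (rule re_im_parts)
  \<comment> \<open>The mixed products cancel in this symmetric sum. Together with
    \<open>star c * c\<close> = - q^2 it exhibits P as a sum of squares, which need not commute with
    each other.\<close>
  have "c * star c + star c * c = x * x + x * x + (y * y + y * y)"
    unfolding cxy star_add star_scaleC xs ys
    by (simp add: algebra_simps mult_scaleC_left mult_scaleC_right
        scaleC_scaleC scaleC_minus_left scaleC_diff_right scaleC_add_right)
  then have P_eq: "P = (x * x + x * x) + (y * y + y * y) + q * q" using c by (simp add: P_def diff_eq_eq)
  define t where "t = (norm (x * x) + norm (x * x)) + (norm (y * y) + norm (y * y)) + norm (q * q)"
  have "t *\<^sub>R 1 - P = ((norm (x * x) *\<^sub>R 1 - x * x) + (norm (x * x) *\<^sub>R 1 - x * x))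
     + ((norm (y * y) *\<^sub>R 1 - y * y) + (norm (y * y) *\<^sub>R 1 - y * y)) + (norm (q * q) *\<^sub>R 1 - q * q)"
    unfolding t_def P_eq scaleR_add_left by simp
  then have tP: "norm (t *\<^sub>R 1 - P) \<le> t"
    unfolding t_def
    by (simp only:) (intro norm_triangle_le add_mono norm_minus_square_le xs ys sa_star[OF q])
  obtain D where D: "comm_subalg D" "P \<in> D"
    using self_adjoint_in_comm_subalg[of P] starP by (auto simp: self_adjoint_def)
  interpret D: comm_subalg D by fact
  \<comment> \<open>Membership in \<open>pos\<close> discards the crude constant t: the bound now
    holds with N, the norm of P itself.\<close>
  have "P \<in> D.pos" using D.pos_of_norm_le[OF D.saI[OF D(2) starP] tP] .
  then have NP: "norm (N *\<^sub>R 1 - P) \<le> N" using D.norm_le_of_pos nP by simp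
  define u where "u = 1 - (1 / (2 * N)) *\<^sub>R P"
  have "u = (1 / (2 * N)) *\<^sub>R (N *\<^sub>R 1 + (N *\<^sub>R 1 - P))"
    using N0 by (simp add: u_def scaleR_add_right scaleR_diff_right scaleR_add_left[symmetric])
  moreover have "norm (N *\<^sub>R (1::'a)) \<le> N"
    using norm_one_le[where 'a='a] N0 by simp
  then have "norm (N *\<^sub>R 1 + (N *\<^sub>R 1 - P)) \<le> 2 * N"
    using norm_triangle_ineq[of "N *\<^sub>R 1" "N *\<^sub>R 1 - P"] NP by linarith
  ultimately have nu: "norm u \<le> 1" using N0 by (simp add: divide_simps)
  define f where "f = (1 / (2 * N)) *\<^sub>R (q * q)"
  have fp: "f \<in> pos" using q N0 by (simp add: f_def pos_scaleR pos_square)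
  define v where "v = 1 + f"
  have vsa: "v \<in> sa" using pos_sa[OF fp] by (simp add: v_def sa_intros)
  have "P * c = - (c * (q * q))" unfolding P_def mult.assoc c by simp
  then have uc: "u * c = c * v"
    by (simp add: u_def v_def f_def left_diff_distrib distrib_left)
  \<comment> \<open>Applying u twice matters: with \<open>v\<close> in place of \<open>v * v\<close>
    the decisive term below would be q^4 / N, of norm exactly N, which gives no
    contradiction.\<close>
  have "c * (v * v) = u * (u * c)" using uc by (metis mult.assoc)
  moreover have "norm (u * (u * c)) \<le> 1 * (1 * norm c)"
  proof -
    have *: "norm (u * z) \<le> norm z" for z
      using norm_mult_ineq[of u z] mult_right_mono[OF nu norm_ge_zero[of z]] by simp
    show ?thesis using order_trans[OF *[of "u * c"] *[of c]] by simp
  qed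
  ultimately have cvv: "(norm (c * (v * v)))\<^sup>2 \<le> N"
    using nc by (metis mult_1 norm_ge_zero power_mono)
  define w where "w = v * v"
  have wsa: "w \<in> sa" using vsa by (simp add: w_def sa_mult)
  have "star (c * w) * (c * w) = w * (star c * c) * w"
    using sa_star[OF wsa] by (simp add: star_mult mult.assoc)
  also have "\<dots> = - ((q * q) * (w * w))"
    unfolding c using sa_commute[OF wsa sa_mult[OF q q]] by (simp add: mult.assoc)
  finally have "(norm (c * w))\<^sup>2 = norm ((q * q) * (w * w))"
    using cstar_identity[of "c * w"] by simp
  then have le: "norm ((q * q) * (w * w)) \<le> N" using cvv by (simp add: w_def)
  \<comment> \<open>What remains of (1 + f)^4 after removing 4 f. It is positive, so it cannot lower
    the norm of q^2 v^4 below that of the term 4 f q^2 = (2 / N) q^4, which is 2 N.\<close>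
  define r where "r = 1 + (f * f + f * f + f * f + f * f + f * f + f * f)
    + (f * (f * f) + f * (f * f) + f * (f * f) + f * (f * f)) + (f * f) * (f * f)"
  have rp: "r \<in> pos" using fp unfolding r_def by (intro pos_add pos_mult pos_one)
  have ww: "w * w = (f + f + f + f) + r"
    unfolding w_def v_def r_def by (simp add: algebra_simps)
  have f4: "f + f + f + f = (2 / N) *\<^sub>R (q * q)"
    by (simp add: f_def scaleR_add_left[symmetric])
  define g where "g = sqrt (2 / N) *\<^sub>R (q * q)"
  have gsa: "g \<in> sa" using q by (simp add: g_def sa_intros)
  have gg: "g * g = (2 / N) *\<^sub>R ((q * q) * (q * q))" using N0 by (simp add: g_def)
  obtain b where b: "b \<in> sa" "(q * q) * r = b * b"
    using pos_mult[OF pos_square[OF q] rp] by (auto simp: pos_def)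
  have "(q * q) * (w * w) = g * g + b * b"
    unfolding ww f4 gg b(2)[symmetric] by (simp add: distrib_left)
  then have "(norm g)\<^sup>2 \<le> N" using norm_square_le_sum_squares[OF gsa b(1)] le by simp
  moreover have "(norm g)\<^sup>2 = (2 / N) * N\<^sup>2"
    using N0 by (simp add: g_def N_def power_mult_distrib)
  ultimately show False using N0 by (simp add: power2_eq_square)
qed

text \<open>For h = \<open>star a * a\<close> and m its absolute value, k = m - h is twice the
  negative part of h. From h k = - m k and m = s^2 it follows that
  \<open>star (a * k) * (a * k)\<close> = - (s k)^2, which the preceding lemma forces to vanish.
  Hence m k = 0, and k^2 = 2 m k = 0.\<close>

lemma star_mult_self_pos:
  assumes B: "comm_subalg B" and a: "star a * (a::'a::cstar_algebra) \<in> B"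
  shows "star a * a \<in> comm_subalg.pos B"
proof -
  interpret comm_subalg B by fact
  define h where "h = star a * a"
  have h: "h \<in> sa" using a by (intro saI) (simp_all add: h_def star_mult star_star)
  obtain m where m: "m \<in> pos" "m * m = h * h" using abs_exists[OF h] .
  have msa: "m \<in> sa" using pos_sa[OF m(1)] .
  obtain s where s: "s \<in> sa" "m = s * s" using m(1) by (auto simp: pos_def)
  define k where "k = m - h"
  have ksa: "k \<in> sa" using msa h by (simp add: k_def sa_diff)
  have hm: "h * m = m * h" using h msa sa_commute by blast
  have hk: "h * k = - (m * k)" using hm m(2) by (simp add: k_def right_diff_distrib)
  define q where "q = s * k"
  have qsa: "q \<in> sa" using s ksa by (simp add: q_def sa_mult)
  have sk: "s * k = k * s" using s(1) ksa sa_commute by blast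
  have "star (a * k) * (a * k) = k * (h * k)"
    using sa_star[OF ksa] by (simp add: star_mult h_def mult.assoc)
  also have "\<dots> = - (k * s * (s * k))" unfolding hk s(2) by (simp add: mult.assoc)
  also have "\<dots> = - (q * q)" by (simp add: q_def sk)
  finally have "q = 0" using star_mult_self_eq_minus_square[OF B qsa] by blast
  then have mk: "m * k = 0" using s(2) by (simp add: q_def mult.assoc)
  have "k * k = m * k + m * k"
    using hm m(2) by (simp add: k_def algebra_simps)
  then have "k = 0" using mk norm_self_adjoint_square[OF sa_star[OF ksa]] by simp
  then show ?thesis using m(1) by (simp add: k_def h_def)
qed

section \<open>Characters of commutative C*-algebras\<close>

context comm_subalg
begin

section \<open>Preorderings, and characters: existence, contractivity, reality\<close>

lemma mem_parts:
  assumes "a \<in> B"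
  obtains x y where "x \<in> sa" "y \<in> sa" "a = x + \<i> *\<^sub>C y"
  using assms re_part_sa im_part_sa re_im_parts by blast

text \<open>Properness, \<open>- 1 \<notin> Q\<close>, is kept out of the notion: adjoining an
  element may destroy it, and exactly that failure is exploited below.\<close>

definition preordering :: "'a set \<Rightarrow> bool" where
  "preordering Q \<longleftrightarrow> pos \<subseteq> Q \<and> Q \<subseteq> sa \<and> (\<forall>x\<in>Q. \<forall>y\<in>Q. x + y \<in> Q \<and> x * y \<in> Q)"

text \<open>Closure under products rests on x^2 being in \<open>pos\<close>: (x r) (x r') = x^2 (r
  r') falls back into Q.\<close>

lemma preordering_adjoin:
  assumes Q: "preordering Q" and x: "x \<in> sa"
  shows "preordering {q + x * r | q r. q \<in> Q \<and> r \<in> Q}" (is "preordering ?R")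
    and "Q \<subseteq> {q + x * r | q r. q \<in> Q \<and> r \<in> Q}"
    and "x \<in> {q + x * r | q r. q \<in> Q \<and> r \<in> Q}"
proof -
  have Qp: "pos \<subseteq> Q" and Qs: "Q \<subseteq> sa"
    and Qa: "\<And>a b. a \<in> Q \<Longrightarrow> b \<in> Q \<Longrightarrow> a + b \<in> Q" and Qm: "\<And>a b. a \<in> Q \<Longrightarrow> b \<in> Q \<Longrightarrow> a * b \<in> Q"
    using Q by (auto simp: preordering_def)
  have z: "0 \<in> Q" "1 \<in> Q" using Qp pos_zero pos_one by auto
  show sub: "Q \<subseteq> ?R"
  proof
    fix q assume "q \<in> Q"
    then have "q = q + x * 0 \<and> q \<in> Q \<and> 0 \<in> Q" using z by simp
    then show "q \<in> ?R" by blast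
  qed
  have "x = 0 + x * 1 \<and> 0 \<in> Q \<and> 1 \<in> Q" using z by simp
  then show "x \<in> ?R" by blast
  show "preordering ?R" unfolding preordering_def
  proof (intro conjI ballI)
    show "pos \<subseteq> ?R" using sub Qp by blast
    show "?R \<subseteq> sa" using x Qs by (auto intro!: sa_intros)
    fix a b assume "a \<in> ?R" "b \<in> ?R"
    then obtain q r q' r' where a: "a = q + x * r" "b = q' + x * r'" and
      q: "q \<in> Q" "r \<in> Q" "q' \<in> Q" "r' \<in> Q" by blast
    have "a + b = (q + q') + x * (r + r')" by (simp add: a distrib_left)
    then show "a + b \<in> ?R" using q Qa by blast
    have qs: "q \<in> sa" "r \<in> sa" "q' \<in> sa" "r' \<in> sa" using q Qs by auto
    have c: "q * x = x * q" "r * x = x * r" using qs x sa_commute by blast+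
    have 1: "q * (x * r') = x * (q * r')" by (simp only: mult.assoc[symmetric] c(1))
    have "(x * r) * (x * r') = x * (r * x) * r'" by (simp only: mult.assoc)
    then have 2: "(x * r) * (x * r') = (x * x) * (r * r')" unfolding c(2) by (simp only: mult.assoc)
    have "a * b = q * q' + (x * r) * q' + (q * (x * r') + (x * r) * (x * r'))"
      by (simp only: a distrib_left distrib_right add.assoc)
    also have "\<dots> = (q * q' + (x * x) * (r * r')) + x * (q * r' + r * q')"
      unfolding 1 2 by (simp add: distrib_left mult.assoc)
    finally have "a * b = (q * q' + (x * x) * (r * r')) + x * (q * r' + r * q')" .
    moreover have "x * x \<in> Q" using pos_square[OF x] Qp by blast
    ultimately show "a * b \<in> ?R" using q by (blast intro: Qa Qm)
  qed
qed

text \<open>A maximal proper preordering is a total, archimedean order, hence given by a unique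
  real-valued homomorphism.\<close>

lemma character_nonneg_on_preordering:
  assumes T: "preordering T" and m1: "- 1 \<notin> T"
  obtains \<omega> where "\<omega> \<in> characters B" "\<And>x. x \<in> T \<Longrightarrow> 0 \<le> Re (\<omega> x)"
proof -
  define \<A> where "\<A> = {Q. preordering Q \<and> T \<subseteq> Q \<and> - 1 \<notin> Q}"
  have "\<exists>M\<in>\<A>. \<forall>X\<in>\<A>. M \<subseteq> X \<longrightarrow> X = M"
  proof (rule subset_Zorn_nonempty)
    show "\<A> \<noteq> {}" using T m1 by (auto simp: \<A>_def)
    fix \<C> assume ne: "\<C> \<noteq> {}" and ch: "subset.chain \<A> \<C>"
    have mem: "Q \<in> \<A>" if "Q \<in> \<C>" for Q using ch that by (auto simp: subset.chain_def)
    have po: "pos \<subseteq> Q" "Q \<subseteq> sa" "T \<subseteq> Q" "- 1 \<notin> Q" if "Q \<in> \<C>" for Q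
      using mem[OF that] by (auto simp: \<A>_def preordering_def)
    have op: "x + y \<in> Q" "x * y \<in> Q" if "Q \<in> \<C>" "x \<in> Q" "y \<in> Q" for Q x y
      using mem[OF that(1)] that(2,3) by (auto simp: \<A>_def preordering_def)
    have tot: "Q \<subseteq> R \<or> R \<subseteq> Q" if "Q \<in> \<C>" "R \<in> \<C>" for Q R
      using ch that unfolding subset_chain_def by blast
    have "x + y \<in> \<Union>\<C> \<and> x * y \<in> \<Union>\<C>" if xy: "x \<in> \<Union>\<C>" "y \<in> \<Union>\<C>" for x y
    proof -
      obtain Q R where QR: "Q \<in> \<C>" "x \<in> Q" "R \<in> \<C>" "y \<in> R" using xy by auto
      obtain S where "S \<in> \<C>" "x \<in> S" "y \<in> S" using tot[OF QR(1,3)] QR by blast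
      then show ?thesis using op by blast
    qed
    moreover have "pos \<subseteq> \<Union>\<C>" "\<Union>\<C> \<subseteq> sa" "T \<subseteq> \<Union>\<C>" "- 1 \<notin> \<Union>\<C>" using ne po by blast+
    ultimately show "\<Union>\<C> \<in> \<A>" by (simp add: \<A>_def preordering_def)
  qed
  then obtain Q where QA: "Q \<in> \<A>" and max: "\<And>X. X \<in> \<A> \<Longrightarrow> Q \<subseteq> X \<Longrightarrow> X = Q" by blast
  have Q: "preordering Q" "T \<subseteq> Q" "- 1 \<notin> Q" using QA by (auto simp: \<A>_def)
  have Qp: "\<And>x. x \<in> pos \<Longrightarrow> x \<in> Q" and Qs: "\<And>x. x \<in> Q \<Longrightarrow> x \<in> sa"
    and Qa: "\<And>a b. a \<in> Q \<Longrightarrow> b \<in> Q \<Longrightarrow> a + b \<in> Q" and Qm: "\<And>a b. a \<in> Q \<Longrightarrow> b \<in> Q \<Longrightarrow> a * b \<in> Q"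
    using Q by (auto simp: preordering_def)
  have scl: "r *\<^sub>R x \<in> Q" if "x \<in> Q" "0 \<le> r" for x r
    using Qm[OF Qp[OF pos_scaleR[OF pos_one that(2)]] that(1)] by simp
  \<comment> \<open>If neither sign can be adjoined, then x r = - (1 + q) and x r' = 1 + q' with all
    letters but x in Q. Multiplying the two equations writes \<open>- 1\<close> as q + q' + q q' +
    x^2 r r', an element of Q.\<close>
  have total: "x \<in> Q \<or> - x \<in> Q" if x: "x \<in> sa" for x
  proof (rule ccontr)
    assume no: "\<not> (x \<in> Q \<or> - x \<in> Q)"
    have *: "\<exists>q r. q \<in> Q \<and> r \<in> Q \<and> - 1 = q + z * r" if "z \<in> sa" "z \<notin> Q" for z
    proof -
      note adj = preordering_adjoin[OF Q(1) that(1)]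
      have "{q + z * r | q r. q \<in> Q \<and> r \<in> Q} \<notin> \<A>"
        using max adj(2,3) that(2) by blast
      then have "- 1 \<in> {q + z * r | q r. q \<in> Q \<and> r \<in> Q}"
        using adj Q(2) unfolding \<A>_def by blast
      then show ?thesis by blast
    qed
    obtain q r where qr: "q \<in> Q" "r \<in> Q" "- 1 = q + x * r" using * x no by blast
    obtain q' r' where qr': "q' \<in> Q" "r' \<in> Q" "- 1 = q' + (- x) * r'"
      using *[OF sa_minus[OF x]] no by blast
    have e1: "x * r = - (1 + q)" using qr(3) by (simp add: algebra_simps eq_neg_iff_add_eq_0)
    have e2: "x * r' = 1 + q'" using qr'(3) by (simp add: algebra_simps)
    have c: "r * x = x * r" using Qs qr x sa_commute by blast
    have "(x * r) * (x * r') = x * (r * x) * r'" by (simp only: mult.assoc)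
    then have "(x * r) * (x * r') = (x * x) * (r * r')" unfolding c by (simp only: mult.assoc)
    then have "(x * x) * (r * r') = - ((1 + q) * (1 + q'))"
      unfolding e1 e2 minus_mult_left[symmetric] by (rule sym)
    then have "- 1 = q + q' + q * q' + (x * x) * (r * r')" by (simp add: algebra_simps)
    moreover have "x * x \<in> Q" using Qp pos_square x by blast
    then have "q + q' + q * q' + (x * x) * (r * r') \<in> Q"
      by (rule Qa[OF Qa[OF Qa[OF qr(1) qr'(1)] Qm[OF qr(1) qr'(1)]] Qm[OF _ Qm[OF qr(2) qr'(2)]]])
    ultimately have "- 1 \<in> Q" by simp
    then show False using Q(3) by blast
  qed
  have nonneg: "0 \<le> t" if "t *\<^sub>R 1 \<in> Q" for t
  proof (rule ccontr)
    assume "\<not> 0 \<le> t"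
    then have "(1 / - t) *\<^sub>R (t *\<^sub>R 1) \<in> Q" using that by (intro scl[OF that]) simp
    then show False using Q(3) \<open>\<not> 0 \<le> t\<close> by simp
  qed
  have const: "t *\<^sub>R 1 \<in> Q" if "0 \<le> t" for t
    using scl[OF Qp[OF pos_one] that] .
  \<comment> \<open>\<open>V x r\<close> says that x has value r up to every e > 0. The slack e is
    what allows infinitesimal elements, since Q is not known to be closed under limits.\<close>
  define V where "V x r \<longleftrightarrow> (\<forall>e>0. (r + e) *\<^sub>R 1 - x \<in> Q \<and> x - (r - e) *\<^sub>R 1 \<in> Q)" for x r
  have Vex: "\<exists>r. V x r" if x: "x \<in> sa" for x
  proof -
    \<comment> \<open>The upper cut of x. Its infimum is finite because \<open>norm x\<close> times
      the unit, plus or minus x, lies in \<open>pos\<close>; totality turns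
      \<open>r - e \<notin> S\<close> into the lower half of \<open>V\<close>.\<close>
    define S where "S = {t. t *\<^sub>R 1 - x \<in> Q}"
    have "norm x \<in> S" using Qp[OF norm_minus_pos[OF x order_refl]] by (simp add: S_def)
    have lb: "- norm x \<le> t" if "t \<in> S" for t
    proof -
      have "(t *\<^sub>R 1 - x) + (norm x *\<^sub>R 1 + x) \<in> Q"
        using that Qp[OF norm_plus_pos[OF x order_refl]] by - (rule Qa; simp add: S_def)
      then have "(t + norm x) *\<^sub>R 1 \<in> Q" by (simp add: scaleR_add_left)
      then show ?thesis using nonneg by force
    qed
    then have bb: "bdd_below S" by (auto simp: bdd_below_def)
    define r where "r = Inf S"
    have "(r + e) *\<^sub>R 1 - x \<in> Q \<and> x - (r - e) *\<^sub>R 1 \<in> Q" if "e > 0" for e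
    proof
      obtain t where t: "t \<in> S" "t < r + e"
      proof -
        have "Inf S < r + e" "S \<noteq> {}" using \<open>norm x \<in> S\<close> \<open>e > 0\<close> by (auto simp: r_def)
        then show thesis using cInf_lessD that by blast
      qed
      have "(t *\<^sub>R 1 - x) + (r + e - t) *\<^sub>R 1 \<in> Q"
        using t const by - (rule Qa; auto simp: S_def)
      then show "(r + e) *\<^sub>R 1 - x \<in> Q" by (simp add: scaleR_diff_left)
      have "r - e \<notin> S" using cInf_lower[OF _ bb, of "r - e"] that by (auto simp: r_def)
      moreover have "(r - e) *\<^sub>R 1 - x \<in> sa" using x by (simp add: sa_intros)
      ultimately have "- ((r - e) *\<^sub>R 1 - x) \<in> Q" using total unfolding S_def by blast
      then show "x - (r - e) *\<^sub>R 1 \<in> Q" by simp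
    qed
    then show ?thesis by (auto simp: V_def)
  qed
  have Vle: "r' \<le> r" if "V x r" "V x r'" for x r r'
  proof (rule field_le_epsilon)
    fix e :: real assume "e > 0"
    then have "((r + e/2) *\<^sub>R 1 - x) + (x - (r' - e/2) *\<^sub>R 1) \<in> Q"
      using that by - (rule Qa; auto simp: V_def)
    moreover have "((r + e/2) *\<^sub>R 1 - x) + (x - (r' - e/2) *\<^sub>R 1) = (r + e - r') *\<^sub>R 1"
      by (simp add: scaleR_diff_left[symmetric])
    ultimately show "r' \<le> r + e" using nonneg by fastforce
  qed
  have Vuniq: "r = r'" if "V x r" "V x r'" for x r r'
    using Vle that by (metis order_antisym)
  have Vadd: "V (x + y) (r + s)" if "V x r" "V y s" for x y r s
    unfolding V_def
  proof (intro allI impI conjI)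
    fix e :: real assume "e > 0"
    then have "((r + e/2) *\<^sub>R 1 - x) + ((s + e/2) *\<^sub>R 1 - y) \<in> Q"
      "(x - (r - e/2) *\<^sub>R 1) + (y - (s - e/2) *\<^sub>R 1) \<in> Q"
      using that by (auto simp: V_def intro!: Qa)
    moreover have "((r + e/2) *\<^sub>R 1 - x) + ((s + e/2) *\<^sub>R 1 - y) = (r + s + e) *\<^sub>R 1 - (x + y)"
      using scaleR_add_left[of "r + e/2" "s + e/2" "1::'a"] by (simp add: algebra_simps)
    moreover have "(x - (r - e/2) *\<^sub>R 1) + (y - (s - e/2) *\<^sub>R 1) = (x + y) - (r + s - e) *\<^sub>R 1"
      using scaleR_add_left[of "r - e/2" "s - e/2" "1::'a"] by (simp add: algebra_simps)
    ultimately show "(r + s + e) *\<^sub>R 1 - (x + y) \<in> Q" "(x + y) - (r + s - e) *\<^sub>R 1 \<in> Q" by simp_all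
  qed
  have Vminus: "V (- x) (- r)" if "V x r" for x r
    unfolding V_def
  proof (intro allI impI conjI)
    fix e :: real assume "e > 0"
    then have "x - (r - e) *\<^sub>R 1 \<in> Q" "(r + e) *\<^sub>R 1 - x \<in> Q" using that by (auto simp: V_def)
    then show "(- r + e) *\<^sub>R 1 - - x \<in> Q" "- x - (- r - e) *\<^sub>R 1 \<in> Q"
      by (simp_all add: algebra_simps)
  qed
  have Vone: "V (t *\<^sub>R 1) t" for t
    using const by (auto simp: V_def scaleR_diff_left[symmetric])
  have Vpos: "V (t *\<^sub>R x) (t * r)" if "V x r" "t > 0" for x r t
    unfolding V_def
  proof (intro allI impI conjI)
    fix e :: real assume "e > 0"
    then have "t *\<^sub>R ((r + e/t) *\<^sub>R 1 - x) \<in> Q" "t *\<^sub>R (x - (r - e/t) *\<^sub>R 1) \<in> Q"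
      using that by (auto simp: V_def intro!: scl)
    then show "(t * r + e) *\<^sub>R 1 - t *\<^sub>R x \<in> Q" "t *\<^sub>R x - (t * r - e) *\<^sub>R 1 \<in> Q"
      using that(2) by (simp_all add: scaleR_diff_right distrib_left right_diff_distrib)
  qed
  have Vscale: "V (t *\<^sub>R x) (t * r)" if "V x r" for x r t
    using Vpos[OF that, of t] Vminus[OF Vpos[OF that, of "- t"]] Vone[of 0]
    by (cases "t = 0"; cases "t > 0") auto
  \<comment> \<open>Squares of infinitesimals: e - x^2 = (d - x) (d + x) with d the square root of
    e. The value of a general square follows by translation, that of a product by
    polarisation.\<close>
  have Vsq0: "V (x * x) 0" if "V x 0" for x
    unfolding V_def
  proof (intro allI impI conjI)
    fix e :: real assume e: "e > 0"
    define d where "d = sqrt e"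
    have d: "d > 0" "d * d = e" using e by (simp_all add: d_def)
    have dx: "d *\<^sub>R 1 - x \<in> Q" "x + d *\<^sub>R 1 \<in> Q" using that d(1) by (auto simp: V_def)
    have "x = (x + d *\<^sub>R 1) - d *\<^sub>R 1" by simp
    then have "x \<in> sa" using Qs[OF dx(2)] by (metis sa_diff sa_one sa_scaleR)
    then have "x * x \<in> Q" using Qp pos_square by blast
    then show "x * x - (0 - e) *\<^sub>R 1 \<in> Q" using Qa const e by simp
    have "(d *\<^sub>R 1 - x) * (x + d *\<^sub>R 1) = e *\<^sub>R 1 - x * x"
      using d(2) by (simp add: algebra_simps)
    then show "(0 + e) *\<^sub>R 1 - x * x \<in> Q" using Qm[OF dx] by simp
  qed
  have Vsq: "V (x * x) (r * r)" if "V x r" for x r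
  proof -
    define y where "y = x - r *\<^sub>R 1"
    have y0: "V y 0" using Vadd[OF that Vminus[OF Vone[of r]]] by (simp add: y_def)
    have "x * x = (y * y + (2 * r) *\<^sub>R y) + (r * r) *\<^sub>R 1"
      by (simp add: y_def algebra_simps scaleR_2[symmetric])
    moreover have "V ((y * y + (2 * r) *\<^sub>R y) + (r * r) *\<^sub>R 1) ((0 + 2 * r * 0) + r * r)"
      by (intro Vadd Vsq0 Vscale Vone y0)
    ultimately show ?thesis by simp
  qed
  have Vmult: "V (x * y) (r * s)" if "V x r" "V y s" "x * y = y * x" for x y r s
  proof -
    have "x * y = (1/2) *\<^sub>R ((x + y) * (x + y) + - (x * x) + - (y * y))"
      using that(3) by (simp add: algebra_simps scaleR_2[symmetric])
    moreover have "V ((1/2) *\<^sub>R ((x + y) * (x + y) + - (x * x) + - (y * y)))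
      ((1/2) * ((r + s) * (r + s) + - (r * r) + - (s * s)))"
      by (intro Vscale Vadd Vminus Vsq that)
    ultimately show ?thesis by (simp add: algebra_simps)
  qed
  define \<phi> where "\<phi> x = (SOME r. V x r)" for x
  have V\<phi>: "V x (\<phi> x)" if "x \<in> sa" for x
    using Vex[OF that] unfolding \<phi>_def by (rule someI_ex)
  have \<phi>: "V x r \<Longrightarrow> x \<in> sa \<Longrightarrow> \<phi> x = r" for x r
    using V\<phi> Vuniq by blast
  have \<phi>add: "\<phi> (x + y) = \<phi> x + \<phi> y" if "x \<in> sa" "y \<in> sa" for x y
    using \<phi>[OF Vadd[OF V\<phi>[OF that(1)] V\<phi>[OF that(2)]] sa_add[OF that]] .
  have \<phi>diff: "\<phi> (x - y) = \<phi> x - \<phi> y" if "x \<in> sa" "y \<in> sa" for x y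
    using \<phi>[OF Vadd[OF V\<phi> Vminus[OF V\<phi>]], of x y] that by (simp add: sa_diff)
  have \<phi>scale: "\<phi> (t *\<^sub>R x) = t * \<phi> x" if "x \<in> sa" for x t
    using \<phi>[OF Vscale[OF V\<phi>[OF that]] sa_scaleR[OF that]] .
  have \<phi>mult: "\<phi> (x * y) = \<phi> x * \<phi> y" if "x \<in> sa" "y \<in> sa" for x y
    using \<phi>[OF Vmult[OF V\<phi>[OF that(1)] V\<phi>[OF that(2)] sa_commute[OF that]] sa_mult[OF that]] .
  have \<phi>one: "\<phi> 1 = 1" using \<phi>[OF Vone[of 1]] by (simp add: sa_one)
  have \<phi>Q: "0 \<le> \<phi> x" if "x \<in> Q" for x
  proof (rule field_le_epsilon)
    fix e :: real assume "e > 0"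
    then have "((\<phi> x + e) *\<^sub>R 1 - x) + x \<in> Q" using V\<phi>[OF Qs[OF that]] that
      by - (rule Qa; auto simp: V_def)
    then show "0 \<le> \<phi> x + e" using nonneg by simp
  qed
  define \<omega> where "\<omega> a = (if a \<in> B then complex_of_real (\<phi> (re_part a)) + \<i> * \<phi> (im_part a) else 0)" for a
  have \<omega>: "\<omega> (x + \<i> *\<^sub>C y) = \<phi> x + \<i> * \<phi> y" if "x \<in> sa" "y \<in> sa" for x y
    using that by (simp add: \<omega>_def sa_def re_im_parts_unique add_mem scaleC_mem)
  have "\<omega> (a + b) = \<omega> a + \<omega> b \<and> \<omega> (a * b) = \<omega> a * \<omega> b" if ab: "a \<in> B" "b \<in> B" for a b
  proof -
    obtain x y where a: "x \<in> sa" "y \<in> sa" "a = x + \<i> *\<^sub>C y" using mem_parts[OF ab(1)] .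
    obtain x' y' where b: "x' \<in> sa" "y' \<in> sa" "b = x' + \<i> *\<^sub>C y'" using mem_parts[OF ab(2)] .
    have 1: "a + b = (x + x') + \<i> *\<^sub>C (y + y')" by (simp add: a b scaleC_add_right)
    have 2: "a * b = (x * x' - y * y') + \<i> *\<^sub>C (x * y' + y * x')"
      by (simp add: a b algebra_simps mult_scaleC_left mult_scaleC_right
          scaleC_scaleC scaleC_minus_left scaleC_add_right)
    have "\<omega> (a + b) = \<phi> (x + x') + \<i> * \<phi> (y + y')"
      unfolding 1 using a b by (intro \<omega> sa_intros)
    moreover have "\<omega> (a * b) = \<phi> (x * x' - y * y') + \<i> * \<phi> (x * y' + y * x')"
      unfolding 2 using a b by (intro \<omega> sa_intros)
    moreover have "\<omega> a = \<phi> x + \<i> * \<phi> y" "\<omega> b = \<phi> x' + \<i> * \<phi> y'"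
      using a b \<omega> by simp_all
    ultimately show ?thesis using a(1,2) b(1,2)
      by (simp add: sa_intros \<phi>add \<phi>diff \<phi>mult) (simp add: algebra_simps)
  qed
  moreover have "\<omega> (c *\<^sub>C a) = c * \<omega> a" if ab: "a \<in> B" for a c
  proof -
    obtain x y where a: "x \<in> sa" "y \<in> sa" "a = x + \<i> *\<^sub>C y" using mem_parts[OF ab(1)] .
    have c: "c *\<^sub>C z = Re c *\<^sub>R z + \<i> *\<^sub>C (Im c *\<^sub>R z)" for z :: 'a
      using scaleC_add_left[of "complex_of_real (Re c)" "\<i> * Im c" z] complex_eq[of c]
      by (simp add: scaleR_scaleC scaleC_scaleC)
    have "c *\<^sub>C a = (Re c *\<^sub>R x - Im c *\<^sub>R y) + \<i> *\<^sub>C (Re c *\<^sub>R y + Im c *\<^sub>R x)"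
      unfolding a(3) c[of "x + \<i> *\<^sub>C y"]
      by (simp add: scaleC_add_right scaleC_scaleC scaleR_scaleC scaleC_minus_left mult.commute)
    moreover have "\<omega> \<dots> = \<phi> (Re c *\<^sub>R x - Im c *\<^sub>R y) + \<i> * \<phi> (Re c *\<^sub>R y + Im c *\<^sub>R x)"
      using a by (intro \<omega> sa_intros)
    ultimately have "\<omega> (c *\<^sub>C a) = (Re c * \<phi> x - Im c * \<phi> y) + \<i> * (Re c * \<phi> y + Im c * \<phi> x)"
      using a(1,2) by (simp add: sa_intros \<phi>add \<phi>diff \<phi>scale)
    moreover have "c * (\<phi> x + \<i> * \<phi> y) = (Re c * \<phi> x - Im c * \<phi> y) + \<i> * (Re c * \<phi> y + Im c * \<phi> x)"
      by (simp add: complex_eq_iff)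
    ultimately show ?thesis using a by (simp add: \<omega>)
  qed
  moreover have \<omega>sa: "\<omega> x = \<phi> x" if "x \<in> sa" for x
    using \<omega>[OF that sa_zero] \<phi>scale[OF sa_zero, of 0] by simp
  then have "\<omega> 1 = 1" using sa_one \<phi>one by simp
  moreover have "\<omega> a = 0" if "a \<notin> B" for a using that by (simp add: \<omega>_def)
  ultimately have "\<omega> \<in> characters B"
    unfolding characters_def clinear_on_def by auto
  moreover have "0 \<le> Re (\<omega> x)" if "x \<in> T" for x
    using that Q(2) Qs \<omega>sa \<phi>Q by auto
  ultimately show ?thesis by (rule that)
qed

text \<open>The Archimedean step. The identity k^2 (p + r - 1/k) = (k - s)^2 (p + r) + 2 k (s p - 1)
  + r s (2 k - s) + (k - s^2 p) transfers positivity from p + r to p + r - 1/k while r is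
  nonnegative. Finitely many such steps bring r from \<open>norm p\<close> down to 0 or
  below.\<close>

lemma pos_descend:
  assumes p: "p \<in> sa" and s: "s \<in> pos" and sp: "s * p - 1 \<in> pos"
  shows "p \<in> pos"
proof -
  \<comment> \<open>This k makes 2 k - s and k - s^2 p positive by their norms; the summand 1
    ensures k > 0.\<close>
  define k where "k = norm s + norm (s * s * p) + 1"
  have k: "k > 0" "norm s \<le> 2 * k" "norm (s * s * p) \<le> k"
    unfolding k_def by (smt (verit) norm_ge_zero)+
  obtain k2 where k2: "k2 = 2 * k" by blast
  have two: "k2 *\<^sub>R z = k *\<^sub>R z + k *\<^sub>R z" for z :: 'a
    unfolding k2 mult_2 by (rule scaleR_add_left)
  have ss: "s \<in> sa" using pos_sa[OF s] .
  have sps: "s * p = p * s" using ss p sa_commute by blast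
  have step: "p + (r - 1/k) *\<^sub>R 1 \<in> pos" if r: "0 \<le> r" "p + r *\<^sub>R 1 \<in> pos" for r
  proof -
    have "(k *\<^sub>R 1 - s) * (k *\<^sub>R 1 - s) * (p + r *\<^sub>R 1) \<in> pos"
      using ss r by (intro pos_mult pos_square sa_intros)
    moreover have "k2 *\<^sub>R (s * p - 1) \<in> pos" using sp k k2 by (intro pos_scaleR) auto
    moreover have "r *\<^sub>R (s * (k2 *\<^sub>R 1 - s)) \<in> pos"
      using r s k k2 ss by (intro pos_scaleR pos_mult norm_minus_pos) auto
    moreover have "k *\<^sub>R 1 - s * s * p \<in> pos"
      using k ss p by (intro norm_minus_pos sa_intros)
    ultimately have "(k *\<^sub>R 1 - s) * (k *\<^sub>R 1 - s) * (p + r *\<^sub>R 1) + k2 *\<^sub>R (s * p - 1)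
       + r *\<^sub>R (s * (k2 *\<^sub>R 1 - s)) + (k *\<^sub>R 1 - s * s * p) \<in> pos"
      by (intro pos_add)
    also have "(k *\<^sub>R 1 - s) * (k *\<^sub>R 1 - s) * (p + r *\<^sub>R 1) + k2 *\<^sub>R (s * p - 1)
       + r *\<^sub>R (s * (k2 *\<^sub>R 1 - s)) + (k *\<^sub>R 1 - s * s * p) = (k * k) *\<^sub>R (p + (r - 1/k) *\<^sub>R 1)"
    proof -
      have "(k * k) *\<^sub>R (p + (r - 1/k) *\<^sub>R 1) = (k * k) *\<^sub>R p + (k * (k * r)) *\<^sub>R 1 - k *\<^sub>R 1"
        using k(1) by (simp add: scaleR_add_right scaleR_diff_right right_diff_distrib scaleR_diff_left)
      then show ?thesis by (simp add: two sps algebra_simps)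
    qed
    finally have fin: "(k * k) *\<^sub>R (p + (r - 1/k) *\<^sub>R 1) \<in> pos" .
    have "(1 / (k * k)) *\<^sub>R ((k * k) *\<^sub>R (p + (r - 1/k) *\<^sub>R 1)) \<in> pos"
      using k(1) by (intro pos_scaleR[OF fin]) simp
    moreover have "(1 / (k * k)) *\<^sub>R ((k * k) *\<^sub>R z) = z" for z :: 'a
      using k(1) unfolding scaleR_scaleR by simp
    ultimately show ?thesis by metis
  qed
  \<comment> \<open>n bounds the number of steps still to be made. Once r is at most 0, p = (p + r)
    + (- r) is a sum of positive elements.\<close>
  have "p + r *\<^sub>R 1 \<in> pos \<Longrightarrow> r \<le> real n / k \<Longrightarrow> p \<in> pos" for r n
  proof (induction n arbitrary: r)
    case 0
    have "(p + r *\<^sub>R 1) + (- r) *\<^sub>R 1 \<in> pos"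
      using 0 by (intro pos_add[OF 0(1) pos_scaleR[OF pos_one]]) simp
    then show ?case by simp
  next
    case (Suc n)
    show ?case
    proof (cases "0 \<le> r")
      case True
      have "r - 1 / k \<le> real n / k" using Suc(3) k(1) by (simp add: add_divide_distrib)
      then show ?thesis using Suc.IH[OF step[OF True Suc(2)]] by blast
    next
      case False
      then have "(p + r *\<^sub>R 1) + (- r) *\<^sub>R 1 \<in> pos"
        by (intro pos_add[OF Suc(2) pos_scaleR[OF pos_one]]) simp
      then show ?thesis by simp
    qed
  qed
  moreover have "p + norm p *\<^sub>R 1 \<in> pos" using norm_plus_pos[OF p order_refl] by (simp add: add.commute)
  moreover obtain n where "norm p * k \<le> real n" using real_arch_simple by blast
  then have "norm p \<le> real n / k" using k(1) by (simp add: pos_le_divide_eq)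
  ultimately show ?thesis by blast
qed

text \<open>Adjoin \<open>- p\<close> to \<open>pos\<close>, where p = a + e. A character
  nonnegative on the result would be at most 0 at p, but every character is at least e there; so the
  result is improper. Its element \<open>- 1\<close> reads r p - 1 = q with q and r in
  \<open>pos\<close>, the situation of \<open>pos_descend\<close>.\<close>

lemma pos_of_characters_nonneg:
  assumes a: "a \<in> sa" and nn: "\<And>\<omega>. \<omega> \<in> characters B \<Longrightarrow> 0 \<le> Re (\<omega> a)" and e: "e > 0"
  shows "a + e *\<^sub>R 1 \<in> pos"
proof -
  define p where "p = a + e *\<^sub>R 1"
  have p: "p \<in> sa" using a by (simp add: p_def sa_intros)
  have pp: "preordering pos"
    using pos_sa pos_add pos_mult by (auto simp: preordering_def)
  define T where "T = {q + (- p) * r | q r. q \<in> pos \<and> r \<in> pos}"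
  note adj = preordering_adjoin[OF pp sa_minus[OF p]]
  have "- 1 \<in> T"
  proof (rule ccontr)
    assume "- 1 \<notin> T"
    then obtain \<omega> where \<omega>: "\<omega> \<in> characters B" "\<And>x. x \<in> T \<Longrightarrow> 0 \<le> Re (\<omega> x)"
      using character_nonneg_on_preordering[OF adj(1)] by (auto simp: T_def)
    have "- p \<in> T" using adj(3) by (simp add: T_def)
    then have "0 \<le> Re (\<omega> (- p))" by (rule \<omega>(2))
    moreover have "\<omega> (- p) = - \<omega> a - e"
    proof -
      have "- p = (-1) *\<^sub>C (a + complex_of_real e *\<^sub>C 1)"
        by (simp add: p_def scaleR_scaleC scaleC_minus_left)
      then show ?thesis using \<omega>(1) a one_mem
        by (simp add: characters_def clinear_on_def sa_mem add_mem scaleC_mem)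
    qed
    ultimately show False using nn[OF \<omega>(1)] e by simp
  qed
  then obtain q r where qr: "q \<in> pos" "r \<in> pos" "- 1 = q + (- p) * r" by (auto simp: T_def)
  have "p * r = r * p" using p pos_sa[OF qr(2)] sa_commute by blast
  then have "r * p - 1 = q" using qr(3) by (simp add: algebra_simps)
  then show ?thesis using pos_descend[OF p qr(2)] qr(1) by (simp add: p_def)
qed

text \<open>If the bound failed, rescaling would give b in B with norm below 1 and \<omega> b = 1.
  The contraction x \<mapsto> b + b x has a fixed point in the complete set B, and applying \<omega>
  to it yields \<omega> x = 1 + \<omega> x.\<close>

lemma character_norm_le:
  assumes \<omega>: "\<omega> \<in> characters B" and a: "a \<in> B"
  shows "cmod (\<omega> a) \<le> norm a"
proof (rule ccontr)
  assume "\<not> cmod (\<omega> a) \<le> norm a"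
  then have gt: "norm a < cmod (\<omega> a)" by simp
  then have nz: "\<omega> a \<noteq> 0" using norm_ge_zero[of a] by (metis norm_zero not_le)
  define b where "b = (1 / \<omega> a) *\<^sub>C a"
  have b: "b \<in> B" using a by (simp add: b_def scaleC_mem)
  have nb: "norm b < 1" using gt nz by (simp add: b_def norm_scaleC norm_divide divide_simps)
  have wb: "\<omega> b = 1" using \<omega> a nz by (simp add: b_def characters_def clinear_on_def)
  have "\<exists>!x\<in>B. b + b * x = x"
  proof (rule Banach_fix[where c="norm b"])
    show "complete B" using closed by (simp add: complete_eq_closed)
    show "B \<noteq> {}" using b by blast
    show "(\<lambda>x. b + b * x) ` B \<subseteq> B" using b by (auto intro!: add_mem mult_mem)
    show "dist (b + b * x) (b + b * y) \<le> norm b * dist x y" if "x \<in> B" "y \<in> B" for x y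
      using norm_mult_ineq[of b "x - y"] by (simp add: dist_norm right_diff_distrib)
  qed (use nb in auto)
  then obtain x where x: "x \<in> B" "b + b * x = x" by blast
  have "\<omega> (b + b * x) = \<omega> b + \<omega> b * \<omega> x"
    using \<omega> b x(1) by (simp add: characters_def clinear_on_def mult_mem)
  then show False using x(2) wb by simp
qed

text \<open>Arens' argument: the squared norm of h + i t is at most (norm h)^2 + t^2, whereas the
  squared modulus of its value contains the linear term 2 \<beta> t. For all real t this is possible
  only if \<beta> = 0.\<close>

lemma character_real:
  assumes \<omega>: "\<omega> \<in> characters B" and h: "h \<in> sa"
  shows "Im (\<omega> h) = 0"
proof -
  define \<alpha> \<beta> where "\<alpha> = Re (\<omega> h)" and "\<beta> = Im (\<omega> h)"
  have bound: "\<alpha>\<^sup>2 + \<beta>\<^sup>2 + 2 * \<beta> * t \<le> (norm h)\<^sup>2" for t :: real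
  proof -
    define w where "w = h + (\<i> * complex_of_real t) *\<^sub>C 1"
    have wB: "w \<in> B" using h by (simp add: w_def sa_mem add_mem scaleC_mem one_mem)
    have "\<omega> w = \<omega> h + \<i> * t"
      using \<omega> h one_mem by (simp add: w_def characters_def clinear_on_def sa_mem scaleC_mem)
    then have cw1: "(cmod (\<omega> w))\<^sup>2 = \<alpha>\<^sup>2 + (\<beta> + t)\<^sup>2"
      by (simp add: cmod_power2 \<alpha>_def \<beta>_def)
    have cw2: "(cmod (\<omega> w))\<^sup>2 \<le> (norm w)\<^sup>2"
      using character_norm_le[OF \<omega> wB] by (simp add: power_mono)
    have it: "\<i> * complex_of_real t * (\<i> * complex_of_real t) = - (complex_of_real t * complex_of_real t)"
      by (simp add: complex_eq_iff)
    have "star w * w = h * h + (t * t) *\<^sub>R 1"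
      using sa_star[OF h] by (simp add: w_def star_add star_scaleC distrib_left distrib_right
          mult_scaleC_left mult_scaleC_right scaleC_scaleC scaleC_minus_left scaleC_diff_right
          scaleC_add_right scaleR_scaleC left_diff_distrib it)
    then have "(norm w)\<^sup>2 \<le> norm (h * h) + norm ((t * t) *\<^sub>R (1::'a))"
      using cstar_identity[of w] norm_triangle_ineq[of "h * h" "(t * t) *\<^sub>R 1"] by simp
    then have "(norm w)\<^sup>2 \<le> (norm h)\<^sup>2 + t\<^sup>2"
      using norm_self_adjoint_square[OF sa_star[OF h]] mult_left_mono[OF norm_one_le[where 'a='a], of "t * t"]
      by (simp add: power2_eq_square)
    then have "(cmod (\<omega> w))\<^sup>2 \<le> (norm h)\<^sup>2 + t\<^sup>2" by (rule order_trans[OF cw2])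
    then show ?thesis using cw1 by (simp add: power2_eq_square algebra_simps)
  qed
  show ?thesis
  proof (rule ccontr)
    assume "Im (\<omega> h) \<noteq> 0"
    then have b: "\<beta> \<noteq> 0" by (simp add: \<beta>_def)
    \<comment> \<open>With this t the linear term alone is twice the right-hand side, and \<beta>^2
      > 0 remains.\<close>
    have "\<alpha>\<^sup>2 + \<beta>\<^sup>2 + 2 * \<beta> * ((norm h)\<^sup>2 / \<beta>) \<le> (norm h)\<^sup>2" by (rule bound)
    then have "\<beta>\<^sup>2 + (\<alpha>\<^sup>2 + (norm h)\<^sup>2) \<le> 0" using b by simp
    then show False using b by (smt (verit, best) zero_le_power2 zero_less_power2)
  qed
qed

end

section \<open>Sublinear and linear functionals\<close>

definition sublinear_on :: "'v::real_vector set \<Rightarrow> ('v \<Rightarrow> real) \<Rightarrow> bool" where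
  "sublinear_on E q \<longleftrightarrow> (\<forall>x\<in>E. \<forall>y\<in>E. q (x + y) \<le> q x + q y) \<and>
     (\<forall>x\<in>E. \<forall>r\<ge>0. q (r *\<^sub>R x) = r * q x)"

definition rlinear_on :: "'v::real_vector set \<Rightarrow> ('v \<Rightarrow> real) \<Rightarrow> bool" where
  "rlinear_on E q \<longleftrightarrow> (\<forall>x\<in>E. \<forall>y\<in>E. q (x + y) = q x + q y) \<and>
     (\<forall>x\<in>E. \<forall>r. q (r *\<^sub>R x) = r * q x)"

text \<open>Serves three infima: over a chain of sublinear functionals, over the shifts t x in the
  Hahn-Banach argument, and over the majorants of a continuous function in the extension
  theorem.\<close>

lemma sublinear_on_Inf:
  fixes A :: "'v::real_vector \<Rightarrow> real set"
  assumes E: "subspace E"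
    and ne: "\<And>x. x \<in> E \<Longrightarrow> A x \<noteq> {}" and bdd: "\<And>x. x \<in> E \<Longrightarrow> bdd_below (A x)"
    and add: "\<And>x y a b. x \<in> E \<Longrightarrow> y \<in> E \<Longrightarrow> a \<in> A x \<Longrightarrow> b \<in> A y \<Longrightarrow> \<exists>c\<in>A (x + y). c \<le> a + b"
    and scale: "\<And>x r a. x \<in> E \<Longrightarrow> r > 0 \<Longrightarrow> a \<in> A x \<Longrightarrow> \<exists>c\<in>A (r *\<^sub>R x). c \<le> r * a"
    and zero: "Inf (A 0) = 0"
  shows "sublinear_on E (\<lambda>x. Inf (A x))"
  unfolding sublinear_on_def
proof (intro conjI ballI allI impI)
  fix x y assume xy: "x \<in> E" "y \<in> E"
  have "Inf (A (x + y)) \<le> b + a" if "a \<in> A x" "b \<in> A y" for a b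
    using add[OF xy that] cInf_lower[OF _ bdd[OF subspace_add[OF E xy]]]
    unfolding add.commute[of b a] by (meson order_trans)
  then have "Inf (A (x + y)) - a \<le> Inf (A y)" if "a \<in> A x" for a
    using that by (intro cInf_greatest ne xy) (simp add: diff_le_eq)
  then have "Inf (A (x + y)) - Inf (A y) \<le> Inf (A x)"
    by (intro cInf_greatest ne xy) (simp add: algebra_simps)
  then show "Inf (A (x + y)) \<le> Inf (A x) + Inf (A y)" by simp
next
  fix x and r :: real assume x: "x \<in> E" and r: "0 \<le> r"
  \<comment> \<open>Only one inequality is proved directly; the converse is the same one for 1 /
    r.\<close>
  have le: "Inf (A (r *\<^sub>R x)) \<le> r * Inf (A x)" if x: "x \<in> E" and r: "r > 0" for r x
  proof -
    have "Inf (A (r *\<^sub>R x)) / r \<le> a" if "a \<in> A x" for a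
    proof -
      have "Inf (A (r *\<^sub>R x)) \<le> r * a"
        using scale[OF x r that] cInf_lower[OF _ bdd[OF subspace_scale[OF E x]]] by (meson order_trans)
      then show ?thesis using r by (simp add: divide_le_eq mult.commute)
    qed
    then have "Inf (A (r *\<^sub>R x)) / r \<le> Inf (A x)" by (intro cInf_greatest ne x)
    then show ?thesis using r by (simp add: divide_le_eq mult.commute)
  qed
  show "Inf (A (r *\<^sub>R x)) = r * Inf (A x)"
  proof (cases "r = 0")
    case False
    then have r: "r > 0" using r by simp
    have "Inf (A ((1 / r) *\<^sub>R (r *\<^sub>R x))) \<le> (1 / r) * Inf (A (r *\<^sub>R x))"
      using r by (intro le subspace_scale[OF E x]) simp
    then have "r * Inf (A x) \<le> Inf (A (r *\<^sub>R x))" using r by (simp add: field_simps)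
    then show ?thesis using le[OF x r] by simp
  qed (simp add: zero)
qed

text \<open>The Hahn-Banach theorem: a minimal sublinear functional \<open>m\<close> is linear, since
  \<open>y \<mapsto> inf\<^sub>t\<^sub>\<ge>\<^sub>0 (m (y + t x) - t m x)\<close> is a sublinear minorant of \<open>m\<close>.\<close>

theorem sublinear_dominates_linear:
  fixes p :: "'v::real_vector \<Rightarrow> real"
  assumes E: "subspace E" and p: "sublinear_on E p"
  obtains l where "rlinear_on E l" "\<And>x. x \<in> E \<Longrightarrow> l x \<le> p x"
proof -
  \<comment> \<open>Values outside E are fixed to 0. If E is not the whole type, they could
    otherwise be lowered for ever, and the pointwise order would have no minimal element.\<close>
  define \<A> where "\<A> = {q. sublinear_on E q \<and> (\<forall>x\<in>E. q x \<le> p x) \<and> (\<forall>x. x \<notin> E \<longrightarrow> q x = 0)}"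
  have zE: "0 \<in> E" using E by (rule subspace_0)
  have Eminus: "- x \<in> E" if "x \<in> E" for x using subspace_neg[OF E that] .
  have sub0: "q 0 = 0" if "sublinear_on E q" for q
    using that zE unfolding sublinear_on_def by (metis mult_zero_left order_refl scaleR_zero_left)
  have subneg: "- q (- x) \<le> q x" if "sublinear_on E q" "x \<in> E" for q x
  proof -
    have "q (x + - x) \<le> q x + q (- x)"
      using that Eminus unfolding sublinear_on_def by blast
    then show ?thesis using sub0[OF that(1)] by simp
  qed
  define R where "R q r \<longleftrightarrow> (\<forall>x. r x \<le> q x)" for q r :: "'v \<Rightarrow> real"
  have "\<exists>m\<in>\<A>. \<forall>q\<in>\<A>. R m q \<longrightarrow> q = m"
  proof (rule predicate_Zorn)
    show "partial_order_on \<A> (relation_of R \<A>)"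
      unfolding R_def by (intro partial_order_on_relation_ofI) (auto intro!: ext intro: order_trans order_antisym)
    fix C assume C: "C \<in> Chains (relation_of R \<A>)"
    have CA: "C \<subseteq> \<A>" using C by (auto simp: Chains_def relation_of_def)
    have tot: "R q r \<or> R r q" if "q \<in> C" "r \<in> C" for q r
      using C that by (auto simp: Chains_def relation_of_def)
    show "\<exists>u\<in>\<A>. \<forall>q\<in>C. R q u"
    proof (cases "C = {}")
      case True
      have "sublinear_on E (\<lambda>x. if x \<in> E then p x else 0)"
        using p E by (simp add: sublinear_on_def subspace_add subspace_scale)
      then have "(\<lambda>x. if x \<in> E then p x else 0) \<in> \<A>" by (simp add: \<A>_def)
      then show ?thesis using True by blast
    next
      case False
      define u where "u x = Inf ((\<lambda>q. q x) ` C)" for x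
      have Csub: "sublinear_on E q" "q x \<le> p x" if "q \<in> C" "x \<in> E" for q x
        using CA that by (auto simp: \<A>_def)
      have out: "q x = 0" if "q \<in> C" "x \<notin> E" for q x using CA that by (auto simp: \<A>_def)
      have bdd: "bdd_below ((\<lambda>q. q x) ` C)" for x
      proof (cases "x \<in> E")
        case True
        have "- p (- x) \<le> q x" if "q \<in> C" for q
          using subneg[OF Csub(1)[OF that True] True] Csub(2)[OF that Eminus[OF True]] by simp
        then show ?thesis by (auto simp: bdd_below_def)
      next
        case False
        then have "(\<lambda>q. q x) ` C \<subseteq> {0}" using out by blast
        then show ?thesis using bdd_below_mono by (metis bdd_below_finite finite.emptyI finite_insert)
      qed
      have "sublinear_on E u" unfolding u_def
      proof (rule sublinear_on_Inf[OF E])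
        fix x y a b assume xy: "x \<in> E" "y \<in> E" "a \<in> (\<lambda>q. q x) ` C" "b \<in> (\<lambda>q. q y) ` C"
        then obtain q r where qr: "q \<in> C" "r \<in> C" "a = q x" "b = r y" by blast
        have "\<exists>s\<in>C. s x \<le> q x \<and> s y \<le> r y"
          using tot[OF qr(1,2)] qr unfolding R_def by blast
        then obtain s where s: "s \<in> C" "s x \<le> q x" "s y \<le> r y" by blast
        then have "s (x + y) \<le> a + b"
          using Csub(1)[OF s(1) xy(1)] xy qr unfolding sublinear_on_def by (smt (verit, best))
        then show "\<exists>c\<in>(\<lambda>q. q (x + y)) ` C. c \<le> a + b" using s by blast
      next
        fix x r a assume "x \<in> E" "(r::real) > 0" "a \<in> (\<lambda>q. q x) ` C"
        then show "\<exists>c\<in>(\<lambda>q. q (r *\<^sub>R x)) ` C. c \<le> r * a"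
        proof -
          obtain q where q: "q \<in> C" "a = q x" using \<open>a \<in> (\<lambda>q. q x) ` C\<close> by blast
          then have "q (r *\<^sub>R x) = r * a"
            using Csub(1)[OF q(1) \<open>x \<in> E\<close>] \<open>x \<in> E\<close> \<open>r > 0\<close> by (simp add: sublinear_on_def)
          then show ?thesis using imageI[OF q(1), of "\<lambda>q. q (r *\<^sub>R x)"] by (intro bexI) auto
        qed
      next
        have "(\<lambda>q. q 0) ` C = {0}" using False sub0 Csub(1)[OF _ zE] by force
        then show "Inf ((\<lambda>q. q 0) ` C) = 0" by simp
      qed (use False bdd in auto)
      moreover have le: "u x \<le> q x" if "q \<in> C" for q x
        unfolding u_def using that bdd by (intro cInf_lower) auto
      moreover have "u x \<le> p x" if "x \<in> E" for x
        using False le Csub(2) that by (metis ex_in_conv order_trans)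
      moreover have "u x = 0" if "x \<notin> E" for x
      proof -
        have "(\<lambda>q. q x) ` C = {0}" using False out that by force
        then show ?thesis by (simp add: u_def)
      qed
      ultimately show ?thesis unfolding \<A>_def R_def by (intro bexI[of _ u]) auto
    qed
  qed
  then obtain m where mA: "m \<in> \<A>" and min: "\<And>q. q \<in> \<A> \<Longrightarrow> R m q \<Longrightarrow> q = m" by blast
  have m: "sublinear_on E m" "\<And>x. x \<in> E \<Longrightarrow> m x \<le> p x" "\<And>x. x \<notin> E \<Longrightarrow> m x = 0"
    using mA by (auto simp: \<A>_def)
  have madd: "m (x + y) \<le> m x + m y" if "x \<in> E" "y \<in> E" for x y
    using m(1) that by (simp add: sublinear_on_def)
  have mscale: "m (r *\<^sub>R x) = r * m x" if "x \<in> E" "0 \<le> r" for x r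
    using m(1) that by (simp add: sublinear_on_def)
  have key: "m y + m x \<le> m (y + x)" if x: "x \<in> E" and y: "y \<in> E" for x y
  proof -
    define A where "A y = {m (y + t *\<^sub>R x) - t * m x | t. t \<ge> 0}" for y
    have tx: "t *\<^sub>R x \<in> E" for t using subspace_scale[OF E x] .
    have lb: "- m (- y) \<le> a" if "y \<in> E" "a \<in> A y" for y a
    proof -
      obtain t where t: "t \<ge> 0" "a = m (y + t *\<^sub>R x) - t * m x" using \<open>a \<in> A y\<close> by (auto simp: A_def)
      have "m (t *\<^sub>R x) \<le> m (y + t *\<^sub>R x) + m (- y)"
        using madd[of "y + t *\<^sub>R x" "- y"] that(1) tx Eminus subspace_add[OF E] by simp
      then show ?thesis using mscale[OF x t(1)] t by simp
    qed
    have bdd: "bdd_below (A y)" if "y \<in> E" for y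
      using lb[OF that] unfolding bdd_below_def by blast
    have in0: "m y \<in> A y" for y unfolding A_def by (auto intro!: exI[of _ 0])
    define q where "q y = (if y \<in> E then Inf (A y) else 0)" for y
    have "sublinear_on E (\<lambda>y. Inf (A y))"
    proof (rule sublinear_on_Inf[OF E])
      fix y z a b assume yz: "y \<in> E" "z \<in> E" "a \<in> A y" "b \<in> A z"
      then obtain s t where st: "s \<ge> 0" "t \<ge> 0" "a = m (y + s *\<^sub>R x) - s * m x"
        "b = m (z + t *\<^sub>R x) - t * m x" by (auto simp: A_def)
      have "m ((y + s *\<^sub>R x) + (z + t *\<^sub>R x)) \<le> m (y + s *\<^sub>R x) + m (z + t *\<^sub>R x)"
        using yz tx by (intro madd subspace_add[OF E])
      moreover have "(y + s *\<^sub>R x) + (z + t *\<^sub>R x) = (y + z) + (s + t) *\<^sub>R x"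
        by (simp add: scaleR_add_left)
      ultimately have "m ((y + z) + (s + t) *\<^sub>R x) - (s + t) * m x \<le> a + b"
        using st by (simp add: distrib_right)
      moreover have "m ((y + z) + (s + t) *\<^sub>R x) - (s + t) * m x \<in> A (y + z)"
        unfolding A_def using st(1,2) by (intro CollectI exI[of _ "s + t"]) simp
      ultimately show "\<exists>c\<in>A (y + z). c \<le> a + b" by blast
    next
      fix y r a assume y: "y \<in> E" "(r::real) > 0" "a \<in> A y"
      then obtain t where t: "t \<ge> 0" "a = m (y + t *\<^sub>R x) - t * m x" by (auto simp: A_def)
      have "m (r *\<^sub>R y + (r * t) *\<^sub>R x) = r * m (y + t *\<^sub>R x)"
        using mscale[of "y + t *\<^sub>R x" r] y subspace_add[OF E y(1) tx] by (simp add: scaleR_add_right)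
      then have "r * a = m (r *\<^sub>R y + (r * t) *\<^sub>R x) - (r * t) * m x"
        using t by (simp add: right_diff_distrib)
      moreover have "\<dots> \<in> A (r *\<^sub>R y)"
        unfolding A_def using t(1) y(2) by (intro CollectI exI[of _ "r * t"]) simp
      ultimately show "\<exists>c\<in>A (r *\<^sub>R y). c \<le> r * a" by (metis order_refl)
    next
      have "a = 0" if "a \<in> A 0" for a using that mscale[OF x] by (auto simp: A_def)
      moreover have "0 \<in> A 0" using in0[of 0] sub0[OF m(1)] by simp
      ultimately have "A 0 = {0}" by auto
      then show "Inf (A 0) = 0" by simp
    qed (use in0 bdd in auto)
    then have qsub: "sublinear_on E q"
      using E by (simp add: sublinear_on_def q_def subspace_add subspace_scale)
    have qm: "q y \<le> m y" for y
      using cInf_lower[OF in0 bdd] m(3) by (simp add: q_def)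
    have "q \<in> \<A>"
      unfolding \<A>_def using qsub order_trans[OF qm m(2)] by (simp add: q_def)
    then have "q = m" using qm by (intro min) (simp_all add: R_def)
    \<comment> \<open>Only t = 1 is evaluated, since q = m by now; the other values of t served to
      make q sublinear.\<close>
    moreover have "m (y + x) - m x \<in> A y" by (auto simp: A_def intro!: exI[of _ 1])
    then have "q y \<le> m (y + x) - m x" using cInf_lower[OF _ bdd[OF y]] y by (simp add: q_def)
    ultimately show ?thesis by simp
  qed
  have add: "m (x + y) = m x + m y" if "x \<in> E" "y \<in> E" for x y
    using key[OF that(2,1)] madd[OF that] by simp
  have neg: "m (- x) = - m x" if "x \<in> E" for x
    using add[OF that Eminus[OF that]] sub0[OF m(1)] by simp
  have "m (r *\<^sub>R x) = r * m x" if "x \<in> E" for r x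
    using mscale[OF that, of r] mscale[OF Eminus[OF that], of "- r"] neg[OF that]
    by (cases "0 \<le> r") auto
  then show ?thesis using that[of m] add m(2) by (simp add: rlinear_on_def)
qed

section \<open>The Riesz-Markov theorem on compact Hausdorff spaces\<close>

abbreviation cfun :: "'b topology \<Rightarrow> ('b \<Rightarrow> real) set" where
  "cfun X \<equiv> {f. continuous_map X euclideanreal f}"

lemma sets_borel_on: "sets (borel_on X) = sigma_sets (topspace X) {U. openin X U}"
  unfolding borel_on_def by (rule sets_measure_of) (auto dest: openin_subset)

lemma space_borel_on [simp]: "space (borel_on X) = topspace X"
  unfolding borel_on_def by (rule space_measure_of) (auto dest: openin_subset)

lemma openin_sets_borel_on: "openin X U \<Longrightarrow> U \<in> sets (borel_on X)"
  by (simp add: sets_borel_on)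

lemma closedin_sets_borel_on: "closedin X C \<Longrightarrow> C \<in> sets (borel_on X)"
proof -
  assume C: "closedin X C"
  then have "topspace X - C \<in> sets (borel_on X)" by (auto intro: openin_sets_borel_on)
  then have "space (borel_on X) - (topspace X - C) \<in> sets (borel_on X)" by (rule sets.compl_sets)
  moreover have "topspace X - (topspace X - C) = C" using closedin_subset[OF C] by blast
  ultimately show ?thesis by simp
qed

lemma continuous_map_borel_on:
  assumes "continuous_map X Y f"
  shows "f \<in> measurable (borel_on X) (borel_on Y)"
  unfolding borel_on_def[of Y]
proof (rule measurable_measure_of)
  show "f \<in> space (borel_on X) \<rightarrow> topspace Y" using assms by (auto simp: continuous_map_def)
  show "f -` U \<inter> space (borel_on X) \<in> sets (borel_on X)" if "U \<in> {U. openin Y U}" for U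
  proof -
    have "openin X {x \<in> topspace X. f x \<in> U}" using assms that by (auto simp: continuous_map_def)
    moreover have "f -` U \<inter> space (borel_on X) = {x \<in> topspace X. f x \<in> U}" by auto
    ultimately show ?thesis using openin_sets_borel_on by metis
  qed
qed (auto dest: openin_subset)

lemma borel_measurable_open_superlevel:
  fixes f :: "'b \<Rightarrow> 'c::{second_countable_topology, linorder_topology}"
  assumes "\<And>c. openin X {x \<in> topspace X. c < f x}"
  shows "f \<in> borel_measurable (borel_on X)"
  by (rule borel_measurableI_greater) (use assms openin_sets_borel_on in auto)

lemma continuous_map_borel_measurable:
  fixes f :: "'b \<Rightarrow> 'c::topological_space"
  assumes "continuous_map X euclidean f" and "sets m = sets (borel_on X)"
  shows "f \<in> borel_measurable m"
proof -
  have "f \<in> borel_measurable (borel_on X)"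
  proof (rule borel_measurableI)
    fix S :: "'c set" assume "open S"
    then have "openin X {x \<in> topspace X. f x \<in> S}" using assms(1) by (auto simp: continuous_map_def)
    then have "{x \<in> topspace X. f x \<in> S} \<in> sets (borel_on X)" by (rule openin_sets_borel_on)
    moreover have "f -` S \<inter> space (borel_on X) = {x \<in> topspace X. f x \<in> S}" by auto
    ultimately show "f -` S \<inter> space (borel_on X) \<in> sets (borel_on X)" by simp
  qed
  then show ?thesis using measurable_cong_sets[OF assms(2) refl] by blast
qed

lemma radon_prob_sets: "radon_prob X m \<Longrightarrow> sets m = sets (borel_on X)"
  and radon_prob_space: "radon_prob X m \<Longrightarrow> space m = topspace X"
  and radon_prob_prob_space: "radon_prob X m \<Longrightarrow> prob_space m"
  using sets_eq_imp_space_eq[of m "borel_on X"] by (auto simp: radon_prob_def intro: prob_spaceI)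

lemma compact_space_bounded:
  fixes f :: "'b \<Rightarrow> 'c::real_normed_vector"
  assumes "compact_space X" "continuous_map X euclidean f"
  obtains M where "M > 0" "\<And>x. x \<in> topspace X \<Longrightarrow> norm (f x) \<le> M"
proof -
  have "compactin euclidean (f ` topspace X)"
    using assms image_compactin compact_space_def by blast
  then have "bounded (f ` topspace X)" by (simp add: compact_imp_bounded)
  then obtain M where "M > 0" "\<forall>y\<in>f ` topspace X. norm y \<le> M" using bounded_pos by blast
  then show ?thesis using that by blast
qed

lemma radon_prob_integrable:
  fixes f :: "'b \<Rightarrow> 'c::{banach, second_countable_topology}"
  assumes "compact_space X" "radon_prob X m" "continuous_map X euclidean f"
  shows "integrable m f"
proof -
  interpret prob_space m using assms(2) by (rule radon_prob_prob_space)
  obtain M where M: "\<And>x. x \<in> topspace X \<Longrightarrow> norm (f x) \<le> M"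
    using compact_space_bounded[OF assms(1,3)] by blast
  show ?thesis
    by (rule integrable_const_bound[where B=M])
      (use M radon_prob_space[OF assms(2)] continuous_map_borel_measurable[OF assms(3) radon_prob_sets[OF assms(2)]]
        in auto)
qed

lemma compact_Hausdorff_Urysohn:
  assumes "compact_space X" "Hausdorff_space X" "closedin X S" "closedin X T" "S \<inter> T = {}"
  obtains f where "continuous_map X euclideanreal f" "\<And>x. x \<in> topspace X \<Longrightarrow> 0 \<le> f x \<and> f x \<le> (1::real)"
    "\<And>x. x \<in> S \<Longrightarrow> f x = 0" "\<And>x. x \<in> T \<Longrightarrow> f x = 1"
proof -
  have "normal_space X" using assms compact_Hausdorff_or_regular_imp_normal_space by blast
  then obtain f where f: "continuous_map X (top_of_set {0..1::real}) f" "f ` S \<subseteq> {0}" "f ` T \<subseteq> {1}"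
    using Urysohn_lemma[of X S T 0 1] assms by (auto simp: disjnt_def)
  then have "continuous_map X euclideanreal f" "f ` topspace X \<subseteq> {0..1}"
    by (auto simp: continuous_map_in_subtopology)
  then show ?thesis using f that[of f] by (auto simp: image_subset_iff)
qed

text \<open>Cuts the interval from 0 to n into unit layers. \<open>functional_le_integral\<close>
  uses it twice: to bound n f by its layers, and, shifted by 1, to bound the number of superlevel
  sets containing a point.\<close>

lemma sum_clamp:
  fixes t :: real assumes "0 \<le> t"
  shows "(\<Sum>k<n. min (max (t - real k) 0) 1) = min t (real n)"
  using assms by (induction n) auto

section \<open>A positive functional and the outer measure that it defines\<close>

locale positive_functional =
  fixes X :: "'b topology" and \<Lambda> :: "('b \<Rightarrow> real) \<Rightarrow> real"
  assumes compact: "compact_space X" and Hausdorff: "Hausdorff_space X"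
    and add: "\<And>f g. f \<in> cfun X \<Longrightarrow> g \<in> cfun X \<Longrightarrow> \<Lambda> (\<lambda>x. f x + g x) = \<Lambda> f + \<Lambda> g"
    and scale: "\<And>f r. f \<in> cfun X \<Longrightarrow> \<Lambda> (\<lambda>x. r * f x) = r * \<Lambda> f"
    and nonneg: "\<And>f. f \<in> cfun X \<Longrightarrow> (\<And>x. x \<in> topspace X \<Longrightarrow> 0 \<le> f x) \<Longrightarrow> 0 \<le> \<Lambda> f"
    and one: "\<Lambda> (\<lambda>_. 1) = 1"
begin

lemma const: "\<Lambda> (\<lambda>_. c) = c"
  using scale[of "\<lambda>_. 1" c] one by simp

lemma mono:
  assumes "f \<in> cfun X" "g \<in> cfun X" "\<And>x. x \<in> topspace X \<Longrightarrow> f x \<le> g x"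
  shows "\<Lambda> f \<le> \<Lambda> g"
proof -
  have "0 \<le> \<Lambda> (\<lambda>x. g x + (-1) * f x)"
    using assms by (intro nonneg) (auto intro!: continuous_intros)
  also have "\<dots> = \<Lambda> g - \<Lambda> f"
    using assms add[of g "\<lambda>x. (-1) * f x"] scale[of f "-1"] by (simp add: continuous_map_minus)
  finally show ?thesis by simp
qed

lemma sum:
  fixes n :: nat
  assumes "\<And>k. k < n \<Longrightarrow> f k \<in> cfun X"
  shows "\<Lambda> (\<lambda>x. \<Sum>k<n. f k x) = (\<Sum>k<n. \<Lambda> (f k))"
  using assms
proof (induction n)
  case 0
  then show ?case using const[of 0] by simp
next
  case (Suc n)
  then show ?case
    using add[of "\<lambda>x. \<Sum>k<n. f k x" "f n"] continuous_map_sum[of "{..<n}" X "\<lambda>x i. f i x"] by simp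
qed

text \<open>Functions need only vanish off U; compact support inside U, as in the usual
  construction, is recovered by \<open>truncate\<close> at the price of an arbitrarily small
  e.\<close>

definition below :: "'b set \<Rightarrow> ('b \<Rightarrow> real) set" where
  "below U = {f \<in> cfun X. (\<forall>x\<in>topspace X. 0 \<le> f x \<and> f x \<le> 1) \<and> (\<forall>x\<in>topspace X - U. f x = 0)}"

definition open_content :: "'b set \<Rightarrow> real" where
  "open_content U = Sup (\<Lambda> ` below U)"

definition outer :: "'b set \<Rightarrow> real" where
  "outer E = Inf (open_content ` {U. openin X U \<and> E \<subseteq> U})"

lemma below_bounds: "f \<in> below U \<Longrightarrow> 0 \<le> \<Lambda> f \<and> \<Lambda> f \<le> 1"
  using nonneg[of f] mono[of f "\<lambda>_. 1"] one by (auto simp: below_def)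

lemma zero_below: "(\<lambda>_. 0) \<in> below U"
  by (simp add: below_def)

lemma content_upper: "f \<in> below U \<Longrightarrow> \<Lambda> f \<le> open_content U"
  unfolding open_content_def using below_bounds by (intro cSUP_upper) (auto simp: bdd_above_def)

lemma content_least: "(\<And>f. f \<in> below U \<Longrightarrow> \<Lambda> f \<le> c) \<Longrightarrow> open_content U \<le> c"
  unfolding open_content_def using zero_below by (intro cSUP_least) auto

lemma content_nonneg: "0 \<le> open_content U"
  using content_upper[OF zero_below] const[of 0] by simp

lemma content_mono: "U \<subseteq> V \<Longrightarrow> open_content U \<le> open_content V"
  by (intro content_least content_upper) (auto simp: below_def)

lemma content_empty: "open_content {} = 0"
proof (rule antisym)
  show "open_content {} \<le> 0"
  proof (rule content_least)
    fix f assume "f \<in> below {}"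
    then show "\<Lambda> f \<le> 0" using mono[of f "\<lambda>_. 0"] const[of 0] by (auto simp: below_def)
  qed
qed (rule content_nonneg)

lemma content_topspace: "open_content (topspace X) = 1"
proof (rule antisym)
  show "open_content (topspace X) \<le> 1" using below_bounds by (intro content_least) auto
  have "(\<lambda>_. 1) \<in> below (topspace X)" by (simp add: below_def)
  from content_upper[OF this] show "1 \<le> open_content (topspace X)" using one by simp
qed

lemma outer_lower: "openin X U \<Longrightarrow> E \<subseteq> U \<Longrightarrow> outer E \<le> open_content U"
  unfolding outer_def using content_nonneg by (intro cINF_lower) (auto simp: bdd_below_def)

lemma outer_greatest:
  assumes "E \<subseteq> topspace X" "\<And>U. openin X U \<Longrightarrow> E \<subseteq> U \<Longrightarrow> c \<le> open_content U"
  shows "c \<le> outer E"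
  unfolding outer_def using assms by (intro cINF_greatest) auto

lemma outer_approx:
  assumes "E \<subseteq> topspace X" "e > 0"
  obtains U where "openin X U" "E \<subseteq> U" "open_content U < outer E + e"
proof -
  have "\<not> outer E + e \<le> outer E" using assms(2) by simp
  then have "\<exists>U. openin X U \<and> E \<subseteq> U \<and> \<not> outer E + e \<le> open_content U"
    using outer_greatest[OF assms(1)] by blast
  then show ?thesis using that by force
qed

lemma outer_open: "openin X U \<Longrightarrow> outer U = open_content U"
  by (intro antisym outer_lower outer_greatest content_mono) (auto dest: openin_subset)

lemma outer_nonneg: "E \<subseteq> topspace X \<Longrightarrow> 0 \<le> outer E"
  by (rule outer_greatest) (auto intro: content_nonneg)

lemma outer_mono: "E \<subseteq> F \<Longrightarrow> F \<subseteq> topspace X \<Longrightarrow> outer E \<le> outer F"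
  by (rule outer_greatest) (auto intro: outer_lower)

lemma closedin_superlevel:
  assumes "f \<in> cfun X" shows "closedin X {x \<in> topspace X. e \<le> f x}"
  using closedin_continuous_map_preimage[of X euclideanreal f "{e..}"] assms by simp

text \<open>Subtracting e costs at most e because \<Lambda> maps the constant 1 to 1. The truncated
  function lives on the superlevel set where e \<le> f, which is closed and contained in U.\<close>

lemma truncate:
  assumes f: "f \<in> below U" and e: "e > 0"
  shows "(\<lambda>x. max (f x - e) 0) \<in> below {x \<in> U. e \<le> f x}"
    and "\<Lambda> f \<le> \<Lambda> (\<lambda>x. max (f x - e) 0) + e"
proof -
  have c: "(\<lambda>x. max (f x - e) 0) \<in> cfun X"
    using f by (auto simp: below_def intro!: continuous_map_real_max continuous_intros)
  then show "(\<lambda>x. max (f x - e) 0) \<in> below {x \<in> U. e \<le> f x}"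
    using f e unfolding below_def by (auto simp: max_def) (metis DiffI not_le order.strict_iff_order)
  have "\<Lambda> f \<le> \<Lambda> (\<lambda>x. max (f x - e) 0 + e)"
    using f c by (intro mono) (auto simp: below_def intro!: continuous_intros)
  also have "\<dots> = \<Lambda> (\<lambda>x. max (f x - e) 0) + e"
    using add[OF c, of "\<lambda>_. e"] const by simp
  finally show "\<Lambda> f \<le> \<Lambda> (\<lambda>x. max (f x - e) 0) + e" .
qed

text \<open>The superlevel set C is covered by U and V, so C - U and C - V are disjoint closed sets.
  A Urysohn function g for them splits the truncation h into h g below U and h (1 - g) below
  V.\<close>

lemma content_Un:
  assumes U: "openin X U" and V: "openin X V"
  shows "open_content (U \<union> V) \<le> open_content U + open_content V"
proof (rule content_least)
  fix f assume f: "f \<in> below (U \<union> V)"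
  show "\<Lambda> f \<le> open_content U + open_content V"
  proof (rule field_le_epsilon)
    fix e :: real assume e: "e > 0"
    define C where "C = {x \<in> topspace X. e \<le> f x}"
    define h where "h x = max (f x - e) 0" for x
    note tr = truncate[OF f e, folded h_def]
    have clC: "closedin X C" using f closedin_superlevel by (simp add: C_def below_def)
    have CUV: "C \<subseteq> U \<union> V" using f e by (force simp: C_def below_def)
    obtain g where g: "continuous_map X euclideanreal g" "\<And>x. x \<in> topspace X \<Longrightarrow> 0 \<le> g x \<and> g x \<le> 1"
      "\<And>x. x \<in> C - U \<Longrightarrow> g x = 0" "\<And>x. x \<in> C - V \<Longrightarrow> g x = (1::real)"
    proof (rule compact_Hausdorff_Urysohn[OF compact Hausdorff, of "C - U" "C - V"])
      show "closedin X (C - U)" "closedin X (C - V)" using clC U V by (auto intro: closedin_diff)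
      show "(C - U) \<inter> (C - V) = {}" using CUV by blast
    qed (rule that)
    have hc: "h \<in> cfun X" and hb: "\<And>x. x \<in> topspace X \<Longrightarrow> 0 \<le> h x \<and> h x \<le> 1"
      and h0: "\<And>x. x \<in> topspace X \<Longrightarrow> x \<notin> C \<Longrightarrow> h x = 0"
      using tr(1) by (auto simp: below_def C_def)
    have "(\<lambda>x. h x * g x) \<in> below U" "(\<lambda>x. h x * (1 - g x)) \<in> below V"
      using hc g hb h0 unfolding below_def
      by (auto intro!: continuous_intros mult_nonneg_nonneg mult_le_one) (metis DiffI)+
    then have "\<Lambda> (\<lambda>x. h x * g x) + \<Lambda> (\<lambda>x. h x * (1 - g x)) \<le> open_content U + open_content V"
      by (intro add_mono content_upper)
    also have "\<Lambda> (\<lambda>x. h x * g x) + \<Lambda> (\<lambda>x. h x * (1 - g x)) = \<Lambda> (\<lambda>x. h x * g x + h x * (1 - g x))"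
      using hc g(1) by (intro add[symmetric]) (auto intro!: continuous_intros)
    also have "(\<lambda>x. h x * g x + h x * (1 - g x)) = h" by (simp add: algebra_simps)
    finally show "\<Lambda> f \<le> open_content U + open_content V + e" using tr(2) by simp
  qed
qed

lemma content_UN_finite:
  fixes n :: nat
  assumes "\<And>i. openin X (U i)"
  shows "open_content (\<Union>i<n. U i) \<le> (\<Sum>i<n. open_content (U i))"
proof (induction n)
  case (Suc n)
  have "open_content ((\<Union>i<n. U i) \<union> U n) \<le> open_content (\<Union>i<n. U i) + open_content (U n)"
    using assms by (intro content_Un openin_Union) auto
  moreover have "(\<Union>i<Suc n. U i) = (\<Union>i<n. U i) \<union> U n" by (auto simp: less_Suc_eq)
  ultimately show ?case using Suc by simp
qed (simp add: content_empty)

text \<open>Compactness of a superlevel set leaves finitely many of the \<open>U i\<close>. Bounding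
  all partial sums by s avoids any question of summability.\<close>

lemma content_UN_le:
  fixes U :: "nat \<Rightarrow> 'b set"
  assumes U: "\<And>i. openin X (U i)" and s: "\<And>n. (\<Sum>i<n. open_content (U i)) \<le> s"
  shows "open_content (\<Union>i. U i) \<le> s"
proof (rule content_least)
  fix f assume f: "f \<in> below (\<Union>i. U i)"
  show "\<Lambda> f \<le> s"
  proof (rule field_le_epsilon)
    fix e :: real assume e: "e > 0"
    define C where "C = {x \<in> topspace X. e \<le> f x}"
    have "closedin X C" using f closedin_superlevel by (simp add: C_def below_def)
    then have cC: "compactin X C" using compact closedin_compact_space by blast
    have "C \<subseteq> \<Union>(range U)" using f e by (force simp: C_def below_def)
    then obtain F where F: "finite F" "F \<subseteq> range U" "C \<subseteq> \<Union>F"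
      using cC U unfolding compactin_def by (metis (no_types, lifting) rangeE)
    obtain I where I: "finite I" "F = U ` I" using finite_subset_image[OF F(1,2)] by blast
    obtain n where n: "I \<subseteq> {..<n}" using finite_nat_iff_bounded I(1) by blast
    have Cn: "C \<subseteq> (\<Union>i<n. U i)" using F(3) I(2) n by blast
    have "{x \<in> \<Union>i. U i. e \<le> f x} \<subseteq> (\<Union>i<n. U i)"
    proof
      fix x assume x: "x \<in> {x \<in> \<Union>i. U i. e \<le> f x}"
      then have "x \<in> topspace X" using U openin_subset by blast
      then show "x \<in> (\<Union>i<n. U i)" using x Cn by (auto simp: C_def)
    qed
    then have "\<Lambda> (\<lambda>x. max (f x - e) 0) \<le> open_content (\<Union>i<n. U i)"
      using content_upper[OF truncate(1)[OF f e]] content_mono by (meson order_trans)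
    also have "\<dots> \<le> s" using content_UN_finite[of U n, OF U] s[of n] by linarith
    finally show "\<Lambda> f \<le> s + e" using truncate(2)[OF f e] by simp
  qed
qed

lemma outer_UN_le:
  fixes A :: "nat \<Rightarrow> 'b set"
  assumes A: "\<And>i. A i \<subseteq> topspace X" and s: "\<And>n. (\<Sum>i<n. outer (A i)) \<le> s"
  shows "outer (\<Union>i. A i) \<le> s"
proof (rule field_le_epsilon)
  fix e :: real assume e: "e > 0"
  have "\<exists>U. openin X U \<and> A i \<subseteq> U \<and> open_content U < outer (A i) + e * (1/2) ^ Suc i" for i
    using outer_approx[OF A, of "e * (1/2) ^ Suc i" i] e by (metis mult_pos_pos zero_less_power zero_less_divide_1_iff zero_less_numeral)
  then obtain U where U: "\<And>i. openin X (U i)" "\<And>i. A i \<subseteq> U i"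
    "\<And>i. open_content (U i) < outer (A i) + e * (1/2) ^ Suc i" by metis
  have geo: "(\<Sum>i<n. (1/2::real) ^ Suc i) = 1 - (1/2) ^ n" for n
    by (induction n) (simp_all add: field_simps)
  have "(\<Sum>i<n. open_content (U i)) \<le> s + e" for n
  proof -
    have "(\<Sum>i<n. open_content (U i)) \<le> (\<Sum>i<n. outer (A i) + e * (1/2) ^ Suc i)"
      using U(3) by (intro sum_mono less_imp_le)
    also have "\<dots> = (\<Sum>i<n. outer (A i)) + e * (1 - (1/2) ^ n)"
      unfolding sum.distrib sum_distrib_left[symmetric] geo ..
    also have "\<dots> \<le> s + e * 1" using s e by (intro add_mono mult_left_mono) auto
    finally show ?thesis by simp
  qed
  then have "open_content (\<Union>i. U i) \<le> s + e" by (intro content_UN_le U)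
  moreover have "outer (\<Union>i. A i) \<le> open_content (\<Union>i. U i)"
    using U by (intro outer_lower openin_Union) auto
  ultimately show "outer (\<Union>i. A i) \<le> s + e" by simp
qed

lemma outer_measure_space_outer: "outer_measure_space (Pow (topspace X)) (\<lambda>E. ennreal (outer E))"
  unfolding outer_measure_space_def
proof (intro conjI)
  show "positive (Pow (topspace X)) (\<lambda>E. ennreal (outer E))"
    using outer_open[of "{}"] content_empty by (simp add: positive_def)
  show "increasing (Pow (topspace X)) (\<lambda>E. ennreal (outer E))"
    using outer_mono by (auto simp: increasing_def intro: ennreal_leI)
  show "countably_subadditive (Pow (topspace X)) (\<lambda>E. ennreal (outer E))"
    unfolding countably_subadditive_def
  proof (intro allI impI)
    fix A :: "nat \<Rightarrow> 'b set"
    assume "range A \<subseteq> Pow (topspace X)"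
    then have A: "A i \<subseteq> topspace X" for i by blast
    show "ennreal (outer (\<Union>i. A i)) \<le> (\<Sum>i. ennreal (outer (A i)))"
    proof (cases "(\<Sum>i. ennreal (outer (A i)))")
      case (real s)
      have "(\<Sum>i<n. outer (A i)) \<le> s" for n
      proof -
        have "ennreal (\<Sum>i<n. outer (A i)) = (\<Sum>i<n. ennreal (outer (A i)))"
          using outer_nonneg[OF A] by simp
        also have "\<dots> \<le> ennreal s" unfolding real(2)[symmetric] by (intro sum_le_suminf) auto
        finally show ?thesis using real(1) by simp
      qed
      then show ?thesis using real outer_UN_le[OF A] by (simp add: ennreal_leI)
    qed simp
  qed
qed

text \<open>Take V around E with content close to \<open>outer E\<close>. A truncated h below V
  \<inter> U lives on a closed C inside U, so a g below V - C can be added to it without exceeding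
  1, while V - C still covers the part of E outside U. The error is halved because approximation and
  truncation each cost e.\<close>

lemma outer_split:
  assumes U: "openin X U" and E: "E \<subseteq> topspace X"
  shows "outer (U \<inter> E) + outer ((topspace X - U) \<inter> E) \<le> outer E"
proof (rule field_le_epsilon)
  fix e0 :: real assume e0: "e0 > 0"
  define e where "e = e0 / 2"
  have e: "e > 0" using e0 by (simp add: e_def)
  obtain V where V: "openin X V" "E \<subseteq> V" "open_content V < outer E + e" using outer_approx[OF E e] .
  have "open_content (V \<inter> U) \<le> open_content V - outer ((topspace X - U) \<inter> E) + e"
  proof (rule content_least)
    fix f assume f: "f \<in> below (V \<inter> U)"
    define C where "C = {x \<in> topspace X. e \<le> f x}"
    define h where "h x = max (f x - e) 0" for x
    note tr = truncate[OF f e, folded h_def]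
    have clC: "closedin X C" using f closedin_superlevel by (simp add: C_def below_def)
    have W: "openin X (V - C)" using V(1) clC by (simp add: openin_diff)
    have hc: "h \<in> cfun X" and hb: "\<And>x. x \<in> topspace X \<Longrightarrow> 0 \<le> h x \<and> h x \<le> 1"
      and h0: "\<And>x. x \<in> topspace X \<Longrightarrow> x \<notin> C \<Longrightarrow> h x = 0" and hV: "\<And>x. x \<in> topspace X \<Longrightarrow> x \<notin> V \<Longrightarrow> h x = 0"
      using tr(1) by (auto simp: below_def C_def)
    have "(topspace X - U) \<inter> E \<subseteq> V - C"
      using V(2) f e by (force simp: C_def below_def)
    then have "outer ((topspace X - U) \<inter> E) \<le> open_content (V - C)" by (rule outer_lower[OF W])
    also have "\<dots> \<le> open_content V - \<Lambda> h"
    proof (rule content_least)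
      fix g assume g: "g \<in> below (V - C)"
      have "(\<lambda>x. h x + g x) \<in> below V"
        unfolding below_def
      proof (intro CollectI conjI ballI)
        show "continuous_map X euclideanreal (\<lambda>x. h x + g x)"
          using hc g by (auto simp: below_def intro!: continuous_intros)
        fix x assume x: "x \<in> topspace X"
        show "0 \<le> h x + g x" using hb[OF x] g x by (auto simp: below_def)
        show "h x + g x \<le> 1" using hb[OF x] h0[OF x] g x by (cases "x \<in> C") (auto simp: below_def)
      qed (use hV g in \<open>auto simp: below_def\<close>)
      from content_upper[OF this] show "\<Lambda> g \<le> open_content V - \<Lambda> h"
        using add[OF hc, of g] g by (simp add: below_def)
    qed
    finally show "\<Lambda> f \<le> open_content V - outer ((topspace X - U) \<inter> E) + e" using tr(2) by simp
  qed
  moreover have "outer (U \<inter> E) \<le> open_content (V \<inter> U)"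
    using V U by (intro outer_lower) auto
  ultimately show "outer (U \<inter> E) + outer ((topspace X - U) \<inter> E) \<le> outer E + e0"
    using V(3) by (simp add: e_def)
qed

lemma open_in_lambda_system:
  assumes "openin X U"
  shows "U \<in> lambda_system (topspace X) (Pow (topspace X)) (\<lambda>E. ennreal (outer E))"
  unfolding lambda_system_def
proof (intro CollectI conjI ballI)
  show "U \<in> Pow (topspace X)" using openin_subset[OF assms] by simp
  fix E assume "E \<in> Pow (topspace X)"
  then have E: "E \<subseteq> topspace X" by simp
  let ?A = "U \<inter> E" and ?B = "(topspace X - U) \<inter> E"
  have nn: "0 \<le> outer ?A" "0 \<le> outer ?B" "0 \<le> outer {}" using E by (auto intro: outer_nonneg)
  \<comment> \<open>Subadditivity for two sets, taken from the countable case with the sequence A,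
    B, empty, empty, and so on.\<close>
  have "outer (\<Union>i. (\<lambda>i::nat. if i = 0 then ?A else if i = 1 then ?B else {}) i) \<le> outer ?A + outer ?B"
  proof (rule outer_UN_le)
    fix n :: nat
    have "(\<Sum>i<n. outer (if i = 0 then ?A else if i = 1 then ?B else {}))
      \<le> (\<Sum>i<n. (if i = 0 then outer ?A else 0) + (if i = 1 then outer ?B else 0))"
      using outer_open[of "{}"] content_empty nn by (intro sum_mono) auto
    also have "\<dots> \<le> outer ?A + outer ?B"
      using nn by (simp add: sum.distrib)
    finally show "(\<Sum>i<n. outer (if i = 0 then ?A else if i = 1 then ?B else {})) \<le> outer ?A + outer ?B" .
  qed (use E in auto)
  moreover have "(\<Union>i. (\<lambda>i::nat. if i = 0 then ?A else if i = 1 then ?B else {}) i) = E"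
    using E by (auto split: if_splits)
  ultimately have "outer E = outer ?A + outer ?B" using outer_split[OF assms E] by simp
  then show "ennreal (outer ?A) + ennreal (outer ?B) = ennreal (outer E)" using nn by simp
qed

section \<open>The measure and the integral representation\<close>

definition riesz_measure :: "'b measure" where
  "riesz_measure = measure_of (topspace X) {U. openin X U} (\<lambda>E. ennreal (outer E))"

lemma sets_riesz: "sets riesz_measure = sets (borel_on X)"
  unfolding riesz_measure_def borel_on_def by (simp add: sets_measure_of_conv)

lemma space_riesz: "space riesz_measure = topspace X"
  using sets_eq_imp_space_eq[OF sets_riesz] by simp

lemma emeasure_riesz:
  assumes "E \<in> sets (borel_on X)"
  shows "emeasure riesz_measure E = ennreal (outer E)"
proof -
  let ?S = "lambda_system (topspace X) (Pow (topspace X)) (\<lambda>E. ennreal (outer E))"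
  interpret sigma_algebra "topspace X" "Pow (topspace X)" by (rule sigma_algebra_Pow)
  have ms: "measure_space (topspace X) ?S (\<lambda>E. ennreal (outer E))"
    by (rule caratheodory_lemma[OF outer_measure_space_outer])
  then interpret S: sigma_algebra "topspace X" ?S by (simp add: measure_space_def)
  have sub: "sigma_sets (topspace X) {U. openin X U} \<subseteq> ?S"
    using open_in_lambda_system by (intro S.sigma_sets_subset) auto
  have "measure_space (topspace X) (sigma_sets (topspace X) {U. openin X U}) (\<lambda>E. ennreal (outer E))"
    by (rule measure_down[OF ms _ sub]) (auto intro!: sigma_algebra_sigma_sets dest: openin_subset)
  then show ?thesis
    unfolding riesz_measure_def using assms
    by (intro emeasure_measure_of[OF refl]) (auto simp: measure_space_def sets_borel_on sets_measure_of_conv dest: openin_subset)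
qed

text \<open>Inner regularity of E is outer regularity of its complement: what an open set around
  \<open>topspace X - E\<close> leaves over is closed, hence compact.\<close>

lemma radon_riesz: "radon_prob X riesz_measure"
  unfolding radon_prob_def
proof (intro conjI ballI)
  have ot: "outer (topspace X) = 1" using outer_open[of "topspace X"] content_topspace by simp
  show one': "emeasure riesz_measure (space riesz_measure) = 1"
    using emeasure_riesz[OF openin_sets_borel_on[of X "topspace X"]] by (simp add: space_riesz ot)
  then interpret prob_space riesz_measure by (rule prob_spaceI)
  show "sets riesz_measure = sets (borel_on X)" by (rule sets_riesz)
  fix E assume E: "E \<in> sets riesz_measure"
  have Es: "E \<subseteq> topspace X" using sets.sets_into_space[OF E] space_riesz by simp
  let ?K = "{K \<in> sets riesz_measure. K \<subseteq> E \<and> compactin X K}"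
  show "emeasure riesz_measure E = (SUP K\<in>?K. emeasure riesz_measure K)"
  proof (rule antisym)
    show "(SUP K\<in>?K. emeasure riesz_measure K) \<le> emeasure riesz_measure E"
      using E by (intro SUP_least emeasure_mono) auto
    show "emeasure riesz_measure E \<le> (SUP K\<in>?K. emeasure riesz_measure K)"
    proof (rule ennreal_le_epsilon)
      fix e :: real assume e: "e > 0"
      obtain U where U: "openin X U" "topspace X - E \<subseteq> U" "open_content U < outer (topspace X - E) + e"
        using outer_approx[of "topspace X - E" e] e by blast
      define K where "K = topspace X - U"
      have Kc: "closedin X K" using U(1) by (simp add: K_def closedin_diff)
      have K: "K \<in> ?K"
        using Kc U(2) compact closedin_compact_space closedin_sets_borel_on[OF Kc]
        by (auto simp: K_def sets_riesz)
      have Us: "U \<in> sets riesz_measure" using openin_sets_borel_on[OF U(1)] sets_riesz by simp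
      have m: "measure riesz_measure A = outer A" if "A \<in> sets riesz_measure" for A
      proof -
        have "A \<subseteq> topspace X" using sets.sets_into_space[OF that] space_riesz by simp
        then show ?thesis using emeasure_riesz[of A] that outer_nonneg[of A] by (simp add: measure_def sets_riesz)
      qed
      have "measure riesz_measure K = 1 - measure riesz_measure U"
        using prob_compl[OF Us] by (simp add: K_def space_riesz)
      moreover have "measure riesz_measure (topspace X - E) = 1 - measure riesz_measure E"
        using prob_compl[OF E] by (simp add: space_riesz)
      moreover have "topspace X - E \<in> sets riesz_measure" using sets.compl_sets[OF E] by (simp add: space_riesz)
      ultimately have "measure riesz_measure E \<le> measure riesz_measure K + e"
        using U(3) m[OF Us] m[of "topspace X - E"] outer_open[OF U(1)] by simp
      then have "emeasure riesz_measure E \<le> emeasure riesz_measure K + ennreal e"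
        using e by (simp add: emeasure_eq_measure ennreal_plus[symmetric] ennreal_leI del: ennreal_plus)
      also have "\<dots> \<le> (SUP K\<in>?K. emeasure riesz_measure K) + ennreal e"
        using K by (intro add_right_mono SUP_upper)
      finally show "emeasure riesz_measure E \<le> (SUP K\<in>?K. emeasure riesz_measure K) + ennreal e" .
    qed
  qed
qed

text \<open>Layer cake: n f is at most the sum of the \<open>fk k\<close>, each \<open>fk k\<close>
  lies below \<open>Uk k\<close>, and the indicators of the \<open>Uk k\<close> sum to at most n f +
  1. Dividing by n leaves an error of 1 / n.\<close>

lemma functional_le_integral:
  assumes f: "f \<in> cfun X" and b: "\<And>x. x \<in> topspace X \<Longrightarrow> 0 \<le> f x \<and> f x \<le> 1"
  shows "\<Lambda> f \<le> (\<integral>x. f x \<partial>riesz_measure)"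
proof (rule field_le_epsilon)
  interpret prob_space riesz_measure using radon_riesz by (rule radon_prob_prob_space)
  fix e :: real assume e: "e > 0"
  obtain n0 where "1 / e < real n0" using reals_Archimedean2 by blast
  define n where "n = Suc n0"
  have n: "n > 0" "1 / real n \<le> e"
    using \<open>1 / e < real n0\<close> e by (simp_all add: n_def field_simps)
  define fk where "fk k x = min (max (n * f x - real k) 0) 1" for k :: nat and x
  define Uk where "Uk k = {x \<in> topspace X. real k < n * f x}" for k :: nat
  have fkc: "fk k \<in> cfun X" for k
    using f unfolding fk_def by (auto intro!: continuous_map_real_max continuous_map_real_min continuous_intros)
  have Uo: "openin X (Uk k)" for k
  proof -
    have "continuous_map X euclideanreal (\<lambda>x. n * f x)" using f by (auto intro!: continuous_intros)
    from openin_continuous_map_preimage[OF this, of "{real k<..}"] show ?thesis by (simp add: Uk_def)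
  qed
  have Us: "Uk k \<in> sets riesz_measure" for k using openin_sets_borel_on[OF Uo] sets_riesz by simp
  have fkU: "fk k \<in> below (Uk k)" for k
    using fkc by (auto simp: below_def fk_def Uk_def)
  have mU: "measure riesz_measure (Uk k) = open_content (Uk k)" for k
    using emeasure_riesz[OF openin_sets_borel_on[OF Uo]] outer_open[OF Uo] content_nonneg
    by (simp add: measure_def)
  have "real n * \<Lambda> f = \<Lambda> (\<lambda>x. real n * f x)" using scale[OF f] by simp
  also have "\<dots> \<le> \<Lambda> (\<lambda>x. \<Sum>k<n. fk k x)"
  proof (rule mono)
    show "(\<lambda>x. real n * f x) \<in> cfun X" using f by (auto intro!: continuous_intros)
    show "(\<lambda>x. \<Sum>k<n. fk k x) \<in> cfun X" using fkc by (auto intro!: continuous_map_sum)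
    fix x assume "x \<in> topspace X"
    then have "0 \<le> n * f x" "n * f x \<le> n" using b[of x] by (auto simp: mult_left_le)
    then show "real n * f x \<le> (\<Sum>k<n. fk k x)" using sum_clamp[of "n * f x" n] by (simp add: fk_def)
  qed
  also have "\<dots> = (\<Sum>k<n. \<Lambda> (fk k))" using fkc by (intro sum)
  also have "\<dots> \<le> (\<Sum>k<n. measure riesz_measure (Uk k))"
    unfolding mU using content_upper[OF fkU] by (intro sum_mono)
  also have "\<dots> = (\<Sum>k<n. (\<integral>x. indicator (Uk k) x \<partial>riesz_measure))"
    using Us by (intro sum.cong) (auto simp: sets.sets_into_space Int_absorb1)
  also have "\<dots> = (\<integral>x. (\<Sum>k<n. indicator (Uk k) x) \<partial>riesz_measure)"
    using Us by (intro Bochner_Integration.integral_sum[symmetric]) (auto simp: emeasure_eq_measure)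
  also have "\<dots> \<le> (\<integral>x. real n * f x + 1 \<partial>riesz_measure)"
  proof (rule integral_mono)
    show "integrable riesz_measure (\<lambda>x. \<Sum>k<n. indicator (Uk k) x :: real)"
      using Us by (intro Bochner_Integration.integrable_sum) (auto simp: emeasure_eq_measure)
    show "integrable riesz_measure (\<lambda>x. real n * f x + 1)"
      using f by (intro radon_prob_integrable[OF compact radon_riesz]) (auto intro!: continuous_intros)
    fix x assume "x \<in> space riesz_measure"
    then have x: "0 \<le> n * f x" using b[of x] by (simp add: space_riesz)
    have "(\<Sum>k<n. indicator (Uk k) x :: real) \<le> (\<Sum>k<n. min (max ((n * f x + 1) - real k) 0) 1)"
      by (intro sum_mono) (auto simp: Uk_def indicator_def)
    also have "\<dots> \<le> n * f x + 1" using sum_clamp[of "n * f x + 1" n] x by simp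
    finally show "(\<Sum>k<n. indicator (Uk k) x :: real) \<le> real n * f x + 1" .
  qed
  also have "\<dots> = real n * (\<integral>x. f x \<partial>riesz_measure) + 1"
    using radon_prob_integrable[OF compact radon_riesz, of f] f prob_space by simp
  finally have "\<Lambda> f \<le> (\<integral>x. f x \<partial>riesz_measure) + 1 / real n"
    using n(1) by (simp add: field_simps)
  then show "\<Lambda> f \<le> (\<integral>x. f x \<partial>riesz_measure) + e" using n(2) by simp
qed

text \<open>The one-sided estimate for both g and 1 - g gives equality; an affine change brings an
  arbitrary f into the range from 0 to 1.\<close>

lemma functional_eq_integral:
  assumes f: "f \<in> cfun X"
  shows "\<Lambda> f = (\<integral>x. f x \<partial>riesz_measure)"
proof -
  interpret prob_space riesz_measure using radon_riesz by (rule radon_prob_prob_space)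
  note int = radon_prob_integrable[OF compact radon_riesz]
  obtain M where M: "M > 0" "\<And>x. x \<in> topspace X \<Longrightarrow> norm (f x) \<le> M"
    using compact_space_bounded[OF compact] f by blast
  define g where "g x = (f x + M) / (2 * M)" for x
  have gc: "g \<in> cfun X" using f M(1) unfolding g_def by (auto intro!: continuous_intros)
  have gb: "0 \<le> g x \<and> g x \<le> 1" if "x \<in> topspace X" for x
    using M(2)[OF that] M(1) by (simp add: g_def abs_le_iff divide_simps)
  have "\<Lambda> (\<lambda>x. 1 + (-1) * g x) \<le> (\<integral>x. 1 + (-1) * g x \<partial>riesz_measure)"
    using gc gb by (intro functional_le_integral) (auto intro!: continuous_intros)
  moreover have "\<Lambda> (\<lambda>x. 1 + (-1) * g x) = 1 - \<Lambda> g"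
    using add[of "\<lambda>_. 1" "\<lambda>x. (-1) * g x"] scale[OF gc, of "-1"] gc one by (simp add: continuous_map_minus)
  moreover have "(\<integral>x. 1 + (-1) * g x \<partial>riesz_measure) = 1 - (\<integral>x. g x \<partial>riesz_measure)"
    using int[of g] gc prob_space by simp
  ultimately have g: "\<Lambda> g = (\<integral>x. g x \<partial>riesz_measure)"
    using functional_le_integral[OF gc gb] by simp
  have fg: "f = (\<lambda>x. 2 * M * g x + (- M))" using M(1) by (auto simp: g_def fun_eq_iff)
  have "\<Lambda> f = 2 * M * \<Lambda> g - M"
    unfolding fg using add[of "\<lambda>x. 2 * M * g x" "\<lambda>_. - M"] scale[OF gc, of "2 * M"] const[of "- M"] gc
    by (simp add: continuous_map_real_mult)
  also have "\<dots> = (\<integral>x. f x \<partial>riesz_measure)"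
    unfolding fg using g int[of g] gc prob_space by simp
  finally show ?thesis .
qed

end

text \<open>Open sets are stable under intersection and generate, so they suffice. On an open U,
  inner regularity reduces to a compact K inside U, and a Urysohn function between the indicators of
  K and U compares the two measures.\<close>

theorem radon_prob_unique:
  assumes X: "compact_space X" "Hausdorff_space X" and m: "radon_prob X m" and m': "radon_prob X m'"
    and eq: "\<And>f. f \<in> cfun X \<Longrightarrow> (\<integral>x. f x \<partial>m) = (\<integral>x. f x \<partial>m')"
  shows "m = m'"
proof -
  have le: "emeasure m U \<le> emeasure m' U"
    if U: "openin X U" and m: "radon_prob X m" and m': "radon_prob X m'"
      and eq: "\<And>f. f \<in> cfun X \<Longrightarrow> (\<integral>x. f x \<partial>m) = (\<integral>x. f x \<partial>m')" for U m m'
  proof -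
    interpret m: prob_space m using m by (rule radon_prob_prob_space)
    interpret m': prob_space m' using m' by (rule radon_prob_prob_space)
    have Us: "U \<in> sets m" "U \<in> sets m'"
      using openin_sets_borel_on[OF U] radon_prob_sets[OF m] radon_prob_sets[OF m'] by auto
    have "emeasure m U = (SUP K\<in>{K \<in> sets m. K \<subseteq> U \<and> compactin X K}. emeasure m K)"
      using m Us(1) by (auto simp: radon_prob_def)
    also have "\<dots> \<le> emeasure m' U"
    proof (rule SUP_least)
      fix K assume K: "K \<in> {K \<in> sets m. K \<subseteq> U \<and> compactin X K}"
      then have "closedin X K" using X(2) compactin_imp_closedin by blast
      moreover have "closedin X (topspace X - U)" "(topspace X - U) \<inter> K = {}" using U K by auto
      ultimately obtain f where f: "continuous_map X euclideanreal f"
        "\<And>x. x \<in> topspace X \<Longrightarrow> 0 \<le> f x \<and> f x \<le> (1::real)"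
        "\<And>x. x \<in> topspace X - U \<Longrightarrow> f x = 0" "\<And>x. x \<in> K \<Longrightarrow> f x = 1"
        using compact_Hausdorff_Urysohn[OF X, of "topspace X - U" K] by blast
      have "measure m K = (\<integral>x. indicator K x \<partial>m)"
        using K by (simp add: Int_absorb1 sets.sets_into_space)
      also have "\<dots> \<le> (\<integral>x. f x \<partial>m)"
        using f K radon_prob_space[OF m] radon_prob_integrable[OF X(1) m f(1)]
        by (intro integral_mono) (auto simp: m.emeasure_eq_measure split: split_indicator)
      also have "\<dots> = (\<integral>x. f x \<partial>m')" using eq f(1) by simp
      also have "\<dots> \<le> (\<integral>x. indicator U x \<partial>m')"
        using f Us radon_prob_space[OF m'] radon_prob_integrable[OF X(1) m' f(1)]
        by (intro integral_mono) (auto simp: m'.emeasure_eq_measure split: split_indicator)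
      also have "\<dots> = measure m' U" using Us by (simp add: Int_absorb1 sets.sets_into_space)
      finally show "emeasure m K \<le> emeasure m' U"
        by (simp add: m.emeasure_eq_measure m'.emeasure_eq_measure ennreal_leI)
    qed
    finally show ?thesis .
  qed
  interpret m: prob_space m using m by (rule radon_prob_prob_space)
  show ?thesis
  proof (rule measure_eqI_generator_eq[where E="{U. openin X U}" and \<Omega>="topspace X" and A="\<lambda>_. topspace X"])
    show "Int_stable {U. openin X U}" by (auto simp: Int_stable_def)
    show "{U. openin X U} \<subseteq> Pow (topspace X)" by (auto dest: openin_subset)
    show "emeasure m U = emeasure m' U" if "U \<in> {U. openin X U}" for U
      using le[OF _ m m' eq] le[OF _ m' m eq[symmetric]] that by (auto intro: antisym)
    show "sets m = sigma_sets (topspace X) {U. openin X U}" "sets m' = sigma_sets (topspace X) {U. openin X U}"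
      using radon_prob_sets[OF m] radon_prob_sets[OF m'] sets_borel_on by auto
  qed (auto simp: m.emeasure_eq_measure)
qed

text \<open>Images of compact sets are compact, and closed because Y is Hausdorff, hence measurable.
  So compact sets exhausting the preimage of E produce compact subsets of E of at least the same
  measure.\<close>

lemma radon_prob_distr:
  assumes m: "radon_prob X m" and h: "continuous_map X Y h" and Y: "Hausdorff_space Y"
  shows "radon_prob Y (distr m (borel_on Y) h)"
proof -
  have hm: "h \<in> measurable m (borel_on Y)"
    using continuous_map_borel_on[OF h] measurable_cong_sets[OF radon_prob_sets[OF m] refl] by blast
  have sp: "space m = topspace X" using radon_prob_space[OF m] .
  interpret prob_space m using m by (rule radon_prob_prob_space)
  interpret d: prob_space "distr m (borel_on Y) h" by (rule prob_space_distr[OF hm])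
  show ?thesis unfolding radon_prob_def
  proof (intro conjI ballI)
    show "emeasure (distr m (borel_on Y) h) (space (distr m (borel_on Y) h)) = 1" by (rule d.emeasure_space_1)
    fix E assume "E \<in> sets (distr m (borel_on Y) h)"
    then have E: "E \<in> sets (borel_on Y)" by simp
    let ?K = "{K \<in> sets (distr m (borel_on Y) h). K \<subseteq> E \<and> compactin Y K}"
    show "emeasure (distr m (borel_on Y) h) E = (SUP K\<in>?K. emeasure (distr m (borel_on Y) h) K)"
    proof (rule antisym)
      show "(SUP K\<in>?K. emeasure (distr m (borel_on Y) h) K) \<le> emeasure (distr m (borel_on Y) h) E"
        using E by (intro SUP_least emeasure_mono) auto
      have pre: "h -` E \<inter> space m \<in> sets m" using measurable_sets[OF hm E] .
      have "emeasure (distr m (borel_on Y) h) E = emeasure m (h -` E \<inter> space m)"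
        using emeasure_distr[OF hm E] .
      also have "\<dots> = (SUP K\<in>{K \<in> sets m. K \<subseteq> h -` E \<inter> space m \<and> compactin X K}. emeasure m K)"
        using m pre unfolding radon_prob_def by blast
      also have "\<dots> \<le> (SUP K\<in>?K. emeasure (distr m (borel_on Y) h) K)"
      proof (rule SUP_least)
        fix K assume K: "K \<in> {K \<in> sets m. K \<subseteq> h -` E \<inter> space m \<and> compactin X K}"
        have cK: "compactin Y (h ` K)" using K h image_compactin by blast
        then have hK: "h ` K \<in> sets (borel_on Y)"
          using Y compactin_imp_closedin closedin_sets_borel_on by blast
        have "emeasure m K \<le> emeasure m (h -` (h ` K) \<inter> space m)"
          using K measurable_sets[OF hm hK] by (intro emeasure_mono) auto
        also have "\<dots> = emeasure (distr m (borel_on Y) h) (h ` K)"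
          using emeasure_distr[OF hm hK] by simp
        also have "\<dots> \<le> (SUP K\<in>?K. emeasure (distr m (borel_on Y) h) K)"
          using K cK hK by (intro SUP_upper) auto
        finally show "emeasure m K \<le> (SUP K\<in>?K. emeasure (distr m (borel_on Y) h) K)" .
      qed
      finally show "emeasure (distr m (borel_on Y) h) E \<le> (SUP K\<in>?K. emeasure (distr m (borel_on Y) h) K)" .
    qed
  qed simp
qed

text \<open>M. Riesz extension of a positive functional from a space of continuous functions, given as
  the image of \<open>T\<close>, combined with the representation theorem.\<close>

theorem radon_prob_extension:
  fixes T :: "'v::real_vector \<Rightarrow> 'b \<Rightarrow> real" and l :: "'v \<Rightarrow> real"
  assumes X: "compact_space X" "Hausdorff_space X" and S: "subspace S"
    and Tc: "\<And>g. g \<in> S \<Longrightarrow> T g \<in> cfun X"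
    and Tadd: "\<And>g h x. g \<in> S \<Longrightarrow> h \<in> S \<Longrightarrow> x \<in> topspace X \<Longrightarrow> T (g + h) x = T g x + T h x"
    and Tscale: "\<And>g r x. g \<in> S \<Longrightarrow> x \<in> topspace X \<Longrightarrow> T (r *\<^sub>R g) x = r * T g x"
    and l: "rlinear_on S l"
    and e: "e \<in> S" "\<And>x. x \<in> topspace X \<Longrightarrow> T e x = 1" "l e = 1"
    and pos: "\<And>g. g \<in> S \<Longrightarrow> (\<And>x. x \<in> topspace X \<Longrightarrow> 0 \<le> T g x) \<Longrightarrow> 0 \<le> l g"
  obtains m where "radon_prob X m" "\<And>g. g \<in> S \<Longrightarrow> (\<integral>x. T g x \<partial>m) = l g"
proof -
  have ladd: "l (g + h) = l g + l h" and lscale: "l (r *\<^sub>R g) = r * l g" if "g \<in> S" "h \<in> S" for g h r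
    using l that by (auto simp: rlinear_on_def)
  have E: "subspace (cfun X)"
    unfolding subspace_def zero_fun_def plus_fun_def scaleR_fun_def
    by (simp add: continuous_map_add continuous_map_real_mult_left)
  \<comment> \<open>The values of l on the majorants of h; their infimum is the sublinear bound for
    Hahn-Banach. As T need not be injective, l lives on S; that T g determines l g follows from
    \<open>pos\<close> and is contained in \<open>\<Lambda>eq\<close>.\<close>
  define A where "A h = {l g | g. g \<in> S \<and> (\<forall>x\<in>topspace X. h x \<le> T g x)}" for h
  have re: "r *\<^sub>R e \<in> S" for r using subspace_scale[OF S e(1)] .
  have Tre: "T (r *\<^sub>R e) x = r" if "x \<in> topspace X" for r x using Tscale[OF e(1) that] e(2)[OF that] by simp
  have lre: "l (r *\<^sub>R e) = r" for r using lscale[OF e(1) e(1)] e(3) by simp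
  have bd: "\<exists>M. \<forall>x\<in>topspace X. \<bar>h x\<bar> \<le> M" if "h \<in> cfun X" for h
    using compact_space_bounded[OF X(1), of h] that by (metis mem_Collect_eq real_norm_def)
  have lb: "- M \<le> a" if "a \<in> A h" "\<forall>x\<in>topspace X. \<bar>h x\<bar> \<le> M" for h M a
  proof -
    obtain g where g: "g \<in> S" "\<forall>x\<in>topspace X. h x \<le> T g x" "a = l g" using \<open>a \<in> A h\<close> by (auto simp: A_def)
    have "0 \<le> l (g + M *\<^sub>R e)"
    proof (rule pos)
      show "g + M *\<^sub>R e \<in> S" using g(1) re subspace_add[OF S] by blast
      fix x assume x: "x \<in> topspace X"
      have "- M \<le> T g x" using g(2) that(2) x by (smt (verit, best))
      then show "0 \<le> T (g + M *\<^sub>R e) x" using Tadd[OF g(1) re x] Tre[OF x] by simp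
    qed
    then show ?thesis using ladd[OF g(1) re] lre g(3) by simp
  qed
  have "sublinear_on (cfun X) (\<lambda>h. Inf (A h))"
  proof (rule sublinear_on_Inf[OF E])
    fix h assume h: "h \<in> cfun X"
    obtain M where M: "\<forall>x\<in>topspace X. \<bar>h x\<bar> \<le> M" using bd[OF h] by blast
    then have "\<forall>x\<in>topspace X. h x \<le> T (M *\<^sub>R e) x" using Tre by (auto simp: abs_le_iff)
    then have "l (M *\<^sub>R e) \<in> A h" using re unfolding A_def by blast
    then show "A h \<noteq> {}" by blast
    show "bdd_below (A h)" using lb M by (auto simp: bdd_below_def)
  next
    fix h k a b assume "a \<in> A h" "b \<in> A k"
    then obtain g g' where g: "g \<in> S" "\<forall>x\<in>topspace X. h x \<le> T g x" "a = l g"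
      "g' \<in> S" "\<forall>x\<in>topspace X. k x \<le> T g' x" "b = l g'" by (auto simp: A_def)
    have "l (g + g') \<in> A (h + k)"
      using g subspace_add[OF S g(1,4)] by (auto simp: A_def plus_fun_def Tadd intro!: exI[of _ "g + g'"] add_mono)
    then show "\<exists>c\<in>A (h + k). c \<le> a + b" using ladd g by force
  next
    fix h r a assume r: "(r::real) > 0" "a \<in> A h"
    then obtain g where g: "g \<in> S" "\<forall>x\<in>topspace X. h x \<le> T g x" "a = l g" by (auto simp: A_def)
    have "l (r *\<^sub>R g) \<in> A (r *\<^sub>R h)"
      using g r subspace_scale[OF S g(1)] by (auto simp: A_def scaleR_fun_def Tscale intro!: exI[of _ "r *\<^sub>R g"])
    then show "\<exists>c\<in>A (r *\<^sub>R h). c \<le> r * a" using lscale g by force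
  next
    have "0 \<le> a" if "a \<in> A 0" for a using lb[OF that, of 0] by (simp add: zero_fun_def)
    moreover have "0 \<in> A 0"
      using re[of 0] Tre[of _ 0] lre[of 0] by (auto simp: A_def zero_fun_def intro!: exI[of _ "0 *\<^sub>R e"])
    ultimately show "Inf (A 0) = 0" by (intro cInf_eq_minimum) auto
  qed
  then obtain \<Lambda> where \<Lambda>: "rlinear_on (cfun X) \<Lambda>" "\<And>h. h \<in> cfun X \<Longrightarrow> \<Lambda> h \<le> Inf (A h)"
    using sublinear_dominates_linear[OF E] by blast
  have \<Lambda>le: "\<Lambda> h \<le> l g" if "h \<in> cfun X" "g \<in> S" "\<And>x. x \<in> topspace X \<Longrightarrow> h x \<le> T g x" for h g
  proof -
    have "l g \<in> A h" using that by (auto simp: A_def)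
    moreover have "\<exists>M. \<forall>x\<in>topspace X. \<bar>h x\<bar> \<le> M" using bd[OF that(1)] .
    then obtain M where M: "\<forall>x\<in>topspace X. \<bar>h x\<bar> \<le> M" by blast
    have "bdd_below (A h)" using lb M by (auto simp: bdd_below_def)
    ultimately have "Inf (A h) \<le> l g" by (intro cInf_lower)
    then show ?thesis using \<Lambda>(2)[OF that(1)] by simp
  qed
  have \<Lambda>scale: "\<Lambda> (\<lambda>x. r * f x) = r * \<Lambda> f" if "f \<in> cfun X" for r f
    using \<Lambda>(1) that by (auto simp: rlinear_on_def scaleR_fun_def)
  have \<Lambda>eq: "\<Lambda> h = l g" if h: "h \<in> cfun X" and g: "g \<in> S" and eq: "\<And>x. x \<in> topspace X \<Longrightarrow> h x = T g x" for h g
  proof -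
    have "\<Lambda> (\<lambda>x. (-1) * h x) \<le> l ((-1) *\<^sub>R g)"
      using h eq subspace_scale[OF S g, of "-1"] Tscale[OF g, of _ "-1"]
      by (intro \<Lambda>le) (auto simp: continuous_map_minus)
    then show ?thesis using \<Lambda>le[OF h g] eq \<Lambda>scale[OF h, of "-1"] lscale[OF g g, of "-1"] by force
  qed
  interpret positive_functional X \<Lambda>
  proof
    show "\<Lambda> (\<lambda>x. f x + g x) = \<Lambda> f + \<Lambda> g" if "f \<in> cfun X" "g \<in> cfun X" for f g
      using \<Lambda>(1) that by (auto simp: rlinear_on_def plus_fun_def)
    show "0 \<le> \<Lambda> f" if f: "f \<in> cfun X" "\<And>x. x \<in> topspace X \<Longrightarrow> 0 \<le> f x" for f
    proof -
      have "\<Lambda> (\<lambda>x. (-1) * f x) \<le> l (0 *\<^sub>R e)"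
        using f re[of 0] Tre[of _ 0] by (intro \<Lambda>le) (auto simp: continuous_map_minus)
      then show ?thesis using \<Lambda>scale[OF f(1), of "-1"] lre[of 0] by simp
    qed
    show "\<Lambda> (\<lambda>_. 1) = 1" using \<Lambda>eq[OF _ e(1)] e by simp
  qed (use X \<Lambda>scale in auto)
  show ?thesis
  proof (rule that[OF radon_riesz])
    fix g assume "g \<in> S"
    then show "(\<integral>x. T g x \<partial>riesz_measure) = l g"
      using functional_eq_integral[OF Tc] \<Lambda>eq[OF Tc] by simp
  qed
qed

section \<open>The spaces of states, characters and quasi-states\<close>

lemma open_evaluation_vimage: "open U \<Longrightarrow> open {h. h a \<in> U}"
  using open_vimage[OF _ continuous_on_product_coordinates, of U a] by (simp add: vimage_def)

text \<open>First of three instances making function types Hausdorff; Stone-Weierstrass is later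
  applied to sets of characters, which are sets of functions.\<close>

instance "fun" :: (type, t0_space) t0_space
proof
  fix f g :: "'a \<Rightarrow> 'b" assume "f \<noteq> g"
  then obtain a where ne: "f a \<noteq> g a" by blast
  obtain U where "open U" "\<not> (f a \<in> U \<longleftrightarrow> g a \<in> U)" using t0_space_class.t0_space[OF ne] by blast
  then show "\<exists>U. open U \<and> \<not> (f \<in> U \<longleftrightarrow> g \<in> U)"
    by (intro exI[of _ "{h. h a \<in> U}"]) (simp add: open_evaluation_vimage)
qed

instance "fun" :: (type, t1_space) t1_space
proof
  fix f g :: "'a \<Rightarrow> 'b" assume "f \<noteq> g"
  then obtain a where ne: "f a \<noteq> g a" by blast
  then obtain U where "open U" "f a \<in> U" "g a \<notin> U" using t1_space_class.t1_space[OF ne] by blast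
  then show "\<exists>U. open U \<and> f \<in> U \<and> g \<notin> U"
    by (intro exI[of _ "{h. h a \<in> U}"]) (simp add: open_evaluation_vimage)
qed

instance "fun" :: (type, t2_space) t2_space
proof
  fix f g :: "'a \<Rightarrow> 'b" assume "f \<noteq> g"
  then obtain a where ne: "f a \<noteq> g a" by blast
  then obtain U V where "open U" "open V" "f a \<in> U" "g a \<in> V" "U \<inter> V = {}"
    using hausdorff[OF ne] by blast
  then show "\<exists>U V. open U \<and> open V \<and> f \<in> U \<and> g \<in> V \<and> U \<inter> V = {}"
    by (intro exI[of _ "{h. h a \<in> U}"] exI[of _ "{h. h a \<in> V}"]) (auto simp: open_evaluation_vimage)
qed

lemma topspace_initial_topology [simp]: "topspace (initial_topology S I f T) = S"
  by (auto simp: initial_topology_def)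

lemma continuous_map_initial_topology:
  assumes "\<And>i. i \<in> I \<Longrightarrow> continuous_map Z (T i) (\<lambda>x. f i (g x))" and "g ` topspace Z \<subseteq> S"
  shows "continuous_map Z (initial_topology S I f T) g"
  unfolding initial_topology_def
proof (rule continuous_on_generated_topo)
  show "g ` topspace Z \<subseteq> \<Union> (insert S {{x \<in> S. f i x \<in> U} |i U. i \<in> I \<and> openin (T i) U})"
    using assms(2) by blast
  fix U assume "U \<in> insert S {{x \<in> S. f i x \<in> U} |i U. i \<in> I \<and> openin (T i) U}"
  then consider "U = S" | i V where "i \<in> I" "openin (T i) V" "U = {x \<in> S. f i x \<in> V}" by blast
  then show "openin Z (g -` U \<inter> topspace Z)"
  proof cases
    case 1
    then have "g -` U \<inter> topspace Z = topspace Z" using assms(2) by blast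
    then show ?thesis by simp
  next
    case 2
    then have "g -` U \<inter> topspace Z = {x \<in> topspace Z. f i (g x) \<in> V}" using assms(2) by blast
    then show ?thesis using assms(1)[OF 2(1)] 2(2) by (simp add: continuous_map_def)
  qed
qed

lemma continuous_map_initial_topology_proj:
  assumes "i \<in> I" "f i ` S \<subseteq> topspace (T i)"
  shows "continuous_map (initial_topology S I f T) (T i) (f i)"
  unfolding continuous_map_def
proof (intro conjI allI impI)
  show "f i \<in> topspace (initial_topology S I f T) \<rightarrow> topspace (T i)" using assms(2) by auto
  fix U assume "openin (T i) U"
  then show "openin (initial_topology S I f T) {x \<in> topspace (initial_topology S I f T). f i x \<in> U}"
    unfolding topspace_initial_topology unfolding initial_topology_def
    using assms(1) by (intro topology_generated_by_Basis) blast
qed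

lemma continuous_map_fun_iff:
  fixes g :: "'z \<Rightarrow> 'a \<Rightarrow> 'b::topological_space"
  shows "continuous_map Z euclidean g \<longleftrightarrow> (\<forall>a. continuous_map Z euclidean (\<lambda>x. g x a))"
  unfolding euclidean_product_topology[symmetric] continuous_map_componentwise_UNIV ..

text \<open>The identity is continuous in both directions. Once a space is a subspace of the
  function type, compactness becomes a matter of closedness and pointwise bounds.\<close>

lemma initial_topology_eq_top_of_set:
  fixes S :: "('a \<Rightarrow> 'b::topological_space) set"
  assumes "\<And>i. i \<in> I \<Longrightarrow> continuous_map (top_of_set S) (T i) (f i)"
    and "\<And>a. continuous_map (initial_topology S I f T) euclidean (\<lambda>x. x a)"
  shows "initial_topology S I f T = top_of_set S"
proof -
  have 1: "continuous_map (top_of_set S) (initial_topology S I f T) (\<lambda>x. x)"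
    using assms(1) by (intro continuous_map_initial_topology) auto
  have 2: "continuous_map (initial_topology S I f T) (top_of_set S) (\<lambda>x. x)"
    using assms(2) by (simp add: continuous_map_in_subtopology continuous_map_fun_iff)
  show ?thesis unfolding topology_eq
  proof (intro allI iffI)
    fix U
    {
      assume U: "openin (initial_topology S I f T) U"
      then have "U \<subseteq> S" using openin_subset by fastforce
      then show "openin (top_of_set S) U"
        using openin_continuous_map_preimage[OF 1 U] by (simp add: Collect_conj_eq Int_absorb1)
    }
    {
      assume U: "openin (top_of_set S) U"
      then have "U \<subseteq> S" using openin_subset by fastforce
      then show "openin (initial_topology S I f T) U"
        using openin_continuous_map_preimage[OF 2 U] by (simp add: Collect_conj_eq Int_absorb1)
    }
  qed
qed

text \<open>Evaluations outside B are constant on S, so including them among the defining maps does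
  not refine the topology.\<close>

lemma initial_topology_evaluations:
  fixes S :: "('a \<Rightarrow> complex) set"
  assumes "\<And>\<mu> a. \<mu> \<in> S \<Longrightarrow> a \<notin> B \<Longrightarrow> \<mu> a = 0"
  shows "initial_topology S B (\<lambda>a \<mu>. \<mu> a) (\<lambda>_. euclidean) = top_of_set S"
proof (rule initial_topology_eq_top_of_set)
  show "continuous_map (top_of_set S) euclidean (\<lambda>\<mu>. \<mu> a)" for a
    by (simp add: continuous_on_product_coordinates continuous_on_subset[OF _ subset_UNIV])
  fix a
  show "continuous_map (initial_topology S B (\<lambda>a \<mu>. \<mu> a) (\<lambda>_. euclidean)) euclidean (\<lambda>x. x a)"
  proof (cases "a \<in> B")
    case True
    then show ?thesis
      using continuous_map_initial_topology_proj[of a B "\<lambda>a \<mu>. \<mu> a" S "\<lambda>_. euclidean"] by simp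
  next
    case False
    have "continuous_map (initial_topology S B (\<lambda>a \<mu>. \<mu> a) (\<lambda>_. euclidean)) euclidean (\<lambda>x. 0::complex)"
      by simp
    then show ?thesis by (rule continuous_map_eq) (use assms False in simp)
  qed
qed

lemma state_space_eq: "state_space B = top_of_set (states B)"
  unfolding state_space_def by (rule initial_topology_evaluations) (auto simp: states_def)

lemma spectrum_eq: "spectrum B = top_of_set (characters B)"
  unfolding spectrum_def by (rule initial_topology_evaluations) (auto simp: characters_def)

lemma Hausdorff_space_top_of_set: "Hausdorff_space (top_of_set (S :: ('a \<Rightarrow> complex) set))"
  unfolding euclidean_product_topology[symmetric]
  by (intro Hausdorff_space_subtopology) (simp add: Hausdorff_space_product_topology)

lemma closed_Collect_Ball:
  assumes "\<And>a. a \<in> A \<Longrightarrow> closed {x. P a x}"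
  shows "closed {x. \<forall>a\<in>A. P a x}"
proof -
  have "{x. \<forall>a\<in>A. P a x} = (\<Inter>a\<in>A. {x. P a x})" by blast
  then show ?thesis using assms by auto
qed

lemma continuous_on_evaluation [continuous_intros]: "continuous_on S (\<lambda>\<mu>. \<mu> a)"
  by (rule continuous_on_subset[OF continuous_on_product_coordinates subset_UNIV])

lemma closed_clinear_on: "closed {\<mu>. clinear_on B \<mu>}"
  unfolding clinear_on_def
  by (intro closed_Collect_conj closed_Collect_Ball closed_Collect_all closed_Collect_eq continuous_intros)

lemma closed_evaluation_nonneg: "closed {\<mu>::'a \<Rightarrow> complex. \<mu> a \<in> \<real>\<^sub>\<ge>\<^sub>0}"
  using closed_vimage[OF closed_nonneg_Reals_complex continuous_on_evaluation[of UNIV a]]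
  by (simp add: vimage_def)

lemma closed_evaluation_zero: "closed {\<mu>::'a \<Rightarrow> complex. \<forall>a. a \<notin> B \<longrightarrow> \<mu> a = 0}"
proof -
  have "closed {\<mu>::'a \<Rightarrow> complex. \<forall>a\<in>- B. \<mu> a = 0}"
    by (intro closed_Collect_Ball closed_Collect_eq continuous_intros)
  then show ?thesis by (simp add: Ball_def)
qed

text \<open>Tychonoff: S is a closed subset of a product of closed discs.\<close>

lemma compact_bounded_functions:
  fixes S :: "('a \<Rightarrow> complex) set"
  assumes "closed S" "\<And>\<mu> a. \<mu> \<in> S \<Longrightarrow> cmod (\<mu> a) \<le> b a"
  shows "compact S"
proof -
  have "compactin (product_topology (\<lambda>_. euclidean) UNIV) (PiE UNIV (\<lambda>a. cball (0::complex) (b a)))"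
    by (subst compactin_PiE) auto
  then have "compact (PiE UNIV (\<lambda>a. cball (0::complex) (b a)))"
    by (simp add: euclidean_product_topology)
  moreover have "S \<subseteq> PiE UNIV (\<lambda>a. cball 0 (b a))" using assms(2) by auto
  ultimately show ?thesis using assms(1) compact_Int_closed by (metis inf.absorb_iff2)
qed

lemma closed_states: "closed (states B)"
  unfolding states_def
  by (intro closed_Collect_conj closed_clinear_on closed_evaluation_zero closed_Collect_Ball
      closed_evaluation_nonneg closed_Collect_eq continuous_intros)

lemma closed_characters: "closed (characters B)"
  unfolding characters_def
  by (intro closed_Collect_conj closed_clinear_on closed_evaluation_zero closed_Collect_Ball
      closed_Collect_eq continuous_intros)

lemma closed_quasi_states: "closed quasi_states"
  unfolding quasi_states_def
  by (intro closed_Collect_conj closed_clinear_on closed_Collect_Ball closed_Collect_all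
      closed_evaluation_nonneg closed_Collect_eq continuous_intros)

section \<open>Bounds, compactness and restriction of functionals\<close>

context comm_subalg
begin

lemma state_pos:
  assumes "\<mu> \<in> states B" "x \<in> pos" shows "\<mu> x \<in> \<real>\<^sub>\<ge>\<^sub>0"
proof -
  obtain b where "b \<in> sa" "x = b * b" using assms(2) by (auto simp: pos_def)
  then have "x = star b * b" "b \<in> B" by (simp_all add: sa_star sa_mem)
  then show ?thesis using assms(1) by (simp add: states_def)
qed

lemma clinear_diff:
  assumes "clinear_on B \<mu>" "a \<in> B" "b \<in> B"
  shows "\<mu> (a - b) = \<mu> a - \<mu> b"
proof -
  have "\<mu> (a + (-1) *\<^sub>C b) = \<mu> a + (-1) * \<mu> b"
    using assms scaleC_mem by (simp add: clinear_on_def)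
  then show ?thesis by (simp add: scaleC_minus_left)
qed

lemma clinear_scaleR:
  assumes "clinear_on B \<mu>" "a \<in> B"
  shows "\<mu> (r *\<^sub>R a) = r * \<mu> a"
  using assms by (simp add: clinear_on_def scaleR_scaleC)

text \<open>Both claims come from applying the state to \<open>norm x\<close> times the unit plus or
  minus x, which are positive elements.\<close>

lemma state_sa:
  assumes \<mu>: "\<mu> \<in> states B" and x: "x \<in> sa"
  shows "\<mu> x \<in> \<real>" "cmod (\<mu> x) \<le> norm x"
proof -
  have lin: "clinear_on B \<mu>" and 1: "\<mu> 1 = 1" using \<mu> by (simp_all add: states_def)
  have xB: "x \<in> B" "norm x *\<^sub>R 1 \<in> B" using x by (simp_all add: sa_mem scaleR_mem one_mem)
  have "\<mu> (norm x *\<^sub>R 1 - x) = norm x - \<mu> x" "\<mu> (norm x *\<^sub>R 1 + x) = norm x + \<mu> x"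
    using clinear_diff[OF lin xB(2,1)] clinear_scaleR[OF lin one_mem] 1 lin xB
    by (simp_all add: clinear_on_def)
  then have "norm x - \<mu> x \<in> \<real>\<^sub>\<ge>\<^sub>0" "norm x + \<mu> x \<in> \<real>\<^sub>\<ge>\<^sub>0"
    using state_pos[OF \<mu> norm_minus_pos[OF x order_refl]] state_pos[OF \<mu> norm_plus_pos[OF x order_refl]]
    by simp_all
  then have *: "Im (\<mu> x) = 0" "\<bar>Re (\<mu> x)\<bar> \<le> norm x"
    by (auto simp: complex_nonneg_Reals_iff)
  then show "\<mu> x \<in> \<real>" by (simp add: complex_is_Real_iff)
  then show "cmod (\<mu> x) \<le> norm x" using * by (simp add: cmod_eq_Re)
qed

lemma clinear_parts:
  assumes "clinear_on B \<mu>" "a \<in> B"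
  shows "\<mu> a = \<mu> (re_part a) + \<i> * \<mu> (im_part a)"
proof -
  have "\<mu> (re_part a + \<i> *\<^sub>C im_part a) = \<mu> (re_part a) + \<i> * \<mu> (im_part a)"
    using assms re_part_sa[OF assms(2)] im_part_sa[OF assms(2)]
    by (simp add: clinear_on_def sa_mem scaleC_mem)
  then show ?thesis by (simp add: re_im_parts[symmetric])
qed

lemma compact_states: "compact (states B)"
proof (rule compact_bounded_functions[OF closed_states])
  fix \<mu> a assume \<mu>: "\<mu> \<in> states B"
  show "cmod (\<mu> a) \<le> 2 * norm a"
  proof (cases "a \<in> B")
    case True
    have "cmod (\<mu> a) \<le> cmod (\<mu> (re_part a)) + cmod (\<mu> (im_part a))"
      using clinear_parts[of \<mu> a] \<mu> True norm_triangle_ineq[of "\<mu> (re_part a)" "\<i> * \<mu> (im_part a)"]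
      by (simp add: states_def norm_mult)
    also have "\<dots> \<le> norm a + norm a"
      using state_sa(2)[OF \<mu> re_part_sa[OF True]] state_sa(2)[OF \<mu> im_part_sa[OF True]]
        norm_re_part_le[of a] norm_im_part_le[of a] by linarith
    finally show ?thesis by simp
  qed (use \<mu> in \<open>simp add: states_def\<close>)
qed

lemma compact_characters: "compact (characters B)"
proof (rule compact_bounded_functions[OF closed_characters])
  fix \<omega> a assume \<omega>: "\<omega> \<in> characters B"
  show "cmod (\<omega> a) \<le> norm a"
    using character_norm_le[OF \<omega>] \<omega> by (cases "a \<in> B") (auto simp: characters_def)
qed

lemma compact_spectrum: "compact_space (spectrum B)" and Hausdorff_spectrum: "Hausdorff_space (spectrum B)"
  by (simp_all add: spectrum_eq compact_space_subtopology compact_characters Hausdorff_space_top_of_set)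

lemma topspace_spectrum: "topspace (spectrum B) = characters B"
  by (simp add: spectrum_eq)

end

lemma restrict_quasi_state:
  assumes "\<mu> \<in> quasi_states" "B \<in> comm_subalgs"
  shows "restrict_to B \<mu> \<in> states B"
proof -
  interpret comm_subalg B by unfold_locales fact
  show ?thesis using assms add_mem scaleC_mem mult_mem star_mem one_mem
    by (auto simp: quasi_states_def states_def restrict_to_def clinear_on_def)
qed

lemma restrict_state:
  assumes "\<mu> \<in> states C" "B \<in> comm_subalgs" "B \<subseteq> C"
  shows "restrict_to B \<mu> \<in> states B"
proof -
  interpret comm_subalg B by unfold_locales fact
  have m: "a \<in> B \<Longrightarrow> a \<in> C" for a using assms(3) by blast
  show ?thesis using assms(1) add_mem scaleC_mem mult_mem star_mem one_mem m
    by (auto simp: states_def restrict_to_def clinear_on_def)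
qed

lemma quasi_state_parts:
  assumes "\<mu> \<in> quasi_states"
  shows "\<mu> a = \<mu> (re_part a) + \<i> * \<mu> (im_part a)"
  using assms re_im_parts[of a] re_part_self_adjoint[of a] im_part_self_adjoint[of a]
  unfolding quasi_states_def by (metis (mono_tags, lifting) mem_Collect_eq)

lemma self_adjoint_mem_comm_subalgs:
  assumes "h \<in> self_adjoint" obtains B where "B \<in> comm_subalgs" "h \<in> B"
  using self_adjoint_in_comm_subalg[OF assms] comm_subalg.mem by blast

lemma quasi_state_self_adjoint_le:
  assumes "\<mu> \<in> quasi_states" "h \<in> self_adjoint"
  shows "cmod (\<mu> h) \<le> norm h"
proof -
  obtain B where B: "B \<in> comm_subalgs" "h \<in> B" using self_adjoint_mem_comm_subalgs[OF assms(2)] .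
  interpret comm_subalg B by unfold_locales fact
  show ?thesis using state_sa(2)[OF restrict_quasi_state[OF assms(1) B(1)], of h] assms(2) B(2)
    by (simp add: restrict_to_def sa_def)
qed

lemma compact_quasi_states: "compact quasi_states"
proof (rule compact_bounded_functions[OF closed_quasi_states])
  fix \<mu> :: "'a \<Rightarrow> complex" and a assume \<mu>: "\<mu> \<in> quasi_states"
  have "cmod (\<mu> a) \<le> cmod (\<mu> (re_part a)) + cmod (\<mu> (im_part a))"
    using quasi_state_parts[OF \<mu>, of a] norm_triangle_ineq[of "\<mu> (re_part a)" "\<i> * \<mu> (im_part a)"]
    by (simp add: norm_mult)
  also have "\<dots> \<le> norm a + norm a"
    using quasi_state_self_adjoint_le[OF \<mu>] norm_re_part_le[of a] norm_im_part_le[of a]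
    by (meson add_mono im_part_self_adjoint order_trans re_part_self_adjoint)
  finally show "cmod (\<mu> a) \<le> 2 * norm a" by simp
qed

lemma continuous_restrict_to:
  assumes "restrict_to B ` S \<subseteq> T"
  shows "continuous_map (top_of_set S) (top_of_set T) (restrict_to B :: ('a \<Rightarrow> complex) \<Rightarrow> _)"
proof -
  have "continuous_map (top_of_set S) euclidean (\<lambda>\<mu>. restrict_to B \<mu> a)" for a
    by (cases "a \<in> B") (simp_all add: restrict_to_def continuous_intros)
  then have "continuous_map (top_of_set S) euclidean (restrict_to B :: ('a \<Rightarrow> complex) \<Rightarrow> _)"
    by (subst continuous_map_fun_iff) blast
  then show ?thesis using assms by (auto simp: continuous_map_in_subtopology)
qed

text \<open>Evaluation at a self-adjoint element factors through restriction to a subalgebra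
  containing it; an arbitrary evaluation is assembled from two such ones by the quasi-state
  identity.\<close>

lemma quasi_state_space_eq: "quasi_state_space = top_of_set quasi_states"
  unfolding quasi_state_space_def
proof (rule initial_topology_eq_top_of_set)
  fix B :: "'a set" assume "B \<in> comm_subalgs"
  then show "continuous_map (top_of_set quasi_states) (state_space B) (restrict_to B)"
    unfolding state_space_eq by (intro continuous_restrict_to) (auto intro: restrict_quasi_state)
next
  fix a :: 'a
  let ?T = "initial_topology quasi_states comm_subalgs restrict_to state_space"
  have sa: "continuous_map ?T euclidean (\<lambda>\<mu>. \<mu> h)" if h: "h \<in> self_adjoint" for h
  proof -
    obtain B where B: "B \<in> comm_subalgs" "h \<in> B" using self_adjoint_mem_comm_subalgs[OF h] .
    have "continuous_map ?T (state_space B) (restrict_to B)"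
      using B(1) by (intro continuous_map_initial_topology_proj) (auto simp: state_space_eq intro: restrict_quasi_state)
    moreover have "continuous_map (state_space B) euclidean (\<lambda>\<mu>. \<mu> h)"
      by (simp add: state_space_eq continuous_intros)
    ultimately have "continuous_map ?T euclidean ((\<lambda>\<mu>. \<mu> h) \<circ> restrict_to B)"
      by (rule continuous_map_compose)
    then show ?thesis using B(2) by (simp add: o_def restrict_to_def)
  qed
  have "continuous_map ?T euclidean (\<lambda>\<mu>. \<mu> (re_part a) + \<i> * \<mu> (im_part a))"
    using sa[OF re_part_self_adjoint] sa[OF im_part_self_adjoint]
    by (auto simp: continuous_map_atin intro!: tendsto_add tendsto_mult_left)
  then show "continuous_map ?T euclidean (\<lambda>\<mu>. \<mu> a)"
    by (rule continuous_map_eq) (use quasi_state_parts[of _ a] in \<open>simp add: eq_commute\<close>)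
qed

section \<open>Convex structure\<close>

lemma continuous_map_convex_combination:
  fixes S :: "('a \<Rightarrow> complex) set"
  assumes "convex S" "t \<in> {0..1}"
  shows "continuous_map (prod_topology (top_of_set S) (top_of_set S)) (top_of_set S)
    (\<lambda>(x, y). t *\<^sub>R x + (1 - t) *\<^sub>R y)"
proof -
  have "continuous_on (S \<times> S) (\<lambda>z. fst z a)" "continuous_on (S \<times> S) (\<lambda>z. snd z a)" for a
    by (rule continuous_on_compose2[OF continuous_on_evaluation[of UNIV]];
        auto intro: continuous_on_fst continuous_on_snd continuous_on_id)+
  then have "continuous_on (S \<times> S) (\<lambda>z. (t *\<^sub>R fst z + (1 - t) *\<^sub>R snd z) a)" for a
    unfolding plus_fun_def scaleR_fun_def by (intro continuous_intros)
  then have "continuous_map (prod_topology (top_of_set S) (top_of_set S)) euclidean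
      (\<lambda>z. (t *\<^sub>R fst z + (1 - t) *\<^sub>R snd z) a)" for a
    by simp
  then have "continuous_map (prod_topology (top_of_set S) (top_of_set S)) euclidean
      (\<lambda>z. t *\<^sub>R fst z + (1 - t) *\<^sub>R snd z)"
    by (subst continuous_map_fun_iff) blast
  moreover have "t *\<^sub>R x + (1 - t) *\<^sub>R y \<in> S" if "x \<in> S" "y \<in> S" for x y
    using assms that by (intro convexD) auto
  ultimately show ?thesis by (auto simp: continuous_map_in_subtopology case_prod_unfold)
qed

lemma convex_states:
  assumes "B \<in> comm_subalgs" shows "convex (states B)"
proof -
  interpret comm_subalg B by unfold_locales fact
  show ?thesis
    unfolding convex_def states_def clinear_on_def plus_fun_def scaleR_fun_def
    by (auto simp: scaleR_conv_of_real algebra_simps of_real_add[symmetric] simp del: of_real_add)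
qed

lemma convex_quasi_states: "convex quasi_states"
  unfolding convex_def quasi_states_def clinear_on_def plus_fun_def scaleR_fun_def
  by (auto simp: scaleR_conv_of_real algebra_simps of_real_add[symmetric] simp del: of_real_add)

lemma cchpd_obj_top_of_set:
  fixes S :: "('a \<Rightarrow> complex) set"
  assumes "convex S" "compact S" "pseudo_dist_on S d"
  shows "cchpd_obj (top_of_set S, d)"
  using assms continuous_map_convex_combination[OF assms(1)]
  by (simp add: compact_space_subtopology Hausdorff_space_top_of_set)

lemma restrict_to_affine:
  "restrict_to B (t *\<^sub>R \<mu> + s *\<^sub>R \<nu>) = t *\<^sub>R restrict_to B \<mu> + s *\<^sub>R restrict_to B \<nu>"
  by (auto simp: restrict_to_def plus_fun_def scaleR_fun_def fun_eq_iff)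

section \<open>Projective limits of state spaces\<close>

text \<open>Two members of a compatible family agree at a common element because both restrict to
  the intersection; this makes the gluing well defined.\<close>

lemma comm_subalgs_Int:
  assumes "B \<in> comm_subalgs" "C \<in> comm_subalgs"
  shows "B \<inter> C \<in> comm_subalgs"
  using assms unfolding comm_subalgs_def by (simp add: closed_Int)

lemma restrict_to_state: "\<mu> \<in> states B \<Longrightarrow> restrict_to B \<mu> = \<mu>"
  by (auto simp: restrict_to_def states_def fun_eq_iff)

lemma restrict_to_restrict_to: "B \<subseteq> C \<Longrightarrow> restrict_to B (restrict_to C \<mu>) = restrict_to B \<mu>"
  by (auto simp: restrict_to_def fun_eq_iff)

lemma pseudo_dist_on_SUP:
  assumes "\<And>i. i \<in> I \<Longrightarrow> pseudo_dist_on (f i ` K) (d i)"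
  shows "pseudo_dist_on K (\<lambda>x y. SUP i\<in>I. d i (f i x) (f i y))"
  unfolding pseudo_dist_on_def
proof (intro conjI ballI)
  fix x y z assume K: "x \<in> K" "y \<in> K" "z \<in> K"
  have "d i (f i x) (f i z) \<le> (SUP i\<in>I. d i (f i x) (f i y)) + (SUP i\<in>I. d i (f i y) (f i z))"
    if "i \<in> I" for i
  proof -
    have "d i (f i x) (f i z) \<le> d i (f i x) (f i y) + d i (f i y) (f i z)"
      using assms[OF that] K by (simp add: pseudo_dist_on_def)
    also have "\<dots> \<le> (SUP i\<in>I. d i (f i x) (f i y)) + (SUP i\<in>I. d i (f i y) (f i z))"
      using that by (intro add_mono SUP_upper)
    finally show ?thesis .
  qed
  then show "(SUP i\<in>I. d i (f i x) (f i z)) \<le> (SUP i\<in>I. d i (f i x) (f i y)) + (SUP i\<in>I. d i (f i y) (f i z))"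
    by (rule SUP_least)
next
  fix x assume "x \<in> K"
  then have "(SUP i\<in>I. d i (f i x) (f i x)) \<le> 0"
    using assms by (intro SUP_least) (simp add: pseudo_dist_on_def)
  then show "(SUP i\<in>I. d i (f i x) (f i x)) = 0" by simp
next
  fix x y assume "x \<in> K" "y \<in> K"
  then show "(SUP i\<in>I. d i (f i x) (f i y)) = (SUP i\<in>I. d i (f i y) (f i x))"
    using assms by (intro SUP_cong) (simp_all add: pseudo_dist_on_def)
qed

text \<open>Common ground of the two pseudo-distances. \<open>contraction\<close> makes the
  restriction maps morphisms, and \<open>D_eq\<close> makes D the least pseudo-distance on
  quasi-states for which all projections are contractions, so that mediating maps contract as
  well.\<close>

locale state_diagram =
  fixes d :: "'a::cstar_algebra set \<Rightarrow> ('a \<Rightarrow> complex) \<Rightarrow> ('a \<Rightarrow> complex) \<Rightarrow> ennreal"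
    and D :: "('a \<Rightarrow> complex) \<Rightarrow> ('a \<Rightarrow> complex) \<Rightarrow> ennreal"
  assumes pseudo_dist: "\<And>B. B \<in> comm_subalgs \<Longrightarrow> pseudo_dist_on (states B) (d B)"
    and contraction: "\<And>B C \<mu> \<nu>. B \<in> comm_subalgs \<Longrightarrow> C \<in> comm_subalgs \<Longrightarrow> B \<subseteq> C \<Longrightarrow>
      \<mu> \<in> states C \<Longrightarrow> \<nu> \<in> states C \<Longrightarrow> d B (restrict_to B \<mu>) (restrict_to B \<nu>) \<le> d C \<mu> \<nu>"
    and D_eq: "\<And>\<mu> \<nu>. \<mu> \<in> quasi_states \<Longrightarrow> \<nu> \<in> quasi_states \<Longrightarrow>
      D \<mu> \<nu> = (SUP B\<in>comm_subalgs. d B (restrict_to B \<mu>) (restrict_to B \<nu>))"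
begin

lemma diagram: "cchpd_diagram comm_subalgs (\<subseteq>) (\<lambda>B. (state_space B, d B)) (\<lambda>C B. restrict_to B)"
  unfolding cchpd_diagram_def
proof (intro conjI ballI impI)
  fix B :: "'a set" assume B: "B \<in> comm_subalgs"
  interpret comm_subalg B by unfold_locales fact
  show "cchpd_obj (state_space B, d B)"
    unfolding state_space_eq
    by (intro cchpd_obj_top_of_set convex_states compact_states pseudo_dist B)
  fix C :: "'a set" assume C: "C \<in> comm_subalgs" "B \<subseteq> C"
  have "continuous_map (top_of_set (states C)) (top_of_set (states B)) (restrict_to B)"
    by (rule continuous_restrict_to) (use B C restrict_state in blast)
  then show "cchpd_hom (state_space C, d C) (state_space B, d B) (restrict_to B)"
    unfolding cchpd_hom.simps state_space_eq
    using B C by (auto simp: restrict_to_affine contraction)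
next
  fix B :: "'a set" and x assume "B \<in> comm_subalgs" "x \<in> carr (state_space B, d B)"
  then show "restrict_to B x = x" by (simp add: state_space_eq restrict_to_state)
next
  fix B C D :: "'a set" and x
  assume "B \<subseteq> C" "C \<subseteq> D"
  then show "restrict_to B (restrict_to C x) = restrict_to B x" by (simp add: restrict_to_restrict_to)
qed

lemma cone: "cchpd_cone comm_subalgs (\<subseteq>) (\<lambda>B. (state_space B, d B)) (\<lambda>C B. restrict_to B)
    (quasi_state_space, D) restrict_to"
  unfolding cchpd_cone_def
proof (intro conjI ballI impI)
  have "restrict_to B ` quasi_states \<subseteq> states B" if "B \<in> comm_subalgs" for B :: "'a set"
    using that by (auto intro: restrict_quasi_state)
  then have "pseudo_dist_on (restrict_to B ` quasi_states) (d B)" if "B \<in> comm_subalgs" for B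
    using pseudo_dist[OF that] that unfolding pseudo_dist_on_def by (meson subset_iff)
  then have "pseudo_dist_on quasi_states
      (\<lambda>\<mu> \<nu>. SUP B\<in>comm_subalgs. d B (restrict_to B \<mu>) (restrict_to B \<nu>))"
    by (rule pseudo_dist_on_SUP)
  then have "pseudo_dist_on quasi_states D" by (simp add: pseudo_dist_on_def D_eq)
  then show "cchpd_obj (quasi_state_space, D)"
    unfolding quasi_state_space_eq
    by (intro cchpd_obj_top_of_set convex_quasi_states compact_quasi_states)
  fix B :: "'a set" assume B: "B \<in> comm_subalgs"
  have "d B (restrict_to B \<mu>) (restrict_to B \<nu>) \<le> D \<mu> \<nu>"
    if "\<mu> \<in> quasi_states" "\<nu> \<in> quasi_states" for \<mu> \<nu>
    unfolding D_eq[OF that] using B by (rule SUP_upper)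
  moreover have "continuous_map (top_of_set quasi_states) (top_of_set (states B)) (restrict_to B)"
    by (rule continuous_restrict_to) (use B restrict_quasi_state in blast)
  ultimately show "cchpd_hom (quasi_state_space, D) (state_space B, d B) (restrict_to B)"
    unfolding cchpd_hom.simps state_space_eq quasi_state_space_eq
    using B by (auto simp: restrict_to_affine)
qed (simp add: restrict_to_restrict_to)

lemma universal:
  fixes Y :: "'c::real_vector cchpd"
  assumes "cchpd_cone comm_subalgs (\<subseteq>) (\<lambda>B. (state_space B, d B)) (\<lambda>C B. restrict_to B) Y r"
  obtains h where "cchpd_hom Y (quasi_state_space, D) h"
    "\<And>B y. B \<in> comm_subalgs \<Longrightarrow> y \<in> carr Y \<Longrightarrow> restrict_to B (h y) = r B y"
proof -
  obtain T e where Y: "Y = (T, e)" by (cases Y)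
  have hom: "cchpd_hom (T, e) (state_space B, d B) (r B)" if "B \<in> comm_subalgs" for B
    using assms that by (simp add: cchpd_cone_def Y)
  have rcont: "continuous_map T (top_of_set (states B)) (r B)" if "B \<in> comm_subalgs" for B
    using hom[OF that] by (simp add: state_space_eq)
  have raff: "r B (t *\<^sub>R x + (1 - t) *\<^sub>R y) = t *\<^sub>R r B x + (1 - t) *\<^sub>R r B y"
    if "B \<in> comm_subalgs" "x \<in> topspace T" "y \<in> topspace T" "t \<in> {0..1}" for B x y t
    using hom[OF that(1)] that by simp
  have rd: "d B (r B x) (r B y) \<le> e x y"
    if "B \<in> comm_subalgs" "x \<in> topspace T" "y \<in> topspace T" for B x y
    using hom[OF that(1)] that by simp
  have rst: "r B y \<in> states B" if "B \<in> comm_subalgs" "y \<in> topspace T" for B y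
    using continuous_map_funspace[OF rcont[OF that(1)]] that(2) by auto
  have rcomp: "restrict_to B (r C y) = r B y"
    if "B \<in> comm_subalgs" "C \<in> comm_subalgs" "B \<subseteq> C" "y \<in> topspace T" for B C y
    using assms that by (simp add: cchpd_cone_def Y)
  \<comment> \<open>An arbitrary subalgebra through x. That the value does not depend on this choice
    is shown by comparison on B \<inter> K x.\<close>
  define K where "K x = (SOME B. B \<in> comm_subalgs \<and> x \<in> B)" for x :: 'a
  have K: "K x \<in> comm_subalgs" "x \<in> K x" if "x \<in> self_adjoint" for x
  proof -
    have "\<exists>B. B \<in> comm_subalgs \<and> x \<in> B" using self_adjoint_mem_comm_subalgs[OF that] by blast
    then have "K x \<in> comm_subalgs \<and> x \<in> K x" unfolding K_def by (rule someI_ex)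
    then show "K x \<in> comm_subalgs" "x \<in> K x" by auto
  qed
  define val where "val y x = r (K x) y x" for y x
  have val: "r B y x = val y x"
    if "B \<in> comm_subalgs" "x \<in> B" "x \<in> self_adjoint" "y \<in> topspace T" for B x y
  proof -
    let ?C = "B \<inter> K x"
    have C: "?C \<in> comm_subalgs" "x \<in> ?C" using comm_subalgs_Int K that by auto
    have "restrict_to ?C (r B y) x = restrict_to ?C (r (K x) y) x"
      using rcomp[OF C(1) that(1) _ that(4)] rcomp[OF C(1) K(1)[OF that(3)] _ that(4)] by simp
    then show ?thesis using C(2) by (simp add: restrict_to_def val_def)
  qed
  \<comment> \<open>Only self-adjoint elements are certain to lie in a commutative subalgebra, so
    values are glued there; the quasi-state identity for a + i b then forces this formula.\<close>
  define h where "h y = (\<lambda>a. val y (re_part a) + \<i> * val y (im_part a))" for y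
  have hB: "h y a = r B y a" if "B \<in> comm_subalgs" "a \<in> B" "y \<in> topspace T" for B y a
  proof -
    interpret comm_subalg B by unfold_locales fact
    have "r B y a = r B y (re_part a) + \<i> * r B y (im_part a)"
      using rst[OF that(1,3)] that(2) by (intro clinear_parts) (simp add: states_def)
    then show ?thesis
      using val[OF that(1) sa_mem[OF re_part_sa] re_part_self_adjoint]
        val[OF that(1) sa_mem[OF im_part_sa] im_part_self_adjoint] that by (simp add: h_def)
  qed
  have hsa: "h y x = val y x" if "x \<in> self_adjoint" "y \<in> topspace T" for x y
    using hB[OF K(1)[OF that(1)] K(2)[OF that(1)] that(2)] by (simp add: val_def)
  have hres: "restrict_to B (h y) = r B y" if "B \<in> comm_subalgs" "y \<in> topspace T" for B y
    using hB[OF that(1) _ that(2)] rst[OF that] by (auto simp: restrict_to_def states_def fun_eq_iff)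
  have hqs: "h y \<in> quasi_states" if y: "y \<in> topspace T" for y
    unfolding quasi_states_def
  proof (intro CollectI conjI ballI allI)
    fix B :: "'a set" assume B: "B \<in> comm_subalgs"
    interpret comm_subalg B by unfold_locales fact
    have "clinear_on B (r B y)" using rst[OF B y] by (simp add: states_def)
    then show "clinear_on B (h y)"
      by (simp add: clinear_on_def hB[OF B _ y] add_mem scaleC_mem)
  next
    fix a b :: 'a assume "a \<in> self_adjoint" "b \<in> self_adjoint"
    then show "h y (a + \<i> *\<^sub>C b) = h y a + \<i> * h y b"
      using hsa y by (simp add: h_def re_im_parts_unique)
  next
    fix a :: 'a
    have "star a * a \<in> self_adjoint" by (simp add: self_adjoint_def star_mult star_star)
    then obtain B where B: "B \<in> comm_subalgs" "star a * a \<in> B"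
      by (rule self_adjoint_mem_comm_subalgs)
    interpret comm_subalg B by unfold_locales fact
    \<comment> \<open>Since a itself need not lie in B, positivity in the definition of a state does
      not apply to a directly; a square root of \<open>star a * a\<close> inside B takes its
      place.\<close>
    have "star a * a \<in> pos" using star_mult_self_pos[OF comm_subalg_axioms B(2)] .
    then have "r B y (star a * a) \<in> \<real>\<^sub>\<ge>\<^sub>0" by (rule state_pos[OF rst[OF B(1) y]])
    then show "h y (star a * a) \<in> \<real>\<^sub>\<ge>\<^sub>0" using hB[OF B y] by simp
  next
    have 1: "(1::'a) \<in> self_adjoint" by (simp add: self_adjoint_def)
    show "h y 1 = 1" using hB[OF K(1)[OF 1] K(2)[OF 1] y] rst[OF K(1)[OF 1] y] by (simp add: states_def)
  qed
  have "continuous_map T euclidean (\<lambda>y. val y x)" if "x \<in> self_adjoint" for x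
  proof -
    have "continuous_map T euclidean (r (K x))"
      using rcont[OF K(1)[OF that]] by (simp add: continuous_map_in_subtopology)
    then show ?thesis unfolding val_def by (simp add: continuous_map_fun_iff)
  qed
  then have "continuous_map T euclidean (\<lambda>y. h y a)" for a
    using re_part_self_adjoint[of a] im_part_self_adjoint[of a] unfolding h_def continuous_map_atin
    by (auto intro!: tendsto_add tendsto_mult_left)
  then have "continuous_map T euclidean h" by (subst continuous_map_fun_iff) blast
  then have "continuous_map T (top_of_set quasi_states) h"
    using hqs by (auto simp: continuous_map_in_subtopology)
  moreover have "h (t *\<^sub>R x + (1 - t) *\<^sub>R y) = t *\<^sub>R h x + (1 - t) *\<^sub>R h y"
    if "x \<in> topspace T" "y \<in> topspace T" "t \<in> {0..1}" for x y t
  proof -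
    have v: "val (t *\<^sub>R x + (1 - t) *\<^sub>R y) z = t *\<^sub>R val x z + (1 - t) *\<^sub>R val y z"
      if "z \<in> self_adjoint" for z
      unfolding val_def raff[OF K(1)[OF that] \<open>x \<in> topspace T\<close> \<open>y \<in> topspace T\<close> \<open>t \<in> {0..1}\<close>]
      by (simp add: plus_fun_def scaleR_fun_def)
    show ?thesis
      unfolding h_def v[OF re_part_self_adjoint] v[OF im_part_self_adjoint]
      by (simp add: plus_fun_def scaleR_fun_def fun_eq_iff scaleR_conv_of_real) (simp add: algebra_simps)
  qed
  moreover have "D (h x) (h y) \<le> e x y" if "x \<in> topspace T" "y \<in> topspace T" for x y
    unfolding D_eq[OF hqs[OF that(1)] hqs[OF that(2)]]
    using hres that rd by (intro SUP_least) simp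
  ultimately have "cchpd_hom Y (quasi_state_space, D) h"
    unfolding Y cchpd_hom.simps quasi_state_space_eq by blast
  then show ?thesis using that hres Y by simp
qed

lemma quasi_states_eqI:
  assumes "\<mu> \<in> quasi_states" "\<nu> \<in> quasi_states"
    and "\<And>B. B \<in> comm_subalgs \<Longrightarrow> restrict_to B \<mu> = restrict_to B \<nu>"
  shows "\<mu> = \<nu>"
proof
  have sa: "\<mu> x = \<nu> x" if x: "x \<in> self_adjoint" for x
  proof -
    obtain B where B: "B \<in> comm_subalgs" "x \<in> B" using self_adjoint_mem_comm_subalgs[OF x] .
    then show ?thesis using fun_cong[OF assms(3)[OF B(1)], of x] by (simp add: restrict_to_def)
  qed
  fix a show "\<mu> a = \<nu> a"
    using quasi_state_parts[OF assms(1), of a] quasi_state_parts[OF assms(2), of a] sa by simp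
qed

lemma limit: "cchpd_limit TYPE('c::real_vector) comm_subalgs (\<subseteq>) (\<lambda>B. (state_space B, d B))
    (\<lambda>C B. restrict_to B) (quasi_state_space, D) restrict_to"
  unfolding cchpd_limit_def
proof (intro conjI allI impI cone)
  fix Y :: "'c cchpd" and r
  assume "cchpd_cone comm_subalgs (\<subseteq>) (\<lambda>B. (state_space B, d B)) (\<lambda>C B. restrict_to B) Y r"
  then obtain h where h: "cchpd_hom Y (quasi_state_space, D) h"
    "\<And>B y. B \<in> comm_subalgs \<Longrightarrow> y \<in> carr Y \<Longrightarrow> restrict_to B (h y) = r B y"
    using universal by blast
  have mem: "k y \<in> quasi_states" if "cchpd_hom Y (quasi_state_space, D) k" "y \<in> carr Y" for k y
  proof -
    obtain T e where Y: "Y = (T, e)" by (cases Y)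
    then have "continuous_map T (top_of_set quasi_states) k"
      using that(1) by (simp add: quasi_state_space_eq)
    then show ?thesis using continuous_map_funspace[of T "top_of_set quasi_states" k] that(2) Y by auto
  qed
  show "\<exists>h. cchpd_hom Y (quasi_state_space, D) h \<and>
      (\<forall>i\<in>comm_subalgs. \<forall>y\<in>carr Y. restrict_to i (h y) = r i y) \<and>
      (\<forall>h'. cchpd_hom Y (quasi_state_space, D) h' \<and>
        (\<forall>i\<in>comm_subalgs. \<forall>y\<in>carr Y. restrict_to i (h' y) = r i y) \<longrightarrow> (\<forall>y\<in>carr Y. h' y = h y))"
  proof (intro exI[of _ h] conjI allI impI ballI)
    fix h' y
    assume h': "cchpd_hom Y (quasi_state_space, D) h' \<and> (\<forall>i\<in>comm_subalgs. \<forall>y\<in>carr Y. restrict_to i (h' y) = r i y)"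
      and y: "y \<in> carr Y"
    show "h' y = h y"
    proof (rule quasi_states_eqI)
      show "h' y \<in> quasi_states" "h y \<in> quasi_states" using mem h(1) h' y by blast+
      show "restrict_to B (h' y) = restrict_to B (h y)" if "B \<in> comm_subalgs" for B
        using h(2)[OF that y] h' that y by metis
    qed
  qed (use h in simp_all)
qed

end

section \<open>The pseudo-distance of an L-seminorm\<close>

lemma dist_L_pseudo_dist: "pseudo_dist_on K (dist_L L B)"
proof -
  have "pseudo_dist_on K' (\<lambda>a b :: complex. ennreal (cmod (a - b)))" for K'
    unfolding pseudo_dist_on_def
    by (auto simp: norm_minus_commute ennreal_plus[symmetric] simp del: ennreal_plus
        intro!: ennreal_leI norm_diff_triangle_le[OF order_refl order_refl])
  then show ?thesis unfolding dist_L_def by (intro pseudo_dist_on_SUP)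
qed

lemma dist_L_contraction:
  "B \<subseteq> C \<Longrightarrow> dist_L L B (restrict_to B \<mu>) (restrict_to B \<nu>) \<le> dist_L L C \<mu> \<nu>"
  unfolding dist_L_def by (intro SUP_mono) (auto simp: restrict_to_def)

text \<open>Every test element f is self-adjoint and so lies in some commutative subalgebra; the
  supremum over f can be taken subalgebra by subalgebra.\<close>

lemma dist_L_UNIV:
  "dist_L L UNIV \<mu> \<nu> = (SUP B\<in>comm_subalgs. dist_L L B (restrict_to B \<mu>) (restrict_to B \<nu>))"
proof (rule antisym)
  show "(SUP B\<in>comm_subalgs. dist_L L B (restrict_to B \<mu>) (restrict_to B \<nu>)) \<le> dist_L L UNIV \<mu> \<nu>"
    by (intro SUP_least dist_L_contraction) simp
  show "dist_L L UNIV \<mu> \<nu> \<le> (SUP B\<in>comm_subalgs. dist_L L B (restrict_to B \<mu>) (restrict_to B \<nu>))"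
    unfolding dist_L_def[of L UNIV]
  proof (rule SUP_least)
    fix f assume f: "f \<in> {f \<in> UNIV \<inter> self_adjoint. L f \<le> 1}"
    then obtain B where B: "B \<in> comm_subalgs" "f \<in> B"
      using self_adjoint_mem_comm_subalgs[of f] by blast
    have "ennreal (cmod (\<mu> f - \<nu> f)) \<le> dist_L L B (restrict_to B \<mu>) (restrict_to B \<nu>)"
      unfolding dist_L_def using f B(2) by (intro SUP_upper2[of f]) (auto simp: restrict_to_def)
    also have "\<dots> \<le> (SUP B\<in>comm_subalgs. dist_L L B (restrict_to B \<mu>) (restrict_to B \<nu>))"
      using B(1) by (rule SUP_upper)
    finally show "ennreal (cmod (\<mu> f - \<nu> f)) \<le>
      (SUP B\<in>comm_subalgs. dist_L L B (restrict_to B \<mu>) (restrict_to B \<nu>))" .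
  qed
qed

lemma state_diagram_dist_L: "state_diagram (dist_L L) (dist_L L UNIV)"
  by unfold_locales (simp_all add: dist_L_pseudo_dist dist_L_contraction dist_L_UNIV)

section \<open>States as Radon measures on the spectrum\<close>

lemma representsD:
  assumes "represents B m \<mu>"
  shows "radon_prob (spectrum B) m" "a \<in> B \<Longrightarrow> (\<integral>\<omega>. \<omega> a \<partial>m) = \<mu> a"
  using assms by (simp_all add: represents_def)

context comm_subalg
begin

lemma continuous_map_spectrum_evaluation:
  "continuous_map (spectrum B) euclidean (\<lambda>\<omega>. \<omega> a)"
  "continuous_map (spectrum B) euclideanreal (\<lambda>\<omega>. Re (\<omega> a))"
  by (simp_all add: spectrum_eq continuous_intros)

lemma subspace_sa: "subspace sa"
  by (simp add: subspace_def sa_intros)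

lemma character_parts:
  assumes "\<omega> \<in> characters B" "a \<in> B"
  shows "\<omega> a = Re (\<omega> (re_part a)) + \<i> * Re (\<omega> (im_part a))"
  using clinear_parts[of \<omega> a] character_real[OF assms(1) re_part_sa[OF assms(2)]]
    character_real[OF assms(1) im_part_sa[OF assms(2)]] assms
  by (simp add: characters_def complex_eq_iff)

text \<open>The extension theorem for the functions \<omega> \<mapsto> Re (\<omega> g) with g in
  \<open>sa\<close>. Its positivity hypothesis is where the existence of characters enters:
  nonnegativity at all characters puts g + e into \<open>pos\<close> for every e > 0. Complex values
  are recovered from the two parts.\<close>

lemma represents_exists:
  assumes \<mu>: "\<mu> \<in> states B"
  obtains m where "represents B m \<mu>"
proof -
  have lin: "clinear_on B \<mu>" and 1: "\<mu> 1 = 1" using \<mu> by (simp_all add: states_def)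
  have chlin: "clinear_on B \<omega>" "\<omega> 1 = 1" if "\<omega> \<in> characters B" for \<omega>
    using that by (simp_all add: characters_def)
  obtain m where m: "radon_prob (spectrum B) m" "\<And>g. g \<in> sa \<Longrightarrow> (\<integral>\<omega>. Re (\<omega> g) \<partial>m) = Re (\<mu> g)"
  proof (rule radon_prob_extension[OF compact_spectrum Hausdorff_spectrum subspace_sa,
        where T="\<lambda>g \<omega>. Re (\<omega> g)" and l="\<lambda>g. Re (\<mu> g)" and e=1])
    show "(\<lambda>\<omega>. Re (\<omega> g)) \<in> cfun (spectrum B)" for g
      using continuous_map_spectrum_evaluation(2) by simp
    show "Re (\<omega> (g + h)) = Re (\<omega> g) + Re (\<omega> h)"
      if "g \<in> sa" "h \<in> sa" "\<omega> \<in> topspace (spectrum B)" for g h \<omega>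
    proof -
      have "\<omega> (g + h) = \<omega> g + \<omega> h"
        using chlin(1)[of \<omega>] that by (simp add: topspace_spectrum clinear_on_def sa_mem)
      then show ?thesis by simp
    qed
    show "Re (\<omega> (r *\<^sub>R g)) = r * Re (\<omega> g)"
      if "g \<in> sa" "\<omega> \<in> topspace (spectrum B)" for g r \<omega>
      using clinear_scaleR[OF chlin(1)[of \<omega>] sa_mem[OF that(1)], of r] that by (simp add: topspace_spectrum)
    show "rlinear_on sa (\<lambda>g. Re (\<mu> g))"
      using lin clinear_scaleR[OF lin sa_mem] by (simp add: rlinear_on_def clinear_on_def sa_mem)
    show "0 \<le> Re (\<mu> g)" if g: "g \<in> sa" "\<And>\<omega>. \<omega> \<in> topspace (spectrum B) \<Longrightarrow> 0 \<le> Re (\<omega> g)" for g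
    proof (rule field_le_epsilon)
      fix e :: real assume "e > 0"
      then have "g + e *\<^sub>R 1 \<in> pos" using g by (intro pos_of_characters_nonneg) (simp_all add: topspace_spectrum)
      then have "\<mu> (g + e *\<^sub>R 1) \<in> \<real>\<^sub>\<ge>\<^sub>0" by (rule state_pos[OF \<mu>])
      moreover have "\<mu> (g + e *\<^sub>R 1) = \<mu> g + e"
        using lin clinear_scaleR[OF lin one_mem] 1 g(1) by (simp add: clinear_on_def sa_mem scaleR_mem one_mem)
      ultimately show "0 \<le> Re (\<mu> g) + e" by (simp add: complex_nonneg_Reals_iff)
    qed
    show "Re (\<omega> 1) = 1" if "\<omega> \<in> topspace (spectrum B)" for \<omega>
      using chlin(2)[of \<omega>] that by (simp add: topspace_spectrum)
  qed (use 1 in \<open>simp_all add: sa_one\<close>)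
  have sp: "space m = characters B" using radon_prob_space[OF m(1)] topspace_spectrum by simp
  have "\<mu> a = (\<integral>\<omega>. \<omega> a \<partial>m)" if a: "a \<in> B" for a
  proof -
    have re: "re_part a \<in> sa" and im: "im_part a \<in> sa" using a re_part_sa im_part_sa by auto
    have int: "integrable m (\<lambda>\<omega>. Re (\<omega> b))" for b
      using radon_prob_integrable[OF compact_spectrum m(1) continuous_map_spectrum_evaluation(2)] .
    have "(\<integral>\<omega>. \<omega> a \<partial>m) = (\<integral>\<omega>. complex_of_real (Re (\<omega> (re_part a))) + \<i> * complex_of_real (Re (\<omega> (im_part a))) \<partial>m)"
      using character_parts a sp by (intro Bochner_Integration.integral_cong) auto
    also have "\<dots> = complex_of_real (\<integral>\<omega>. Re (\<omega> (re_part a)) \<partial>m) + \<i> * complex_of_real (\<integral>\<omega>. Re (\<omega> (im_part a)) \<partial>m)"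
      using int[of "re_part a"] int[of "im_part a"] by simp
    also have "\<dots> = Re (\<mu> (re_part a)) + \<i> * Re (\<mu> (im_part a))"
      using m(2) re im by simp
    also have "\<dots> = \<mu> a"
      using clinear_parts[OF lin a] state_sa(1)[OF \<mu> re] state_sa(1)[OF \<mu> im]
      by (simp add: of_real_Re)
    finally show ?thesis by simp
  qed
  then have "represents B m \<mu>" using m(1) by (simp add: represents_def)
  then show ?thesis by (rule that)
qed

text \<open>Stone-Weierstrass for the functions \<omega> \<mapsto> Re (\<omega> a) with a in
  \<open>sa\<close>. They are closed under products because characters are real there, and distinct
  characters differ at the real or imaginary part of some element of B.\<close>

lemma characters_dense:
  assumes f: "f \<in> cfun (spectrum B)" and e: "e > 0"
  obtains a where "a \<in> B" "\<And>\<omega>. \<omega> \<in> characters B \<Longrightarrow> \<bar>f \<omega> - Re (\<omega> a)\<bar> < e"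
proof -
  define P where "P g \<longleftrightarrow> continuous_on (characters B) g \<and> (\<exists>a\<in>sa. \<forall>\<omega>\<in>characters B. g \<omega> = Re (\<omega> a))" for g
  have "\<exists>g. P g \<and> (\<forall>\<omega>\<in>characters B. \<bar>f \<omega> - g \<omega>\<bar> < e)"
  proof (rule Stone_Weierstrass_HOL[OF compact_characters])
    show "P (\<lambda>\<omega>. c)" for c
    proof -
      have "c = Re (\<omega> (c *\<^sub>R 1))" if "\<omega> \<in> characters B" for \<omega>
        using clinear_scaleR[of \<omega> 1 c] that one_mem by (simp add: characters_def)
      then show ?thesis unfolding P_def
        by (intro conjI continuous_intros bexI[of _ "c *\<^sub>R 1"] ballI sa_intros)
    qed
    show "continuous_on (characters B) g" if "P g" for g using that by (simp add: P_def)
    fix g h assume "P g \<and> P h"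
    then obtain a b where ab: "a \<in> sa" "b \<in> sa" "\<forall>\<omega>\<in>characters B. g \<omega> = Re (\<omega> a)"
      "\<forall>\<omega>\<in>characters B. h \<omega> = Re (\<omega> b)" "continuous_on (characters B) g" "continuous_on (characters B) h"
      unfolding P_def by blast
    have "Re (\<omega> (a + b)) = Re (\<omega> a) + Re (\<omega> b)" "Re (\<omega> (a * b)) = Re (\<omega> a) * Re (\<omega> b)"
      if "\<omega> \<in> characters B" for \<omega>
      using that ab(1,2) character_real[OF that ab(1)] by (simp_all add: characters_def clinear_on_def sa_mem)
    then show "P (\<lambda>\<omega>. g \<omega> + h \<omega>)" "P (\<lambda>\<omega>. g \<omega> * h \<omega>)"
      using ab(3,4) unfolding P_def
      by (intro conjI continuous_intros ab(5,6) bexI[of _ "a + b"] bexI[of _ "a * b"] sa_add sa_mult ab(1,2),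
        simp)+
  next
    fix \<omega> \<omega>' assume o: "\<omega> \<in> characters B \<and> \<omega>' \<in> characters B \<and> \<omega> \<noteq> \<omega>'"
    then obtain a where "\<omega> a \<noteq> \<omega>' a" by blast
    moreover from this o have a: "a \<in> B" by (auto simp: characters_def)
    ultimately have "Re (\<omega> (re_part a)) \<noteq> Re (\<omega>' (re_part a)) \<or> Re (\<omega> (im_part a)) \<noteq> Re (\<omega>' (im_part a))"
      using character_parts[of \<omega> a] character_parts[of \<omega>' a] o by auto
    moreover have "P (\<lambda>\<omega>. Re (\<omega> b))" if "b \<in> sa" for b
      using that unfolding P_def by (auto intro!: continuous_intros)
    ultimately show "\<exists>g. P g \<and> g \<omega> \<noteq> g \<omega>'"
      using re_part_sa[OF a] im_part_sa[OF a] by blast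
  qed (use f e in \<open>auto simp: spectrum_eq\<close>)
  then show ?thesis using that unfolding P_def by (metis sa_mem)
qed

text \<open>Gluing requires equal middle marginals as measures, whereas the definition of a coupling
  only says that they represent the same state. Density lets the state determine all integrals of
  continuous functions.\<close>

lemma represents_unique:
  assumes m: "represents B m \<mu>" and m': "represents B m' \<mu>"
  shows "m = m'"
proof (rule radon_prob_unique[OF compact_spectrum Hausdorff_spectrum representsD(1)[OF m] representsD(1)[OF m']])
  fix f assume f: "f \<in> cfun (spectrum B)"
  have close: "\<bar>(\<integral>\<omega>. f \<omega> \<partial>n) - Re (\<mu> a)\<bar> \<le> e"
    if n: "represents B n \<mu>" and a: "a \<in> B" "\<And>\<omega>. \<omega> \<in> characters B \<Longrightarrow> \<bar>f \<omega> - Re (\<omega> a)\<bar> < e" for n a e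
  proof -
    note rn = representsD(1)[OF n]
    interpret prob_space n using rn by (rule radon_prob_prob_space)
    have int: "integrable n f" "integrable n (\<lambda>\<omega>. Re (\<omega> a))" "integrable n (\<lambda>\<omega>. \<omega> a)"
      using f continuous_map_spectrum_evaluation by (auto intro!: radon_prob_integrable[OF compact_spectrum rn])
    have sp: "space n = characters B" using radon_prob_space[OF rn] topspace_spectrum by simp
    have "Re (\<mu> a) = (\<integral>\<omega>. Re (\<omega> a) \<partial>n)"
      using representsD(2)[OF n a(1)] int(3) by (metis integral_Re)
    then have "\<bar>(\<integral>\<omega>. f \<omega> \<partial>n) - Re (\<mu> a)\<bar> = \<bar>(\<integral>\<omega>. f \<omega> - Re (\<omega> a) \<partial>n)\<bar>"
      using int by simp
    also have "\<dots> \<le> (\<integral>\<omega>. \<bar>f \<omega> - Re (\<omega> a)\<bar> \<partial>n)" by (rule integral_abs_bound)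
    also have "\<dots> \<le> (\<integral>\<omega>. e \<partial>n)"
      using int a(2) sp by (intro integral_mono) (auto intro: less_imp_le)
    also have "\<dots> = e" by (simp add: prob_space)
    finally show ?thesis .
  qed
  show "(\<integral>\<omega>. f \<omega> \<partial>m) = (\<integral>\<omega>. f \<omega> \<partial>m')"
  proof (rule ccontr)
    assume ne: "(\<integral>\<omega>. f \<omega> \<partial>m) \<noteq> (\<integral>\<omega>. f \<omega> \<partial>m')"
    define e where "e = \<bar>(\<integral>\<omega>. f \<omega> \<partial>m) - (\<integral>\<omega>. f \<omega> \<partial>m')\<bar> / 3"
    have e: "e > 0" using ne by (simp add: e_def)
    obtain a where a: "a \<in> B" "\<And>\<omega>. \<omega> \<in> characters B \<Longrightarrow> \<bar>f \<omega> - Re (\<omega> a)\<bar> < e"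
      using characters_dense[OF f e] by blast
    have "\<bar>(\<integral>\<omega>. f \<omega> \<partial>m) - Re (\<mu> a)\<bar> \<le> e" using m a by (rule close)
    moreover have "\<bar>(\<integral>\<omega>. f \<omega> \<partial>m') - Re (\<mu> a)\<bar> \<le> e" using m' a by (rule close)
    ultimately have "\<bar>(\<integral>\<omega>. f \<omega> \<partial>m) - (\<integral>\<omega>. f \<omega> \<partial>m')\<bar> \<le> 2 * e" by arith
    then show False using e unfolding e_def by simp
  qed
qed

end

section \<open>Gluing of couplings\<close>

text \<open>The extension theorem is applied to the sum of the two integrals, whose positivity is
  the only place where the common marginal enters. Testing with pairs (f, 0) and (0, f) then
  identifies the two projections of the resulting measure.\<close>

lemma radon_prob_gluing:
  fixes X :: "'b topology"
  assumes X: "compact_space X" "Hausdorff_space X"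
    and \<pi>: "radon_prob (prod_topology X X) \<pi>" and \<rho>: "radon_prob (prod_topology X X) \<rho>"
    and eq: "distr \<pi> (borel_on X) snd = distr \<rho> (borel_on X) fst"
  obtains m where "radon_prob (prod_topology X (prod_topology X X)) m"
    "distr m (borel_on (prod_topology X X)) (\<lambda>(x, y, z). (x, y)) = \<pi>"
    "distr m (borel_on (prod_topology X X)) (\<lambda>(x, y, z). (y, z)) = \<rho>"
proof -
  let ?X2 = "prod_topology X X" and ?X3 = "prod_topology X (prod_topology X X)"
  have X2: "compact_space ?X2" "Hausdorff_space ?X2" and X3: "compact_space ?X3" "Hausdorff_space ?X3"
    using X by (auto simp: compact_space_prod_topology Hausdorff_space_prod_topology)
  interpret \<pi>: prob_space \<pi> using \<pi> by (rule radon_prob_prob_space)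
  interpret \<rho>: prob_space \<rho> using \<rho> by (rule radon_prob_prob_space)
  have cp: "continuous_map ?X3 ?X2 (\<lambda>(x, y, z). (x, y))" and cr: "continuous_map ?X3 ?X2 (\<lambda>(x, y, z). (y, z))"
    unfolding case_prod_unfold
    by (intro continuous_map_pairedI continuous_map_fst continuous_map_snd
        continuous_map_compose[OF continuous_map_snd continuous_map_fst, unfolded o_def]
        continuous_map_compose[OF continuous_map_snd continuous_map_snd, unfolded o_def])+
  have snd\<pi>: "snd \<in> measurable \<pi> (borel_on X)" and fst\<rho>: "fst \<in> measurable \<rho> (borel_on X)"
    using continuous_map_borel_on[OF continuous_map_snd] continuous_map_borel_on[OF continuous_map_fst]
      measurable_cong_sets[OF radon_prob_sets[OF \<pi>] refl] measurable_cong_sets[OF radon_prob_sets[OF \<rho>] refl]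
    by blast+
  note sp = radon_prob_space[OF \<pi>] radon_prob_space[OF \<rho>]
  \<comment> \<open>Pairs instead of sums: a function of y alone can be moved from one summand to
    the other without changing f(x,y) + g(y,z).\<close>
  define S where "S = cfun ?X2 \<times> cfun ?X2"
  have cf: "subspace (cfun ?X2)"
    unfolding subspace_def zero_fun_def plus_fun_def scaleR_fun_def
    by (simp add: continuous_map_add continuous_map_real_mult_left)
  have S: "subspace S" unfolding S_def by (intro subspace_Times cf)
  have int: "integrable \<pi> f" "integrable \<rho> f" if "f \<in> cfun ?X2" for f
    using that radon_prob_integrable[OF X2(1) \<pi>] radon_prob_integrable[OF X2(1) \<rho>] by auto
  define l where "l p = (\<integral>z. fst p z \<partial>\<pi>) + (\<integral>z. snd p z \<partial>\<rho>)" for p :: "('b \<times> 'b \<Rightarrow> real) \<times> ('b \<times> 'b \<Rightarrow> real)"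
  define T where "T p w = fst p (fst w, fst (snd w)) + snd p (snd w)"
    for p :: "('b \<times> 'b \<Rightarrow> real) \<times> ('b \<times> 'b \<Rightarrow> real)" and w :: "'b \<times> 'b \<times> 'b"
  have pos: "0 \<le> l p" if p: "p \<in> S" "\<And>w. w \<in> topspace ?X3 \<Longrightarrow> 0 \<le> T p w" for p
  proof -
    obtain f g where fg: "p = (f, g)" "continuous_map ?X2 euclideanreal f" "continuous_map ?X2 euclideanreal g"
      using p(1) by (auto simp: S_def)
    have le: "- g (y, z) \<le> f (x, y)" if "x \<in> topspace X" "y \<in> topspace X" "z \<in> topspace X" for x y z
      using p(2)[of "(x, y, z)"] that by (simp add: T_def fg(1))
    have ne: "topspace X \<noteq> {}" using \<pi>.not_empty sp(1) by auto
    obtain M where M: "\<And>z. z \<in> topspace ?X2 \<Longrightarrow> norm (f z) \<le> M" using compact_space_bounded[OF X2(1) fg(2)] by blast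
    have Mb: "\<bar>f (x, y)\<bar> \<le> M" if "x \<in> topspace X" "y \<in> topspace X" for x y
      using M[of "(x, y)"] that by simp
    have bdd: "bdd_below ((\<lambda>x. f (x, y)) ` topspace X)" if "y \<in> topspace X" for y
      unfolding bdd_below_def using Mb[OF _ that] by (intro exI[of _ "- M"]) (fastforce simp: abs_le_iff)
    \<comment> \<open>\<phi> separates the two terms: - g (y, z) \<le> \<phi> y \<le> f (x, y).
      Depending on y only, it has the same integral under both couplings. As an infimum of
      continuous functions it is upper semicontinuous, hence Borel.\<close>
    define \<phi> where "\<phi> y = (INF x\<in>topspace X. f (x, y))" for y
    have lo: "\<phi> y \<le> f (x, y)" if "x \<in> topspace X" "y \<in> topspace X" for x y
      unfolding \<phi>_def using that bdd by (intro cINF_lower)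
    have hi: "c \<le> \<phi> y" if "\<And>x. x \<in> topspace X \<Longrightarrow> c \<le> f (x, y)" for y c
      unfolding \<phi>_def using ne that by (intro cINF_greatest)
    have "\<phi> \<in> borel_measurable (borel_on X)"
    proof (rule borel_measurableI_less)
      fix c
      have "openin X {y \<in> topspace X. f (x, y) < c}" if "x \<in> topspace X" for x
      proof -
        have "continuous_map X ?X2 (\<lambda>y. (x, y))" using that by (intro continuous_map_pairedI) auto
        then have "continuous_map X euclideanreal (f \<circ> (\<lambda>y. (x, y)))" using fg(2) by (rule continuous_map_compose)
        from openin_continuous_map_preimage[OF this, of "{..<c}"] show ?thesis by simp
      qed
      then have "openin X (\<Union>x\<in>topspace X. {y \<in> topspace X. f (x, y) < c})" by (intro openin_Union) auto
      moreover have "{y \<in> space (borel_on X). \<phi> y < c} = (\<Union>x\<in>topspace X. {y \<in> topspace X. f (x, y) < c})"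
        using bdd ne by (auto simp: \<phi>_def cINF_less_iff)
      ultimately show "{y \<in> space (borel_on X). \<phi> y < c} \<in> sets (borel_on X)"
        using openin_sets_borel_on by metis
    qed
    note \<phi>m = this
    have bound: "norm (\<phi> y) \<le> M" if "y \<in> topspace X" for y
    proof -
      obtain x where x: "x \<in> topspace X" using ne by blast
      have "- M \<le> \<phi> y" using Mb[OF _ that] by (intro hi) (simp add: abs_le_iff minus_le_iff)
      moreover have "\<phi> y \<le> M" using lo[OF x that] Mb[OF x that] by simp
      ultimately have "- M \<le> \<phi> y" "\<phi> y \<le> M" by simp_all
      then show ?thesis by simp
    qed
    have \<phi>int: "integrable \<pi> (\<lambda>z. \<phi> (snd z))" "integrable \<rho> (\<lambda>z. \<phi> (fst z))"
      by (rule \<pi>.integrable_const_bound[where B=M] \<rho>.integrable_const_bound[where B=M],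
        use bound sp measurable_compose[OF snd\<pi> \<phi>m] measurable_compose[OF fst\<rho> \<phi>m] in auto)+
    have "(\<integral>z. \<phi> (snd z) \<partial>\<pi>) \<le> (\<integral>z. f z \<partial>\<pi>)"
      using lo sp int(1)[of f] fg(2) \<phi>int by (intro integral_mono) auto
    moreover have "(\<integral>z. - \<phi> (fst z) \<partial>\<rho>) \<le> (\<integral>z. g z \<partial>\<rho>)"
    proof (rule integral_mono)
      fix z assume "z \<in> space \<rho>"
      then have "- g (fst z, snd z) \<le> \<phi> (fst z)" using le sp by (intro hi) auto
      then show "- \<phi> (fst z) \<le> g z" by simp
    qed (use int(2)[of g] fg(3) \<phi>int in auto)
    moreover have "(\<integral>z. \<phi> (snd z) \<partial>\<pi>) = (\<integral>y. \<phi> y \<partial>(distr \<pi> (borel_on X) snd))"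
      using integral_distr[OF snd\<pi> \<phi>m] by simp
    moreover have "(\<integral>z. \<phi> (fst z) \<partial>\<rho>) = (\<integral>y. \<phi> y \<partial>(distr \<rho> (borel_on X) fst))"
      using integral_distr[OF fst\<rho> \<phi>m] by simp
    ultimately show ?thesis using eq by (simp add: l_def fg(1))
  qed
  have Tc: "T p \<in> cfun ?X3" if "p \<in> S" for p
  proof -
    have p: "continuous_map ?X2 euclideanreal (fst p)" "continuous_map ?X2 euclideanreal (snd p)"
      using that by (auto simp: S_def)
    from continuous_map_add[OF continuous_map_compose[OF cp p(1)] continuous_map_compose[OF cr p(2)]] show ?thesis
      by (simp add: o_def T_def[abs_def] case_prod_unfold)
  qed
  obtain m where m: "radon_prob ?X3 m" "\<And>p. p \<in> S \<Longrightarrow> (\<integral>w. T p w \<partial>m) = l p"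
  proof (rule radon_prob_extension[OF X3 S])
    show "T p \<in> cfun ?X3" if "p \<in> S" for p using that by (rule Tc)
    show "0 \<le> l p" if "p \<in> S" "\<And>w. w \<in> topspace ?X3 \<Longrightarrow> 0 \<le> T p w" for p
      using that by (rule pos)
    show "T (p + q) w = T p w + T q w" "T (r *\<^sub>R p) w = r * T p w" for p q w r
      by (simp_all add: T_def plus_fun_def scaleR_fun_def algebra_simps)
    show "rlinear_on S l"
      using int by (auto simp: rlinear_on_def l_def S_def plus_fun_def scaleR_fun_def algebra_simps)
    show "(\<lambda>_. 1, \<lambda>_. 0) \<in> S" "\<And>w. T (\<lambda>_. 1, \<lambda>_. 0) w = 1" "l (\<lambda>_. 1, \<lambda>_. 0) = 1"
      by (simp_all add: S_def T_def l_def \<pi>.prob_space)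
  qed (rule that)
  have meas: "h \<in> measurable m (borel_on ?X2)" if "continuous_map ?X3 ?X2 h" for h
    using continuous_map_borel_on[OF that] measurable_cong_sets[OF radon_prob_sets[OF m(1)] refl] by blast
  have "distr m (borel_on ?X2) (\<lambda>(x, y, z). (x, y)) = \<pi>"
  proof (rule radon_prob_unique[OF X2 radon_prob_distr[OF m(1) cp X2(2)] \<pi>])
    fix f assume f: "f \<in> cfun ?X2"
    have "(\<integral>w. f w \<partial>distr m (borel_on ?X2) (\<lambda>(x, y, z). (x, y))) = (\<integral>w. T (f, \<lambda>_. 0) w \<partial>m)"
      using f by (subst integral_distr[OF meas[OF cp]])
        (auto simp: T_def[abs_def] case_prod_unfold intro: continuous_map_borel_measurable)
    also have "\<dots> = (\<integral>z. f z \<partial>\<pi>)" using m(2)[of "(f, \<lambda>_. 0)"] f by (simp add: S_def l_def)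
    finally show "(\<integral>w. f w \<partial>distr m (borel_on ?X2) (\<lambda>(x, y, z). (x, y))) = (\<integral>z. f z \<partial>\<pi>)" .
  qed
  moreover have "distr m (borel_on ?X2) (\<lambda>(x, y, z). (y, z)) = \<rho>"
  proof (rule radon_prob_unique[OF X2 radon_prob_distr[OF m(1) cr X2(2)] \<rho>])
    fix f assume f: "f \<in> cfun ?X2"
    have "(\<integral>w. f w \<partial>distr m (borel_on ?X2) (\<lambda>(x, y, z). (y, z))) = (\<integral>w. T (\<lambda>_. 0, f) w \<partial>m)"
      using f by (subst integral_distr[OF meas[OF cr]])
        (auto simp: T_def[abs_def] case_prod_unfold intro: continuous_map_borel_measurable)
    also have "\<dots> = (\<integral>z. f z \<partial>\<rho>)" using m(2)[of "(\<lambda>_. 0, f)"] f by (simp add: S_def l_def)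
    finally show "(\<integral>w. f w \<partial>distr m (borel_on ?X2) (\<lambda>(x, y, z). (y, z))) = (\<integral>z. f z \<partial>\<rho>)" .
  qed
  ultimately show ?thesis using that m(1) by blast
qed

section \<open>The Wasserstein pseudo-distances\<close>

lemma ennreal_powr_mono: "0 < p \<Longrightarrow> x \<le> y \<Longrightarrow> ennreal_powr x p \<le> ennreal_powr y p"
  unfolding ennreal_powr_def
  by (auto simp: less_top intro!: ennreal_leI powr_mono2 enn2real_mono dest: top_le)

lemma ennreal_powr_zero [simp]: "ennreal_powr 0 p = 0"
  by (simp add: ennreal_powr_def)

lemma ennreal_powr_ennreal: "0 \<le> a \<Longrightarrow> ennreal_powr (ennreal a) p = ennreal (a powr p)"
  by (simp add: ennreal_powr_def)

lemma ennreal_powr_top [simp]: "ennreal_powr top p = top"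
  by (simp add: ennreal_powr_def)

lemma ennreal_powr_measurable [measurable]: "(\<lambda>x. ennreal_powr x p) \<in> borel_measurable borel"
  unfolding ennreal_powr_def by measurable

text \<open>Convexity of the power at a / \<alpha> and b / \<beta>, with weights proportional to
  \<alpha> and \<beta>. With \<alpha> and \<beta> close to the two L^p norms, integration gives
  Minkowski's inequality.\<close>

lemma powr_add_le:
  fixes a b \<alpha> \<beta> p :: real
  assumes p: "1 \<le> p" and \<alpha>: "0 < \<alpha>" and \<beta>: "0 < \<beta>" and a: "0 \<le> a" and b: "0 \<le> b"
  shows "(a + b) powr p \<le> (\<alpha> + \<beta>) powr p * (\<alpha> / (\<alpha> + \<beta>) * (a / \<alpha>) powr p + \<beta> / (\<alpha> + \<beta>) * (b / \<beta>) powr p)"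
proof -
  define s t where "s = \<alpha> / (\<alpha> + \<beta>)" and "t = \<beta> / (\<alpha> + \<beta>)"
  have st: "0 < s" "0 < t" "s + t = 1" "s \<le> 1" "t \<le> 1"
    using \<alpha> \<beta> by (simp_all add: s_def t_def add_divide_distrib[symmetric])
  have conv: "(s * x + t * y) powr p \<le> s * x powr p + t * y powr p" if "0 \<le> x" "0 \<le> y" for x y
  proof -
    \<comment> \<open>Covers the case of a zero argument, which lies outside the open half-line
      where convexity is applied.\<close>
    have *: "(r * z) powr p \<le> r * z powr p" if "0 < r" "r \<le> 1" "0 \<le> z" for r z :: real
    proof -
      have "r powr p \<le> r powr 1" using that p by (intro powr_mono') auto
      then show ?thesis using that by (simp add: powr_mult mult_right_mono)
    qed
    consider "x = 0" | "y = 0" | "0 < x" "0 < y" using \<open>0 \<le> x\<close> \<open>0 \<le> y\<close> by linarith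
    then show ?thesis
    proof cases
      case 1
      then show ?thesis using *[OF st(2,5) \<open>0 \<le> y\<close>] p by simp
    next
      case 2
      then show ?thesis using *[OF st(1,4) \<open>0 \<le> x\<close>] p by simp
    next
      case 3
      have "(s *\<^sub>R x + t *\<^sub>R y) powr p \<le> s * x powr p + t * y powr p"
        using powr_convex[OF p] 3 st unfolding convex_on_def by (metis greaterThan_iff less_imp_le)
      then show ?thesis by simp
    qed
  qed
  have "a + b = (\<alpha> + \<beta>) * (s * (a / \<alpha>) + t * (b / \<beta>))"
    using \<alpha> \<beta> by (simp add: s_def t_def distrib_left)
  then have "(a + b) powr p = (\<alpha> + \<beta>) powr p * (s * (a / \<alpha>) + t * (b / \<beta>)) powr p"
    using \<alpha> \<beta> a b st by (simp add: powr_mult)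
  also have "\<dots> \<le> (\<alpha> + \<beta>) powr p * (s * (a / \<alpha>) powr p + t * (b / \<beta>) powr p)"
    using \<alpha> \<beta> a b by (intro mult_left_mono conv) auto
  finally show ?thesis by (simp add: s_def t_def)
qed

lemma nn_integral_Minkowski:
  fixes u v :: "'b \<Rightarrow> ennreal"
  assumes p: "1 \<le> p" and u: "u \<in> borel_measurable M" and v: "v \<in> borel_measurable M"
  shows "ennreal_powr (\<integral>\<^sup>+x. ennreal_powr (u x + v x) p \<partial>M) (1 / p)
    \<le> ennreal_powr (\<integral>\<^sup>+x. ennreal_powr (u x) p \<partial>M) (1 / p) + ennreal_powr (\<integral>\<^sup>+x. ennreal_powr (v x) p \<partial>M) (1 / p)"
proof (cases "(\<integral>\<^sup>+x. ennreal_powr (u x) p \<partial>M) = top \<or> (\<integral>\<^sup>+x. ennreal_powr (v x) p \<partial>M) = top")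
  case False
  then obtain U V where U: "0 \<le> U" "(\<integral>\<^sup>+x. ennreal_powr (u x) p \<partial>M) = ennreal U"
    and V: "0 \<le> V" "(\<integral>\<^sup>+x. ennreal_powr (v x) p \<partial>M) = ennreal V"
    by (metis ennreal_cases infinity_ennreal_def)
  show ?thesis
  proof (rule ennreal_le_epsilon)
    fix e :: real assume e: "e > 0"
    \<comment> \<open>The L^p norms of u and v, enlarged by e / 2 so that dividing by them makes
      sense even when a norm is 0.\<close>
    define \<alpha> \<beta> where "\<alpha> = U powr (1 / p) + e / 2" and "\<beta> = V powr (1 / p) + e / 2"
    have \<alpha>: "\<alpha> > 0" and \<beta>: "\<beta> > 0" using e by (simp_all add: \<alpha>_def \<beta>_def add_nonneg_pos)
    have pw: "(x powr (1 / p)) powr p = x" if "0 \<le> x" for x using p that by (simp add: powr_powr)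
    have "U \<le> \<alpha> powr p" "V \<le> \<beta> powr p"
      using powr_mono2[of p "U powr (1 / p)" \<alpha>] powr_mono2[of p "V powr (1 / p)" \<beta>] p e pw U(1) V(1)
      by (simp_all add: \<alpha>_def \<beta>_def)
    then have UV: "U / \<alpha> powr p \<le> 1" "V / \<beta> powr p \<le> 1" using \<alpha> \<beta> by (simp_all add: divide_le_eq_1)
    define c d where "c = (\<alpha> + \<beta>) powr p * (\<alpha> / (\<alpha> + \<beta>)) / \<alpha> powr p"
      and "d = (\<alpha> + \<beta>) powr p * (\<beta> / (\<alpha> + \<beta>)) / \<beta> powr p"
    have cd: "c > 0" "d > 0" using \<alpha> \<beta> by (simp_all add: c_def d_def)
    have pt: "ennreal_powr (x + y) p \<le> ennreal c * ennreal_powr x p + ennreal d * ennreal_powr y p" for x y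
    proof (cases x; cases y)
      fix a b assume xy: "0 \<le> a" "x = ennreal a" "0 \<le> b" "y = ennreal b"
      have "(a + b) powr p \<le> c * a powr p + d * b powr p"
        using powr_add_le[OF p \<alpha> \<beta> xy(1,3)] \<alpha> \<beta> xy
        by (simp add: c_def d_def powr_divide distrib_left)
      then show ?thesis using xy cd
        by (simp add: ennreal_powr_ennreal ennreal_plus[symmetric] ennreal_mult[symmetric] ennreal_leI
            del: ennreal_plus)
    qed (use cd in \<open>simp_all add: ennreal_mult_top\<close>)
    have "(\<integral>\<^sup>+x. ennreal_powr (u x + v x) p \<partial>M)
      \<le> (\<integral>\<^sup>+x. ennreal c * ennreal_powr (u x) p + ennreal d * ennreal_powr (v x) p \<partial>M)"
      by (intro nn_integral_mono pt)
    also have "\<dots> = ennreal c * ennreal U + ennreal d * ennreal V"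
      using u v by (simp add: nn_integral_add nn_integral_cmult U(2) V(2))
    also have "\<dots> = ennreal (c * U + d * V)"
      using cd U V by (simp add: ennreal_mult)
    also have "\<dots> \<le> ennreal ((\<alpha> + \<beta>) powr p)"
    proof (rule ennreal_leI)
      have "c * U + d * V = (\<alpha> + \<beta>) powr p * (\<alpha> / (\<alpha> + \<beta>)) * (U / \<alpha> powr p)
        + (\<alpha> + \<beta>) powr p * (\<beta> / (\<alpha> + \<beta>)) * (V / \<beta> powr p)"
        by (simp add: c_def d_def)
      also have "\<dots> \<le> (\<alpha> + \<beta>) powr p * (\<alpha> / (\<alpha> + \<beta>)) * 1 + (\<alpha> + \<beta>) powr p * (\<beta> / (\<alpha> + \<beta>)) * 1"
        using \<alpha> \<beta> UV by (intro add_mono mult_left_mono) auto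
      also have "\<dots> = (\<alpha> + \<beta>) powr p * (\<alpha> / (\<alpha> + \<beta>) + \<beta> / (\<alpha> + \<beta>))" by (simp only: mult_1_right distrib_left)
      also have "\<alpha> / (\<alpha> + \<beta>) + \<beta> / (\<alpha> + \<beta>) = 1" using \<alpha> \<beta> by (simp add: add_divide_distrib[symmetric])
      finally show "c * U + d * V \<le> (\<alpha> + \<beta>) powr p" by simp
    qed
    finally have "ennreal_powr (\<integral>\<^sup>+x. ennreal_powr (u x + v x) p \<partial>M) (1 / p)
      \<le> ennreal_powr (ennreal ((\<alpha> + \<beta>) powr p)) (1 / p)"
      using p by (intro ennreal_powr_mono) auto
    also have "\<dots> = ennreal (\<alpha> + \<beta>)" using \<alpha> \<beta> p by (simp add: ennreal_powr_ennreal powr_powr)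
    also have "\<alpha> + \<beta> = U powr (1 / p) + V powr (1 / p) + e" by (simp add: \<alpha>_def \<beta>_def)
    finally show "ennreal_powr (\<integral>\<^sup>+x. ennreal_powr (u x + v x) p \<partial>M) (1 / p)
      \<le> ennreal_powr (\<integral>\<^sup>+x. ennreal_powr (u x) p \<partial>M) (1 / p)
        + ennreal_powr (\<integral>\<^sup>+x. ennreal_powr (v x) p \<partial>M) (1 / p) + ennreal e"
      using e by (simp add: U V ennreal_powr_ennreal)
  qed
qed auto

section \<open>Transport costs of couplings\<close>

definition transport_cost :: "real \<Rightarrow> ('b \<Rightarrow> 'b \<Rightarrow> ennreal) \<Rightarrow> ('b \<times> 'b) measure \<Rightarrow> ennreal" where
  "transport_cost p d \<pi> = ennreal_powr (\<integral>\<^sup>+(x, y). ennreal_powr (d x y) p \<partial>\<pi>) (1 / p)"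

lemma wasserstein_eq: "wasserstein p L B \<mu> \<nu> = (INF \<pi>\<in>couplings B \<mu> \<nu>. transport_cost p (dist_L L B) \<pi>)"
  by (simp add: wasserstein_def transport_cost_def)

lemma dist_L_sym: "dist_L L B \<mu> \<nu> = dist_L L B \<nu> \<mu>"
  and dist_L_self: "dist_L L B \<mu> \<mu> = 0"
  and dist_L_triangle: "dist_L L B \<mu> \<kappa> \<le> dist_L L B \<mu> \<nu> + dist_L L B \<nu> \<kappa>"
  using dist_L_pseudo_dist[of UNIV L B] unfolding pseudo_dist_on_def by blast+

text \<open>A supremum of continuous functions over a possibly uncountable family: its strict
  superlevel sets are unions of open sets. The sigma-algebra is that of the product topology, on
  which couplings live.\<close>

lemma dist_L_measurable:
  "(\<lambda>(x, y). dist_L L B x y) \<in> borel_measurable (borel_on (prod_topology (spectrum B) (spectrum B)))"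
proof (rule borel_measurable_open_superlevel)
  fix c
  let ?X2 = "prod_topology (spectrum B) (spectrum B)"
  let ?F = "{f \<in> B \<inter> self_adjoint. L f \<le> 1}"
  have "openin ?X2 {z \<in> topspace ?X2. c < ennreal (cmod (fst z f - snd z f))}" for f
  proof -
    have "continuous_on (characters B \<times> characters B) (\<lambda>z. fst z f)"
      "continuous_on (characters B \<times> characters B) (\<lambda>z. snd z f)"
      by (rule continuous_on_compose2[OF continuous_on_evaluation[of UNIV]];
          auto intro: continuous_on_fst continuous_on_snd continuous_on_id)+
    then have "continuous_on (characters B \<times> characters B) (\<lambda>z. ennreal (cmod (fst z f - snd z f)))"
      by (intro continuous_on_ennreal continuous_intros)
    then have "continuous_map ?X2 euclidean (\<lambda>z. ennreal (cmod (fst z f - snd z f)))"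
      by (simp add: spectrum_eq)
    from openin_continuous_map_preimage[OF this, of "{c<..}"] show ?thesis by simp
  qed
  then have "openin ?X2 (\<Union>f\<in>?F. {z \<in> topspace ?X2. c < ennreal (cmod (fst z f - snd z f))})"
    by (intro openin_Union) auto
  moreover have "{z \<in> topspace ?X2. c < (case z of (x, y) \<Rightarrow> dist_L L B x y)}
      = (\<Union>f\<in>?F. {z \<in> topspace ?X2. c < ennreal (cmod (fst z f - snd z f))})"
    by (auto simp: dist_L_def less_SUP_iff)
  ultimately show "openin ?X2 {z \<in> topspace ?X2. c < (case z of (x, y) \<Rightarrow> dist_L L B x y)}" by simp
qed

lemma cost_measurable:
  "(\<lambda>(x, y). ennreal_powr (dist_L L B x y) p) \<in> borel_measurable (borel_on (prod_topology (spectrum B) (spectrum B)))"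
  using measurable_compose[OF dist_L_measurable ennreal_powr_measurable] by (simp add: case_prod_unfold)

lemma measurable_radon:
  assumes "radon_prob X m" "continuous_map X Y h"
  shows "h \<in> measurable m (borel_on Y)"
  using continuous_map_borel_on[OF assms(2)] measurable_cong_sets[OF radon_prob_sets[OF assms(1)] refl] by blast

lemma transport_cost_distr:
  assumes "h \<in> measurable m (borel_on (prod_topology (spectrum B) (spectrum B)))"
  shows "transport_cost p (dist_L L B) (distr m (borel_on (prod_topology (spectrum B) (spectrum B))) h)
    = ennreal_powr (\<integral>\<^sup>+w. ennreal_powr (dist_L L B (fst (h w)) (snd (h w))) p \<partial>m) (1 / p)"
  unfolding transport_cost_def
  by (subst nn_integral_distr[OF assms]) (simp_all add: case_prod_unfold cost_measurable[unfolded case_prod_unfold])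

lemma distr_distr_radon:
  assumes "radon_prob X m" "continuous_map X Y g" "continuous_map Y Z h"
  shows "distr (distr m (borel_on Y) g) (borel_on Z) h = distr m (borel_on Z) (\<lambda>x. h (g x))"
  using distr_distr[OF continuous_map_borel_on[OF assms(3)] measurable_radon[OF assms(1,2)]]
  by (simp add: o_def)

context comm_subalg
begin

abbreviation spectrum2 :: "(('a \<Rightarrow> complex) \<times> ('a \<Rightarrow> complex)) topology" where
  "spectrum2 \<equiv> prod_topology (spectrum B) (spectrum B)"

lemma Hausdorff_spectrum2: "Hausdorff_space spectrum2"
  by (simp add: Hausdorff_space_prod_topology Hausdorff_spectrum)

text \<open>The diagonal image of a representing measure has cost 0. Its existence matters: over an
  empty set of couplings the infimum would be infinite.\<close>

lemma wasserstein_self: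
  assumes "\<mu> \<in> states B" and p: "1 \<le> p"
  shows "wasserstein p L B \<mu> \<mu> = 0"
proof -
  obtain m where m: "represents B m \<mu>" using represents_exists[OF assms(1)] .
  note rm = representsD(1)[OF m]
  have c: "continuous_map (spectrum B) spectrum2 (\<lambda>x. (x, x))"
    by (intro continuous_map_pairedI) auto
  define \<pi> where "\<pi> = distr m (borel_on spectrum2) (\<lambda>x. (x, x))"
  have "distr m (borel_on (spectrum B)) (\<lambda>x. x) = m"
    using radon_prob_sets[OF rm] by (rule distr_id2[OF sym])
  then have "\<pi> \<in> couplings B \<mu> \<mu>"
    unfolding couplings_def \<pi>_def
    using m radon_prob_distr[OF rm c Hausdorff_spectrum2]
    by (simp add: distr_distr_radon[OF rm c continuous_map_fst] distr_distr_radon[OF rm c continuous_map_snd])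
  then have "wasserstein p L B \<mu> \<mu> \<le> transport_cost p (dist_L L B) \<pi>"
    unfolding wasserstein_eq by (rule INF_lower)
  also have "\<dots> = 0"
    unfolding \<pi>_def transport_cost_distr[OF measurable_radon[OF rm c]] by (simp add: dist_L_self)
  finally show ?thesis by simp
qed

lemma wasserstein_sym_le: "wasserstein p L B \<mu> \<nu> \<le> wasserstein p L B \<nu> \<mu>"
  unfolding wasserstein_eq[of p L B \<nu>]
proof (rule INF_greatest)
  fix \<pi> assume \<pi>: "\<pi> \<in> couplings B \<nu> \<mu>"
  then have r: "radon_prob spectrum2 \<pi>" by (simp add: couplings_def)
  have c: "continuous_map spectrum2 spectrum2 prod.swap"
    unfolding prod.swap_def by (intro continuous_map_pairedI continuous_map_fst continuous_map_snd)
  define \<rho> where "\<rho> = distr \<pi> (borel_on spectrum2) prod.swap"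
  have "\<rho> \<in> couplings B \<mu> \<nu>"
    unfolding couplings_def \<rho>_def
    using \<pi> radon_prob_distr[OF r c Hausdorff_spectrum2]
    by (simp add: distr_distr_radon[OF r c continuous_map_fst] distr_distr_radon[OF r c continuous_map_snd]
        couplings_def)
  then have "wasserstein p L B \<mu> \<nu> \<le> transport_cost p (dist_L L B) \<rho>"
    unfolding wasserstein_eq by (rule INF_lower)
  also have "\<dots> = transport_cost p (dist_L L B) \<pi>"
    unfolding \<rho>_def transport_cost_distr[OF measurable_radon[OF r c]]
    by (simp add: transport_cost_def case_prod_unfold dist_L_sym)
  finally show "wasserstein p L B \<mu> \<nu> \<le> transport_cost p (dist_L L B) \<pi>" .
qed

lemma transport_cost_triangle:
  assumes p: "1 \<le> p" and \<pi>: "\<pi> \<in> couplings B \<mu> \<nu>" and \<rho>: "\<rho> \<in> couplings B \<nu> \<kappa>"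
  shows "wasserstein p L B \<mu> \<kappa> \<le> transport_cost p (dist_L L B) \<pi> + transport_cost p (dist_L L B) \<rho>"
proof -
  let ?X3 = "prod_topology (spectrum B) spectrum2"
  have r: "radon_prob spectrum2 \<pi>" "radon_prob spectrum2 \<rho>" using \<pi> \<rho> by (simp_all add: couplings_def)
  \<comment> \<open>Both marginals represent \<nu>, so uniqueness of representing measures
    identifies them.\<close>
  have "distr \<pi> (borel_on (spectrum B)) snd = distr \<rho> (borel_on (spectrum B)) fst"
    using \<pi> \<rho> unfolding couplings_def by (intro represents_unique) auto
  then obtain m where m: "radon_prob ?X3 m" "distr m (borel_on spectrum2) (\<lambda>(x, y, z). (x, y)) = \<pi>"
    "distr m (borel_on spectrum2) (\<lambda>(x, y, z). (y, z)) = \<rho>"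
    using radon_prob_gluing[OF compact_spectrum Hausdorff_spectrum r] by blast
  have y: "continuous_map ?X3 (spectrum B) (\<lambda>w. fst (snd w))" and z: "continuous_map ?X3 (spectrum B) (\<lambda>w. snd (snd w))"
    using continuous_map_compose[OF continuous_map_snd continuous_map_fst]
      continuous_map_compose[OF continuous_map_snd continuous_map_snd] by (auto simp: o_def)
  have c12: "continuous_map ?X3 spectrum2 (\<lambda>(x, y, z). (x, y))"
    and c23: "continuous_map ?X3 spectrum2 (\<lambda>(x, y, z). (y, z))"
    and c13: "continuous_map ?X3 spectrum2 (\<lambda>(x, y, z). (x, z))"
    unfolding case_prod_unfold by (intro continuous_map_pairedI continuous_map_fst y z)+
  define \<sigma> where "\<sigma> = distr m (borel_on spectrum2) (\<lambda>(x, y, z). (x, z))"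
  have "distr \<sigma> (borel_on (spectrum B)) fst = distr \<pi> (borel_on (spectrum B)) fst"
    unfolding \<sigma>_def m(2)[symmetric] distr_distr_radon[OF m(1) c13 continuous_map_fst]
      distr_distr_radon[OF m(1) c12 continuous_map_fst] by (simp add: case_prod_unfold)
  moreover have "distr \<sigma> (borel_on (spectrum B)) snd = distr \<rho> (borel_on (spectrum B)) snd"
    unfolding \<sigma>_def m(3)[symmetric] distr_distr_radon[OF m(1) c13 continuous_map_snd]
      distr_distr_radon[OF m(1) c23 continuous_map_snd] by (simp add: case_prod_unfold)
  ultimately have "\<sigma> \<in> couplings B \<mu> \<kappa>"
    using \<pi> \<rho> radon_prob_distr[OF m(1) c13 Hausdorff_spectrum2] by (simp add: couplings_def \<sigma>_def)
  then have "wasserstein p L B \<mu> \<kappa> \<le> transport_cost p (dist_L L B) \<sigma>"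
    unfolding wasserstein_eq by (rule INF_lower)
  also have "\<dots> = ennreal_powr (\<integral>\<^sup>+w. ennreal_powr (dist_L L B (fst w) (snd (snd w))) p \<partial>m) (1 / p)"
    unfolding \<sigma>_def transport_cost_distr[OF measurable_radon[OF m(1) c13]] by (simp add: case_prod_unfold)
  also have "\<dots> \<le> ennreal_powr (\<integral>\<^sup>+w. ennreal_powr
      (dist_L L B (fst w) (fst (snd w)) + dist_L L B (fst (snd w)) (snd (snd w))) p \<partial>m) (1 / p)"
    using p by (intro ennreal_powr_mono nn_integral_mono dist_L_triangle) auto
  also have "\<dots> \<le> ennreal_powr (\<integral>\<^sup>+w. ennreal_powr (dist_L L B (fst w) (fst (snd w))) p \<partial>m) (1 / p)
      + ennreal_powr (\<integral>\<^sup>+w. ennreal_powr (dist_L L B (fst (snd w)) (snd (snd w))) p \<partial>m) (1 / p)"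
    using measurable_compose[OF measurable_radon[OF m(1) c12] dist_L_measurable]
      measurable_compose[OF measurable_radon[OF m(1) c23] dist_L_measurable]
    by (intro nn_integral_Minkowski p) (simp_all add: case_prod_unfold)
  also have "\<dots> = transport_cost p (dist_L L B) \<pi> + transport_cost p (dist_L L B) \<rho>"
    unfolding m(2)[symmetric] m(3)[symmetric] transport_cost_distr[OF measurable_radon[OF m(1) c12]]
      transport_cost_distr[OF measurable_radon[OF m(1) c23]]
    by (simp add: case_prod_unfold)
  finally show ?thesis .
qed

lemma wasserstein_triangle:
  assumes p: "1 \<le> p"
  shows "wasserstein p L B \<mu> \<kappa> \<le> wasserstein p L B \<mu> \<nu> + wasserstein p L B \<nu> \<kappa>"
proof (cases "wasserstein p L B \<mu> \<nu> = top \<or> wasserstein p L B \<nu> \<kappa> = top")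
  case False
  show ?thesis
  proof (rule ennreal_le_epsilon)
    fix e :: real assume e: "e > 0"
    obtain \<pi> where \<pi>: "\<pi> \<in> couplings B \<mu> \<nu>"
      "transport_cost p (dist_L L B) \<pi> < wasserstein p L B \<mu> \<nu> + ennreal (e / 2)"
      using INF_approx_ennreal[OF _ wasserstein_eq[of p L B \<mu> \<nu>], of "e / 2"] False e by auto
    obtain \<rho> where \<rho>: "\<rho> \<in> couplings B \<nu> \<kappa>"
      "transport_cost p (dist_L L B) \<rho> < wasserstein p L B \<nu> \<kappa> + ennreal (e / 2)"
      using INF_approx_ennreal[OF _ wasserstein_eq[of p L B \<nu> \<kappa>], of "e / 2"] False e by auto
    have "wasserstein p L B \<mu> \<kappa> \<le> transport_cost p (dist_L L B) \<pi> + transport_cost p (dist_L L B) \<rho>"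
      using p \<pi>(1) \<rho>(1) by (rule transport_cost_triangle)
    also have "\<dots> \<le> (wasserstein p L B \<mu> \<nu> + ennreal (e / 2)) + (wasserstein p L B \<nu> \<kappa> + ennreal (e / 2))"
      using \<pi>(2) \<rho>(2) by (intro add_mono less_imp_le)
    also have "\<dots> = wasserstein p L B \<mu> \<nu> + wasserstein p L B \<nu> \<kappa> + (ennreal (e / 2) + ennreal (e / 2))"
      by (simp only: ac_simps)
    also have "ennreal (e / 2) + ennreal (e / 2) = ennreal e"
      using e by (simp add: ennreal_plus[symmetric] del: ennreal_plus)
    finally show "wasserstein p L B \<mu> \<kappa> \<le> wasserstein p L B \<mu> \<nu> + wasserstein p L B \<nu> \<kappa> + ennreal e" .
  qed
qed auto

lemma wasserstein_pseudo_dist: "1 \<le> p \<Longrightarrow> pseudo_dist_on (states B) (wasserstein p L B)"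
  unfolding pseudo_dist_on_def
  by (intro conjI ballI wasserstein_self wasserstein_triangle antisym wasserstein_sym_le)

end

lemma restrict_character:
  assumes "\<omega> \<in> characters C" "B \<in> comm_subalgs" "B \<subseteq> C"
  shows "restrict_to B \<omega> \<in> characters B"
proof -
  interpret comm_subalg B by unfold_locales fact
  have m: "a \<in> B \<Longrightarrow> a \<in> C" for a using assms(3) by blast
  show ?thesis using assms(1) add_mem scaleC_mem mult_mem one_mem m
    by (auto simp: characters_def restrict_to_def clinear_on_def)
qed

text \<open>Restriction of characters pushes a coupling over C forward to one over B whose marginals
  represent the restricted states, and the integrand does not grow because \<open>dist_L\<close> is
  contracted pointwise.\<close>

lemma wasserstein_contraction:
  assumes p: "1 \<le> p" and B: "B \<in> comm_subalgs" and C: "C \<in> comm_subalgs" and BC: "B \<subseteq> C"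
  shows "wasserstein p L B (restrict_to B \<mu>) (restrict_to B \<nu>) \<le> wasserstein p L C \<mu> \<nu>"
  unfolding wasserstein_eq[of p L C]
proof (rule INF_greatest)
  fix \<pi> assume \<pi>: "\<pi> \<in> couplings C \<mu> \<nu>"
  interpret B: comm_subalg B by unfold_locales fact
  interpret C: comm_subalg C by unfold_locales fact
  have r: "radon_prob C.spectrum2 \<pi>" using \<pi> by (simp add: couplings_def)
  let ?r = "restrict_to B :: ('a \<Rightarrow> complex) \<Rightarrow> _"
  have cr: "continuous_map (spectrum C) (spectrum B) ?r"
    unfolding spectrum_eq by (rule continuous_restrict_to) (use restrict_character B BC in blast)
  have fst: "continuous_map C.spectrum2 (spectrum B) (\<lambda>z. ?r (fst z))"
    and snd: "continuous_map C.spectrum2 (spectrum B) (\<lambda>z. ?r (snd z))"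
    using continuous_map_compose[OF continuous_map_fst cr] continuous_map_compose[OF continuous_map_snd cr]
    by (auto simp: o_def)
  have c: "continuous_map C.spectrum2 B.spectrum2 (\<lambda>z. (?r (fst z), ?r (snd z)))"
    by (intro continuous_map_pairedI fst snd)
  define \<rho> where "\<rho> = distr \<pi> (borel_on B.spectrum2) (\<lambda>z. (?r (fst z), ?r (snd z)))"
  have rep: "represents B (distr m (borel_on (spectrum B)) ?r) (restrict_to B \<kappa>)"
    if m: "represents C m \<kappa>" for m \<kappa>
  proof -
    note rm = representsD(1)[OF m]
    have "(\<integral>\<omega>. \<omega> a \<partial>distr m (borel_on (spectrum B)) ?r) = \<kappa> a" if a: "a \<in> B" for a
    proof -
      have "(\<integral>\<omega>. \<omega> a \<partial>distr m (borel_on (spectrum B)) ?r) = (\<integral>\<omega>. ?r \<omega> a \<partial>m)"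
        using continuous_map_borel_measurable[OF B.continuous_map_spectrum_evaluation(1) refl]
        by (rule integral_distr[OF measurable_radon[OF rm cr]])
      also have "\<dots> = (\<integral>\<omega>. \<omega> a \<partial>m)" using a by (simp add: restrict_to_def)
      also have "\<dots> = \<kappa> a" using representsD(2)[OF m] a BC by auto
      finally show ?thesis .
    qed
    then show ?thesis
      using radon_prob_distr[OF rm cr B.Hausdorff_spectrum] by (simp add: represents_def restrict_to_def)
  qed
  have m1: "distr \<rho> (borel_on (spectrum B)) fst = distr (distr \<pi> (borel_on (spectrum C)) fst) (borel_on (spectrum B)) ?r"
    unfolding \<rho>_def distr_distr_radon[OF r c continuous_map_fst] distr_distr_radon[OF r continuous_map_fst cr] by simp
  have m2: "distr \<rho> (borel_on (spectrum B)) snd = distr (distr \<pi> (borel_on (spectrum C)) snd) (borel_on (spectrum B)) ?r"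
    unfolding \<rho>_def distr_distr_radon[OF r c continuous_map_snd] distr_distr_radon[OF r continuous_map_snd cr] by simp
  have "radon_prob B.spectrum2 \<rho>"
    unfolding \<rho>_def by (rule radon_prob_distr[OF r c B.Hausdorff_spectrum2])
  then have "\<rho> \<in> couplings B (restrict_to B \<mu>) (restrict_to B \<nu>)"
    unfolding couplings_def mem_Collect_eq m1 m2 using \<pi> rep by (simp add: couplings_def)
  then have "wasserstein p L B (restrict_to B \<mu>) (restrict_to B \<nu>) \<le> transport_cost p (dist_L L B) \<rho>"
    unfolding wasserstein_eq by (rule INF_lower)
  also have "\<dots> = ennreal_powr (\<integral>\<^sup>+z. ennreal_powr (dist_L L B (?r (fst z)) (?r (snd z))) p \<partial>\<pi>) (1 / p)"
    unfolding \<rho>_def transport_cost_distr[OF measurable_radon[OF r c]] by simp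
  also have "\<dots> \<le> ennreal_powr (\<integral>\<^sup>+z. ennreal_powr (dist_L L C (fst z) (snd z)) p \<partial>\<pi>) (1 / p)"
    using p BC by (intro ennreal_powr_mono nn_integral_mono dist_L_contraction) auto
  also have "\<dots> = transport_cost p (dist_L L C) \<pi>" by (simp add: transport_cost_def case_prod_unfold)
  finally show "wasserstein p L B (restrict_to B \<mu>) (restrict_to B \<nu>) \<le> transport_cost p (dist_L L C) \<pi>" .
qed

lemma state_diagram_wasserstein:
  assumes "1 \<le> p" shows "state_diagram (wasserstein p L) (wasserstein_QS p L)"
proof
  fix B :: "'a set" assume "B \<in> comm_subalgs"
  then interpret comm_subalg B by unfold_locales
  show "pseudo_dist_on (states B) (wasserstein p L B)" using assms by (rule wasserstein_pseudo_dist)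
qed (use assms wasserstein_contraction in \<open>simp_all add: wasserstein_QS_def\<close>)

theorem mainTheorem4:
  fixes L :: "'a::cstar_algebra \<Rightarrow> ennreal" and p :: real
  assumes "L_seminorm L" and "1 \<le> p"
  shows "cchpd_diagram comm_subalgs (\<subseteq>) (\<lambda>B. (state_space B, dist_L L B))
           (\<lambda>C B. restrict_to B) \<and>
         cchpd_limit TYPE('c::real_vector) comm_subalgs (\<subseteq>) (\<lambda>B. (state_space B, dist_L L B))
           (\<lambda>C B. restrict_to B) (quasi_state_space, dist_L L UNIV) restrict_to \<and>
         cchpd_diagram comm_subalgs (\<subseteq>) (\<lambda>B. (state_space B, wasserstein p L B))
           (\<lambda>C B. restrict_to B) \<and>
         cchpd_limit TYPE('c) comm_subalgs (\<subseteq>) (\<lambda>B. (state_space B, wasserstein p L B))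
           (\<lambda>C B. restrict_to B) (quasi_state_space, wasserstein_QS p L) restrict_to"
proof -
  interpret L: state_diagram "dist_L L" "dist_L L UNIV" by (rule state_diagram_dist_L)
  interpret W: state_diagram "wasserstein p L" "wasserstein_QS p L"
    using assms(2) by (rule state_diagram_wasserstein)
  show ?thesis by (intro conjI L.diagram L.limit W.diagram W.limit)
qed

end
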